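(* Let $\mathbb{F}\in\{\mathbb{R},\mathbb{C}\}$ and fix a matrix $Q\in\mathbb{F}^{d\times r}$ with orthonormal columns and coherence $\mu(Q)$. For some choice of embedding dimension $k = O(r)$ and column sparsity $\xi = O\big(\tfrac{d}{r}\mu(Q)\log r\big)$ (with universal constants hidden in $O(\cdot)$), a random SparseCol matrix $S\in\mathbb{F}^{d\times k}$ satisfies \[ \sigma_{\min}^2(S^*Q)\ge 1/2\quad\text{with probability at least } 39/40 . \]
   Context: The coherence of $Q$ is $\mu(Q) = \max_{1\le i\le d}\|e_i^*Q\|_2^2$. SparseCol with column sparsity $\xi\in\mathbb{N}$: $S = k^{-1/2}[\omega_1,\dots,\omega_k]$ where $\omega_j$ are iid copies of $\omega=\sqrt{d/\xi}\sum_{i=1}^\xi \varrho_i e_{s_i}\in\mathbb{F}^d$, with $\varrho_i$ iid Rademacher ($\pm1$ equiprobable), $s_1,\dots,s_\xi$ sampled uniformly from $\{1,\dots,d\}$ without replacement, $e_i$ standard basis vectors. $\sigma_{\min}(M)=\min_{\|u\|_2=1}\|Mu\|_2$; $^*$ is conjugate transpose. *)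

theory Defs
  imports "HOL-Probability.Probability" "Jordan_Normal_Form.Schur_Decomposition"
begin

unbundle no vec_syntax
hide_const (open) Finite_Cartesian_Product.vec Finite_Cartesian_Product.row
  Finite_Cartesian_Product.mat

text \<open>
  Dimensions are natural numbers (vectors and matrices of \<^theory>\<open>Jordan_Normal_Form.Matrix\<close>)
  rather than types, so that a constant can be chosen before all dimensions.
  The scalar type is meant to be \<^typ>\<open>real\<close> or \<^typ>\<open>complex\<close>, where \<^const>\<open>mat_adjoint\<close> is
  the (conjugate) transpose.
\<close>

definition l2_norm :: "'a :: real_normed_vector vec \<Rightarrow> real" where
  "l2_norm v = L2_set (\<lambda>i. norm (v $ i)) {..<dim_vec v}"

definition orthonormal_columns :: "'a :: conjugatable_field mat \<Rightarrow> bool" where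
  "orthonormal_columns Q \<longleftrightarrow> mat_adjoint Q * Q = 1\<^sub>m (dim_col Q)"

text \<open>The row vector \<open>e\<^sub>i\<^sup>* Q\<close> is the \<open>i\<close>-th row of \<open>Q\<close>.\<close>

definition coherence :: "'a :: real_normed_vector mat \<Rightarrow> real" where
  "coherence Q = (MAX i\<in>{..<dim_row Q}. (l2_norm (row Q i))\<^sup>2)"

text \<open>
  The minimum is attained, by compactness of the unit sphere, as soon as the matrix has a column;
  it is therefore written as an infimum.
\<close>

definition sigma_min :: "'a :: real_normed_field mat \<Rightarrow> real" where
  "sigma_min M = (INF u\<in>{u \<in> carrier_vec (dim_col M). l2_norm u = 1}. l2_norm (M *\<^sub>v u))"

text \<open>
  Coordinates are counted from \<open>0\<close>.  A sample of size \<open>\<xi>\<close> without replacement is an ordered list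
  of \<open>\<xi>\<close> distinct coordinates, drawn independently of the signs; such lists exist only for
  \<open>\<xi> \<le> d\<close>, and outside \<open>1 \<le> \<xi> \<le> d\<close> the definition has no intended meaning.
\<close>

definition sparse_vec_pmf :: "nat \<Rightarrow> nat \<Rightarrow> 'a :: real_normed_field vec pmf" where
  "sparse_vec_pmf d \<xi> = do {
     \<rho> \<leftarrow> Pi_pmf {..<\<xi>} 0 (\<lambda>_. pmf_of_set {- 1, 1});
     s \<leftarrow> pmf_of_set {s. length s = \<xi> \<and> distinct s \<and> set s \<subseteq> {..<d}};
     return_pmf (of_real (sqrt (real d / real \<xi>)) \<cdot>\<^sub>v
       vec d (\<lambda>l. \<Sum>i<\<xi>. \<rho> i * unit_vec d (s ! i) $ l))
   }"

text \<open>The law of the \<open>d \<times> k\<close> SparseCol matrix with \<open>\<xi>\<close> nonzeros per column.\<close>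

definition sparse_col_pmf :: "nat \<Rightarrow> nat \<Rightarrow> nat \<Rightarrow> 'a :: real_normed_field mat pmf" where
  "sparse_col_pmf d k \<xi> =
     map_pmf (\<lambda>\<omega>. of_real (1 / sqrt (real k)) \<cdot>\<^sub>m mat_of_cols d (map \<omega> [0..<k]))
       (Pi_pmf {..<k} (0\<^sub>v d) (\<lambda>_. sparse_vec_pmf d \<xi>))"

text \<open>
  Admissible parameters for \<open>k = O(r)\<close> and \<open>\<xi> = O((d/r) \<mu> log r)\<close> with constants \<open>A\<close> and \<open>B\<close>.
  The logarithm is \<open>ln r\<close> for \<open>r \<ge> 2\<close>; for \<open>r = 1\<close> it is read as \<open>ln 2\<close>, because \<open>ln 1 = 0\<close>
  would leave no positive \<open>\<xi>\<close>.
\<close>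

definition admissible_parameters ::
    "real \<Rightarrow> real \<Rightarrow> nat \<Rightarrow> nat \<Rightarrow> real \<Rightarrow> nat \<Rightarrow> nat \<Rightarrow> bool" where
  "admissible_parameters A B d r \<mu> k \<xi> \<longleftrightarrow>
     1 \<le> k \<and> real k \<le> A * real r \<and>
     1 \<le> \<xi> \<and> \<xi> \<le> d \<and> real \<xi> \<le> B * (real d / real r * \<mu> * ln (max 2 (real r)))"

end

theory Submission
  imports Defs
begin

text \<open>
  Write \<open>q\<^sub>l\<close> for the conjugated rows of \<open>Q\<close>, so that the rows of \<open>S\<^sup>* Q\<close> are given by independent copies of
  \<open>x = Q\<^sup>* \<omega>\<close>, up to scaling.  The bound comes from the potential \<open>tr (I - (\<theta> / n) Y)\<^sup>n\<close>, where
  \<open>Y = Q\<^sup>* S S\<^sup>* Q\<close>, \<open>\<theta>\<close> is of order \<open>log r\<close> and the even number \<open>n\<close> is so large that all operators are close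
  to the identity.  Along a rank-one direction \<open>z z\<^sup>*\<close> this potential depends only on the moments \<open>z\<^sup>* K\<^sup>a z\<close>;
  as they are nonnegative, a negative update is dominated by its second-order expansion, and
  the average over an update with a random sign dominates its own.

  The second-order term of a sparse column is at most that of a dense sign vector \<open>y = Q\<^sup>* \<rho>\<close> plus a diagonal
  term.  The diagonal term is controlled as in the matrix Chernoff bound, by the coherence
  and the log-convexity of the moments; this is what fixes \<open>\<xi>\<close>.  The dense term is
  absorbed by replacing \<open>- x x\<^sup>*\<close> with \<open>2 \<eta> y y\<^sup>*\<close> for a random sign \<open>\<eta>\<close>.  After replacing all columns, the
  potential is bounded by \<open>r\<close> times an exponential moment of the norm of \<open>\<Sum>\<^sub>j \<eta>\<^sub>j y\<^sub>j y\<^sub>j\<^sup>*\<close>.  That matrix has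
  subexponential quadratic forms, so a net argument handles it with \<open>k = O(r)\<close> and no logarithm.
\<close>

section \<open>Self-adjoint operators and rank-one updates\<close>

text \<open>A plain trace argument loses a factor r, so \<theta> must be of order log r. With k =
  O(r) columns the step a = \<theta> / k is then of order (log r) / r, while the squared norm of a
  column is of order r. A second-order term bounded through that norm has size a \<theta> times the
  trace, up to constants: too large by a logarithm for the first-order decrease of a times the
  trace. Hence the dense second-order term is never estimated column by column; it is carried along
  as a random update and paid for once, at the end. Only the diagonal correction is estimated at
  each step. Relative to the first-order term it costs a d \<mu> / \<xi>, and keeping this below a
  constant means \<xi> of order (d / r) \<mu> log r. The net costs exp (O(r)), which a potential at
  scale log r cannot afford; the norm is therefore estimated at a fixed exponent and the bound is
  raised to a power proportional to a. The polynomial (I - (\<theta> / n) Y)^n replaces the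
  exponential because its expansion along a rank-one update is an exact finite identity, valid
  without any commutation of operators.\<close>

definition cip :: "nat \<Rightarrow> (nat \<Rightarrow> complex) \<Rightarrow> (nat \<Rightarrow> complex) \<Rightarrow> complex" where
  "cip r u v = (\<Sum>i<r. cnj (u i) * v i)"

definition sqn :: "nat \<Rightarrow> (nat \<Rightarrow> complex) \<Rightarrow> real" where
  "sqn r v = (\<Sum>i<r. (cmod (v i))\<^sup>2)"

text \<open>
  Vectors of dimension \<open>r\<close> are functions of which only the values below \<open>r\<close> matter, and operators are arbitrary
  functions on them: self-adjointness already forces linearity on these coordinates, and iterates
  \<open>K ^^ n\<close> serve as matrix powers.
\<close>

definition selfadj :: "nat \<Rightarrow> ((nat \<Rightarrow> complex) \<Rightarrow> nat \<Rightarrow> complex) \<Rightarrow> bool" where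
  "selfadj r K \<longleftrightarrow> (\<forall>u v. cip r (K u) v = cip r u (K v))"

definition basis_fun :: "nat \<Rightarrow> nat \<Rightarrow> complex" where
  "basis_fun i = (\<lambda>j. if j = i then 1 else 0)"

definition op_trace :: "nat \<Rightarrow> ((nat \<Rightarrow> complex) \<Rightarrow> nat \<Rightarrow> complex) \<Rightarrow> real" where
  "op_trace r K = (\<Sum>i<r. Re (cip r (basis_fun i) (K (basis_fun i))))"

definition mom :: "nat \<Rightarrow> ((nat \<Rightarrow> complex) \<Rightarrow> nat \<Rightarrow> complex) \<Rightarrow> nat \<Rightarrow> (nat \<Rightarrow> complex) \<Rightarrow> real" where
  "mom r K a z = Re (cip r z ((K ^^ a) z))"

definition rank_one_update ::
    "nat \<Rightarrow> ((nat \<Rightarrow> complex) \<Rightarrow> nat \<Rightarrow> complex) \<Rightarrow> real \<Rightarrow> (nat \<Rightarrow> complex) \<Rightarrow>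
      (nat \<Rightarrow> complex) \<Rightarrow> nat \<Rightarrow> complex" where
  "rank_one_update r K t z = (\<lambda>v i. K v i + of_real t * cip r z v * z i)"

lemma cip_cnj: "cnj (cip r u v) = cip r v u"
  by (simp add: cip_def mult.commute)

lemma cip_self: "cip r v v = of_real (sqn r v)"
  unfolding cip_def sqn_def of_real_sum complex_norm_square by (simp add: mult.commute)

lemma sqn_nonneg: "0 \<le> sqn r v"
  by (simp add: sqn_def sum_nonneg)

lemma cip_basis_right: "i < r \<Longrightarrow> cip r v (basis_fun i) = cnj (v i)"
  by (simp add: cip_def basis_fun_def if_distrib sum.delta cong: if_cong)

lemma cip_basis_left: "i < r \<Longrightarrow> cip r (basis_fun i) v = v i"
  by (simp add: cip_def basis_fun_def if_distrib if_distribR sum.delta cong: if_cong)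

lemma sum_cip_basis: "(\<Sum>i<r. cip r u (basis_fun i) * cip r (basis_fun i) v) = cip r u v"
proof -
  have "(\<Sum>i<r. cip r u (basis_fun i) * cip r (basis_fun i) v) = (\<Sum>i<r. cnj (u i) * v i)"
    by (intro sum.cong refl) (simp add: cip_basis_left cip_basis_right)
  then show ?thesis by (simp add: cip_def)
qed

lemma selfadjD: "selfadj r K \<Longrightarrow> cip r (K u) v = cip r u (K v)"
  by (simp add: selfadj_def)

lemma selfadj_funpow: "selfadj r K \<Longrightarrow> selfadj r (K ^^ n)"
  by (induction n) (auto simp: selfadj_def funpow_swap1)

lemma cip_add_scaled_right:
  "cip r u (\<lambda>i. v i + c * w i) = cip r u v + c * cip r u w"
  by (simp add: cip_def distrib_left sum.distrib sum_distrib_left mult.left_commute)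

lemma cip_rank_one_update:
  "cip r u (rank_one_update r K t z v) = cip r u (K v) + t * cip r u z * cip r z v"
  unfolding rank_one_update_def cip_add_scaled_right by (simp add: mult.assoc mult.left_commute)

lemma selfadj_rank_one_update:
  assumes "selfadj r K"
  shows "selfadj r (rank_one_update r K t z)"
proof -
  have "cip r (rank_one_update r K t z u) v = cip r u (rank_one_update r K t z v)" for u v
  proof -
    have "cip r (rank_one_update r K t z u) v = cnj (cip r v (rank_one_update r K t z u))"
      by (simp add: cip_cnj)
    also have "\<dots> = cip r (K u) v + t * cip r u z * cip r z v"
      by (simp add: cip_rank_one_update cip_cnj)
    finally show ?thesis
      by (simp add: cip_rank_one_update selfadjD[OF assms])
  qed
  then show ?thesis by (simp add: selfadj_def)
qed

lemma mom_real: "selfadj r K \<Longrightarrow> cip r z ((K ^^ a) z) = of_real (mom r K a z)"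
proof -
  assume "selfadj r K"
  then have "cnj (cip r z ((K ^^ a) z)) = cip r z ((K ^^ a) z)"
    by (metis cip_cnj selfadjD selfadj_funpow)
  then have "Im (cip r z ((K ^^ a) z)) = 0"
    by (metis Reals_cnj_iff complex_is_Real_iff)
  then show ?thesis by (simp add: mom_def complex_eq_iff)
qed

lemma mom_0: "mom r K 0 z = sqn r z"
  by (simp add: mom_def cip_self)

lemma cip_funpow_funpow:
  assumes "selfadj r K"
  shows "cip r ((K ^^ a) z) ((K ^^ b) z) = of_real (mom r K (a + b) z)"
  using selfadjD[OF selfadj_funpow[OF assms]] mom_real[OF assms]
  by (metis comp_apply funpow_add)

text \<open>Telescoping of the difference of two powers along the single place where the rank-one
  difference acts, with \<open>K\<close> to its left and \<open>K'\<close> to its right. The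
  induction peels off the outermost factor and moves \<open>K\<close> to the test vector by
  self-adjointness, so \<open>u\<close> has to be arbitrary.\<close>

lemma cip_funpow_rank_one_update:
  fixes r K t z
  defines "K' \<equiv> rank_one_update r K t z"
  assumes "selfadj r K"
  shows "cip r u ((K' ^^ a) v) = cip r u ((K ^^ a) v) +
    t * (\<Sum>e<a. cip r u ((K ^^ (a - 1 - e)) z) * cip r z ((K' ^^ e) v))"
proof (induction a arbitrary: u)
  case 0
  then show ?case by simp
next
  case (Suc a)
  have e: "cip r (K u) ((K ^^ (a - 1 - e)) z) = cip r u ((K ^^ (a - e)) z)" if "e < a" for e
  proof -
    have "a - e = Suc (a - 1 - e)" using that by simp
    then show ?thesis using selfadjD[OF assms(2)] by (metis comp_apply funpow.simps(2))
  qed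
  have "cip r u ((K' ^^ Suc a) v) = cip r (K u) ((K' ^^ a) v) + t * cip r u z * cip r z ((K' ^^ a) v)"
    using selfadjD[OF assms(2)] by (simp add: K'_def cip_rank_one_update)
  also have "\<dots> = cip r u ((K ^^ Suc a) v) + t * (\<Sum>e<a. cip r u ((K ^^ (a - e)) z) * cip r z ((K' ^^ e) v))
     + t * cip r u z * cip r z ((K' ^^ a) v)"
    unfolding Suc.IH[of "K u"] using selfadjD[OF assms(2), of u "(K ^^ a) v"] e by simp
  also have "\<dots> = cip r u ((K ^^ Suc a) v) +
      t * (\<Sum>e<Suc a. cip r u ((K ^^ (Suc a - 1 - e)) z) * cip r z ((K' ^^ e) v))"
    by (simp add: algebra_simps)
  finally show ?case .
qed

text \<open>Pairing the telescoped power with \<open>z\<close> on both sides closes the recursion: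
  the moments of the update at \<open>z\<close> are determined by those of \<open>K\<close>, which
  makes sign arguments possible.\<close>

lemma mom_rank_one_update:
  fixes r K t z
  defines "K' \<equiv> rank_one_update r K t z"
  assumes "selfadj r K"
  shows "mom r K' a z = mom r K a z + t * (\<Sum>e<a. mom r K (a - 1 - e) z * mom r K' e z)"
proof -
  have K': "selfadj r K'" using assms selfadj_rank_one_update by simp
  have "of_real (mom r K' a z) = (of_real (mom r K a z + t * (\<Sum>e<a. mom r K (a - 1 - e) z * mom r K' e z)) :: complex)"
    using cip_funpow_rank_one_update[OF assms(2), where u=z and t=t and z=z and a=a and v=z]
    by (simp add: mom_real[OF assms(2)] mom_real[OF K'] K'_def[symmetric])
  then show ?thesis by (simp only: of_real_eq_iff)
qed

lemma cip_funpow_funpow_rank_one_update: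
  fixes r K t z
  defines "K' \<equiv> rank_one_update r K t z"
  assumes "selfadj r K"
  shows "cip r ((K ^^ c) z) ((K' ^^ e) z) =
    of_real (mom r K (c + e) z + t * (\<Sum>f<e. mom r K (c + (e - 1 - f)) z * mom r K' f z))"
proof -
  have K': "selfadj r K'" using assms selfadj_rank_one_update by simp
  show ?thesis
    using cip_funpow_rank_one_update[OF assms(2), where u="(K ^^ c) z" and t=t and z=z and a=e and v=z]
    by (simp add: cip_funpow_funpow[OF assms(2)] mom_real[OF K'] K'_def[symmetric])
qed

text \<open>Telescoping is used twice. The first application gives, by cyclicity of the trace, mixed
  moments at \<open>z\<close>; the second replaces the update by \<open>K\<close> up to a term in
  t^2, which keeps moments of the updated operator and makes the expansion exact.\<close>

lemma trace_rank_one_update: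
  fixes r K t z
  defines "K' \<equiv> rank_one_update r K t z"
  assumes "selfadj r K"
  shows "op_trace r (K' ^^ n) = op_trace r (K ^^ n) + n * t * mom r K (n - 1) z
    + t\<^sup>2 * (\<Sum>e<n-1. real (n - 1 - e) * (mom r K (n - 2 - e) z * mom r K' e z))"
proof -
  have K': "selfadj r K'" using assms selfadj_rank_one_update by simp
  have inner: "(\<Sum>i<r. cip r (basis_fun i) ((K ^^ c) z) * cip r z ((K' ^^ e) (basis_fun i)))
     = of_real (mom r K (c + e) z + t * (\<Sum>f<e. mom r K (c + (e - 1 - f)) z * mom r K' f z))" (is "?L = ?R") for c e
  proof -
    have "?L = (\<Sum>i<r. cip r ((K' ^^ e) z) (basis_fun i) * cip r (basis_fun i) ((K ^^ c) z))"
      using selfadjD[OF selfadj_funpow[OF K']] by (simp add: mult.commute)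
    also have "\<dots> = cip r ((K' ^^ e) z) ((K ^^ c) z)" by (rule sum_cip_basis)
    also have "\<dots> = cnj (cip r ((K ^^ c) z) ((K' ^^ e) z))" by (simp add: cip_cnj)
    also have "\<dots> = ?R"
      unfolding K'_def cip_funpow_funpow_rank_one_update[OF assms(2)] by simp
    finally show ?thesis .
  qed
  have "op_trace r (K' ^^ n) = op_trace r (K ^^ n) + 
     t * (\<Sum>i<r. Re (\<Sum>e<n. cip r (basis_fun i) ((K ^^ (n - 1 - e)) z) * cip r z ((K' ^^ e) (basis_fun i))))"
  proof -
    have "Re (cip r (basis_fun i) ((K' ^^ n) (basis_fun i))) = Re (cip r (basis_fun i) ((K ^^ n) (basis_fun i)))
       + t * Re (\<Sum>e<n. cip r (basis_fun i) ((K ^^ (n - 1 - e)) z) * cip r z ((K' ^^ e) (basis_fun i)))" for i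
      unfolding K'_def
        cip_funpow_rank_one_update[OF assms(2), where u="basis_fun i" and t=t and z=z and a=n and v="basis_fun i"]
      by (simp del: Re_sum)
    then show ?thesis
      unfolding op_trace_def by (simp add: sum.distrib sum_distrib_left del: Re_sum)
  qed
  also have "(\<Sum>i<r. Re (\<Sum>e<n. cip r (basis_fun i) ((K ^^ (n - 1 - e)) z) * cip r z ((K' ^^ e) (basis_fun i))))
     = Re (\<Sum>e<n. \<Sum>i<r. cip r (basis_fun i) ((K ^^ (n - 1 - e)) z) * cip r z ((K' ^^ e) (basis_fun i)))"
    by (subst sum.swap) (simp only: Re_sum)
  also have "\<dots> = (\<Sum>e<n. mom r K (n - 1 - e + e) z
      + t * (\<Sum>f<e. mom r K (n - 1 - e + (e - 1 - f)) z * mom r K' f z))"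
    unfolding inner by (simp only: of_real_sum[symmetric] Re_complex_of_real)
  also have "\<dots> = (\<Sum>e<n. mom r K (n - 1) z + t * (\<Sum>f<e. mom r K (n - 2 - f) z * mom r K' f z))"
  proof (intro sum.cong refl arg_cong2[where f="(+)"] arg_cong2[where f="(*)"])
    fix e f assume "e \<in> {..<n}" "f \<in> {..<e}"
    then have "n - 1 - e + (e - 1 - f) = n - 2 - f" by auto
    then show "mom r K (n - 1 - e + (e - 1 - f)) z = mom r K (n - 2 - f) z" by simp
  qed simp
  also have "\<dots> = n * mom r K (n - 1) z + t * (\<Sum>e<n. \<Sum>f<e. mom r K (n - 2 - f) z * mom r K' f z)"
    by (simp add: sum.distrib sum_distrib_left)
  \<comment> \<open>The summand does not depend on \<open>e\<close>, and a given \<open>f\<close>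
    lies below n - 1 - f values of \<open>e\<close>; the value f = n - 1 drops out.\<close>
  also have "(\<Sum>e<n. \<Sum>f<e. mom r K (n - 2 - f) z * mom r K' f z) =
     (\<Sum>f<n-1. real (n - 1 - f) * (mom r K (n - 2 - f) z * mom r K' f z))"
  proof -
    have "(\<Sum>e<n. \<Sum>f<e. h f) = (\<Sum>f<n-1. real (n - 1 - f) * h f)" for h :: "nat \<Rightarrow> real"
    proof (induction n)
      case (Suc n)
      show ?case
      proof (cases n)
        case (Suc m)
        have "(\<Sum>f<m. real (Suc m - f) * h f) = (\<Sum>f<m. real (m - f) * h f + h f)"
          by (intro sum.cong refl) (auto simp: Suc_diff_le algebra_simps)
        then show ?thesis using Suc.IH Suc by (simp add: sum.distrib)
      qed simp
    qed simp
    then show ?thesis .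
  qed
  finally show ?thesis by (simp add: algebra_simps power2_eq_square)
qed

section \<open>Positivity and one-sided trace estimates\<close>

definition psd :: "nat \<Rightarrow> ((nat \<Rightarrow> complex) \<Rightarrow> nat \<Rightarrow> complex) \<Rightarrow> bool" where
  "psd r K \<longleftrightarrow> selfadj r K \<and> (\<forall>v. 0 \<le> Re (cip r v (K v)))"

lemma psd_selfadj: "psd r K \<Longrightarrow> selfadj r K"
  by (simp add: psd_def)

lemma mom_even:
  assumes "selfadj r K"
  shows "mom r K (b + b) z = sqn r ((K ^^ b) z)"
  using cip_funpow_funpow[OF assms, of b z b] by (simp add: cip_self)

lemma mom_odd:
  assumes "selfadj r K"
  shows "mom r K (Suc (b + b)) z = Re (cip r ((K ^^ b) z) (K ((K ^^ b) z)))"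
  using cip_funpow_funpow[OF assms, of b z "Suc b"] by simp

text \<open>Even moments are squared norms and odd ones are values of the form of
  \<open>K\<close>.\<close>

lemma mom_nonneg:
  assumes "psd r K"
  shows "0 \<le> mom r K a z"
proof (cases "even a")
  case True
  then obtain b where "a = b + b" by (metis evenE mult_2)
  then show ?thesis using mom_even[OF psd_selfadj[OF assms]] sqn_nonneg by simp
next
  case False
  then obtain b where "a = Suc (b + b)" by (metis oddE mult_2 Suc_eq_plus1)
  then show ?thesis using mom_odd[OF psd_selfadj[OF assms]] assms by (simp add: psd_def)
qed

text \<open>The recursion of \<open>mom_rank_one_update\<close> subtracts products of moments of
  \<open>K\<close> and of the updated operator, nonnegative by positivity of both. Hence the updated
  moments in the exact remainder may be replaced by those of \<open>K\<close>.\<close>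

lemma trace_rank_one_downdate_le:
  assumes "psd r K" and "psd r (rank_one_update r K (- s) z)" and "0 \<le> s"
  shows "op_trace r (rank_one_update r K (- s) z ^^ n) \<le> op_trace r (K ^^ n) - n * s * mom r K (n - 1) z
    + s\<^sup>2 * (\<Sum>e<n-1. real (n - 1 - e) * (mom r K (n - 2 - e) z * mom r K e z))"
proof -
  have le: "mom r (rank_one_update r K (- s) z) e z \<le> mom r K e z" for e
    unfolding mom_rank_one_update[OF psd_selfadj[OF assms(1)], of "-s" z e]
    using assms by (auto intro!: mult_nonneg_nonneg sum_nonneg mom_nonneg)
  show ?thesis
    unfolding trace_rank_one_update[OF psd_selfadj[OF assms(1)]]
    by (auto intro!: mult_left_mono sum_mono le mom_nonneg assms)
qed

text \<open>The first-order terms of the two signs cancel. In the second-order term the average of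
  the updated moments is at least the moment of \<open>K\<close>: the recursion leaves a nonnegative
  combination of differences between upward and downward moments, and these are nonnegative
  too.\<close>

lemma trace_rank_one_symmetric_ge:
  assumes "psd r K" and "psd r (rank_one_update r K t z)" and "psd r (rank_one_update r K (- t) z)"
    and "0 \<le> t"
  shows "2 * op_trace r (K ^^ n) + 2 * t\<^sup>2 * (\<Sum>e<n-1. real (n - 1 - e) * (mom r K (n - 2 - e) z * mom r K e z))
    \<le> op_trace r (rank_one_update r K t z ^^ n) + op_trace r (rank_one_update r K (- t) z ^^ n)"
proof -
  note sa = psd_selfadj[OF assms(1)]
  let ?P = "\<lambda>e. mom r (rank_one_update r K t z) e z"
  let ?M = "\<lambda>e. mom r (rank_one_update r K (- t) z) e z"
  have ge: "?M e \<le> mom r K e z \<and> mom r K e z \<le> ?P e" for e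
    unfolding mom_rank_one_update[OF sa, of t z e] mom_rank_one_update[OF sa, of "-t" z e]
    using assms by (auto intro!: mult_nonneg_nonneg sum_nonneg mom_nonneg)
  have mid: "2 * mom r K e z \<le> ?P e + ?M e" for e
  proof -
    have "?P e + ?M e - 2 * mom r K e z = t * (\<Sum>f<e. mom r K (e - 1 - f) z * (?P f - ?M f))"
      unfolding mom_rank_one_update[OF sa, of t z e] mom_rank_one_update[OF sa, of "-t" z e]
      by (simp add: algebra_simps sum_subtractf)
    also have "\<dots> \<ge> 0"
      using ge assms by (intro mult_nonneg_nonneg sum_nonneg mom_nonneg) (auto intro: order_trans)
    finally show ?thesis by simp
  qed
  have "(\<Sum>e<n-1. real (n - 1 - e) * (mom r K (n - 2 - e) z * (2 * mom r K e z)))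
      \<le> (\<Sum>e<n-1. real (n - 1 - e) * (mom r K (n - 2 - e) z * (?P e + ?M e)))"
    by (intro sum_mono mult_left_mono mid mom_nonneg assms) simp
  then have "t\<^sup>2 * (2 * (\<Sum>e<n-1. real (n - 1 - e) * (mom r K (n - 2 - e) z * mom r K e z)))
      \<le> t\<^sup>2 * ((\<Sum>e<n-1. real (n - 1 - e) * (mom r K (n - 2 - e) z * ?P e)) +
          (\<Sum>e<n-1. real (n - 1 - e) * (mom r K (n - 2 - e) z * ?M e)))"
    unfolding sum.distrib[symmetric] distrib_left[symmetric]
    by (intro mult_left_mono) (simp_all add: sum_distrib_left mult.left_commute)
  then show ?thesis
    unfolding trace_rank_one_update[OF sa] by (simp add: algebra_simps)
qed

section \<open>Moments of operators near the identity\<close>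

lemma nonneg_quadratic_imp_discriminant:
  fixes A B C :: real
  assumes "\<And>t. 0 \<le> A + 2 * t * B + t\<^sup>2 * C" and nonneg: "0 \<le> C"
  shows "B\<^sup>2 \<le> A * C"
proof (cases "C = 0")
  case True
  have "B = 0"
  proof (rule ccontr)
    assume "B \<noteq> 0"
    \<comment> \<open>This value of \<open>t\<close> turns the affine function into -1.\<close>
    then show False using assms(1)[of "- (A + 1) / (2 * B)"] True by (simp add: field_simps)
  qed
  then show ?thesis using True by simp
next
  case False
  then have "C > 0" using nonneg by simp
  then have "0 \<le> (A + 2 * (- B / C) * B + (- B / C)\<^sup>2 * C) * C"
    using assms(1)[of "- B / C"] \<open>C > 0\<close> by simp
  also have "\<dots> = A * C - B\<^sup>2" using \<open>C > 0\<close> by (simp add: field_simps power2_eq_square)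
  finally show ?thesis by simp
qed

lemma psd_Cauchy_Schwarz:
  assumes "psd r K"
  shows "(Re (cip r u (K v)))\<^sup>2 \<le> Re (cip r u (K u)) * Re (cip r v (K v))"
proof (rule nonneg_quadratic_imp_discriminant)
  fix t :: real
  note sa = psd_selfadj[OF assms]
  define w where "w = (\<lambda>i. u i + of_real t * v i)"
  have lin: "cip r x (K w) = cip r x (K u) + t * cip r x (K v)" for x
    using selfadjD[OF sa] cip_add_scaled_right[of r "K x" u "of_real t" v] by (simp add: w_def)
  have "cip r w (K w) = cip r w (K u) + t * cip r w (K v)" by (rule lin)
  also have "cip r w (K u) = cnj (cip r u (K w))" using selfadjD[OF sa] by (simp add: cip_cnj)
  also have "cip r w (K v) = cnj (cip r v (K w))" using selfadjD[OF sa] by (simp add: cip_cnj)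
  also have "Re (cnj (cip r u (K w)) + t * cnj (cip r v (K w))) =
     Re (cip r u (K u)) + 2 * t * Re (cip r u (K v)) + t\<^sup>2 * Re (cip r v (K v))"
  proof -
    have "Re (cip r v (K u)) = Re (cip r u (K v))"
      using selfadjD[OF sa, of u v] cip_cnj[of r "K u" v] by (metis complex_cnj_cnj cnj.simps(1))
    then show ?thesis unfolding lin by (simp add: power2_eq_square algebra_simps)
  qed
  finally have "Re (cip r w (K w)) = Re (cip r u (K u)) + 2 * t * Re (cip r u (K v)) + t\<^sup>2 * Re (cip r v (K v))" .
  then show "0 \<le> Re (cip r u (K u)) + 2 * t * Re (cip r u (K v)) + t\<^sup>2 * Re (cip r v (K v))"
    using assms by (metis psd_def)
next
  show "0 \<le> Re (cip r v (K v))" using assms by (simp add: psd_def)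
qed

lemma psd_id: "psd r (\<lambda>v. v)"
  by (simp add: psd_def selfadj_def cip_self sqn_nonneg)

text \<open>Cauchy-Schwarz at consecutive powers of \<open>K\<close> on \<open>z\<close>, for the
  form of the identity when the middle order is odd and for the form of \<open>K\<close> when it is
  even. This stands in for the spectral measure of \<open>K\<close> at \<open>z\<close>.\<close>

lemma mom_log_convex:
  assumes "psd r K"
  shows "(mom r K (Suc a) z)\<^sup>2 \<le> mom r K a z * mom r K (Suc (Suc a)) z"
proof (cases "even a")
  note sa = psd_selfadj[OF assms]
  case True
  then obtain b where "a = b + b" by (metis evenE mult_2)
  then show ?thesis
    using psd_Cauchy_Schwarz[OF psd_id, of r "(K ^^ b) z" "(K ^^ Suc b) z"]
    unfolding cip_funpow_funpow[OF sa] by simp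
next
  note sa = psd_selfadj[OF assms]
  case False
  then obtain b where a: "a = Suc (b + b)" by (metis oddE mult_2 Suc_eq_plus1)
  have K: "K ((K ^^ c) z) = (K ^^ Suc c) z" for c by simp
  show ?thesis
    using psd_Cauchy_Schwarz[OF assms, of "(K ^^ b) z" "(K ^^ Suc b) z"]
    unfolding K cip_funpow_funpow[OF sa] by (simp add: a)
qed

definition near_id :: "nat \<Rightarrow> real \<Rightarrow> ((nat \<Rightarrow> complex) \<Rightarrow> nat \<Rightarrow> complex) \<Rightarrow> bool" where
  "near_id r \<delta> K \<longleftrightarrow> selfadj r K \<and>
    (\<forall>v. (1 - \<delta>) * sqn r v \<le> Re (cip r v (K v)) \<and> Re (cip r v (K v)) \<le> (1 + \<delta>) * sqn r v)"

lemma near_id_psd: "near_id r \<delta> K \<Longrightarrow> \<delta> \<le> 1 \<Longrightarrow> psd r K"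
  unfolding near_id_def psd_def using sqn_nonneg[of r]
  by (smt (verit) mult_nonneg_nonneg)

lemma near_id_id: "0 \<le> \<delta> \<Longrightarrow> near_id r \<delta> (\<lambda>v. v)"
  unfolding near_id_def using sqn_nonneg[of r] psd_selfadj[OF psd_id, of r]
  by (simp add: cip_self mult_left_le_one_le algebra_simps)

lemma near_id_mono: "near_id r \<delta> K \<Longrightarrow> \<delta> \<le> \<epsilon> \<Longrightarrow> near_id r \<epsilon> K"
  unfolding near_id_def using sqn_nonneg[of r]
  by (smt (verit, best) mult_right_mono)

text \<open>For even orders this is the hypothesis at a power of \<open>K\<close> applied to
  \<open>z\<close>. Log-convexity makes the ratios of consecutive moments increase, so an odd order
  inherits the upper bound from the even order after it.\<close>

lemma mom_Suc_le:
  assumes "psd r K" and "\<And>v. Re (cip r v (K v)) \<le> c * sqn r v"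
  shows "mom r K (Suc a) z \<le> c * mom r K a z"
proof -
  note sa = psd_selfadj[OF assms(1)]
  have even: "mom r K (Suc (b + b)) z \<le> c * mom r K (b + b) z" for b
    unfolding mom_odd[OF sa] mom_even[OF sa] by (rule assms(2))
  show ?thesis
  proof (cases "even a")
    case True
    then show ?thesis using even by (metis evenE mult_2)
  next
    case False
    then obtain b where a: "a = Suc (b + b)" by (metis oddE mult_2 Suc_eq_plus1)
    then have "mom r K (Suc (Suc a)) z \<le> c * mom r K (Suc a) z"
      using even[of "Suc b"] by simp
    then have "mom r K a z * mom r K (Suc (Suc a)) z \<le> mom r K a z * (c * mom r K (Suc a) z)"
      by (intro mult_left_mono mom_nonneg assms)
    with mom_log_convex[OF assms(1), of a z]
    have *: "mom r K (Suc a) z * mom r K (Suc a) z \<le> (c * mom r K a z) * mom r K (Suc a) z"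
      by (simp add: power2_eq_square algebra_simps)
    show ?thesis
    proof (cases "mom r K (Suc a) z = 0")
      case True
      have "c * mom r K a z \<ge> 0"
      proof (cases "c \<ge> 0")
        case True then show ?thesis by (simp add: mom_nonneg assms)
      next
        case False
        \<comment> \<open>A negative \<open>c\<close> contradicts positivity unless this vector
          vanishes, and then the odd moment vanishes with it.\<close>
        then have "sqn r ((K ^^ b) z) = 0" using assms(2)[of "(K ^^ b) z"] sqn_nonneg[of r "(K ^^ b) z"] assms(1)
          unfolding psd_def by (smt (verit) mult_neg_pos)
        then have "mom r K (b + b) z = 0" using mom_even[OF sa] by simp
        then have "mom r K a z = 0" using even[of b] mom_nonneg[OF assms(1), of a z] a by simp
        then show ?thesis by simp
      qed
      then show ?thesis using True by simp
    next
      case False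
      then have "0 < mom r K (Suc a) z" using mom_nonneg[OF assms(1), of "Suc a" z] by linarith
      then show ?thesis using * by (simp add: mult_le_cancel_right)
    qed
  qed
qed

text \<open>Mirror image of the upper bound: here an odd order inherits the estimate from the even
  order before it.\<close>

lemma mom_Suc_ge:
  assumes "psd r K" and "\<And>v. c * sqn r v \<le> Re (cip r v (K v))"
  shows "c * mom r K a z \<le> mom r K (Suc a) z"
proof -
  note sa = psd_selfadj[OF assms(1)]
  have even: "c * mom r K (b + b) z \<le> mom r K (Suc (b + b)) z" for b
    unfolding mom_odd[OF sa] mom_even[OF sa] by (rule assms(2))
  show ?thesis
  proof (cases "even a")
    case True
    then show ?thesis using even by (metis evenE mult_2)
  next
    case False
    then obtain b where a: "a = Suc (b + b)" by (metis oddE mult_2 Suc_eq_plus1)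
    let ?c = "b + b"
    show ?thesis
    proof (cases "mom r K a z = 0 \<or> c \<le> 0")
      case True
      then show ?thesis
        using mom_nonneg[OF assms(1), of a z] mom_nonneg[OF assms(1), of "Suc a" z]
        by (auto intro: order_trans[OF mult_nonpos_nonneg])
    next
      case False
      then have pos: "0 < mom r K a z" "0 < c" using mom_nonneg[OF assms(1), of a z] by linarith+
      have "c * (mom r K a z)\<^sup>2 \<le> c * (mom r K ?c z * mom r K (Suc a) z)"
        using mom_log_convex[OF assms(1), of ?c z] pos a by (intro mult_left_mono) auto
      also have "\<dots> = (c * mom r K ?c z) * mom r K (Suc a) z" by simp
      also have "\<dots> \<le> mom r K a z * mom r K (Suc a) z"
        using even[of b] a by (intro mult_right_mono mom_nonneg assms) auto
      finally have "mom r K a z * (c * mom r K a z) \<le> mom r K a z * mom r K (Suc a) z"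
        by (simp add: power2_eq_square algebra_simps)
      then show ?thesis using pos by (simp add: mult_le_cancel_left)
    qed
  qed
qed

text \<open>The ratios of consecutive terms increase, so shifting both indices by b can only enlarge
  the quotient of \<open>m a\<close> and \<open>m 0\<close>.\<close>

lemma log_convex_seq_mult_le:
  fixes m :: "nat \<Rightarrow> real"
  assumes pos: "\<And>a. 0 < m a" and lc: "\<And>a. (m (Suc a))\<^sup>2 \<le> m a * m (Suc (Suc a))"
  shows "m a * m b \<le> m 0 * m (a + b)"
proof (induction a)
  case 0
  then show ?case by simp
next
  case (Suc a)
  have "incseq (\<lambda>a. m (Suc a) / m a)"
    using lc pos by (intro incseq_SucI) (simp add: field_simps power2_eq_square)
  then have ratio: "m (Suc a) / m a \<le> m (Suc (a + b)) / m (a + b)"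
    by (rule incseqD) simp
  have "m (Suc a) * m b = m (Suc a) / m a * (m a * m b)" using pos[of a] by simp
  also have "\<dots> \<le> m (Suc (a + b)) / m (a + b) * (m 0 * m (a + b))"
    using pos by (intro mult_mono ratio Suc divide_nonneg_nonneg mult_nonneg_nonneg) (auto simp: less_imp_le)
  also have "\<dots> = m 0 * m (Suc a + b)" using pos[of "a + b"] by simp
  finally show ?case .
qed

text \<open>Merges two moments into one at the price of the squared norm of \<open>z\<close>; at
  frame vectors this is where the coherence enters. The condition \<delta> < 1 keeps all moments
  strictly positive when the norm of \<open>z\<close> is nonzero.\<close>

lemma mom_mult_le:
  assumes "near_id r \<delta> K" "\<delta> < 1"
  shows "mom r K a z * mom r K b z \<le> sqn r z * mom r K (a + b) z"
proof -
  have psd: "psd r K" using near_id_psd assms by simp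
  show ?thesis
  proof (cases "sqn r z = 0")
    case True
    have "mom r K a z = 0" for a
    proof (induction a)
      case 0
      then show ?case by (simp add: mom_0 True)
    next
      case (Suc a)
      then show ?case using mom_Suc_le[OF psd, of "1 + \<delta>" a z] mom_nonneg[OF psd, of "Suc a" z] assms
        by (auto simp: near_id_def)
    qed
    then show ?thesis using True by simp
  next
    case False
    have "0 < mom r K a z" for a
    proof (induction a)
      case 0
      then show ?case using False sqn_nonneg[of r z] by (simp add: mom_0)
    next
      case (Suc a)
      then have "0 < (1 - \<delta>) * mom r K a z" using assms by simp
      then show ?case using mom_Suc_ge[OF psd, of "1 - \<delta>" a z] assms by (auto simp: near_id_def)
    qed
    from log_convex_seq_mult_le[of "\<lambda>a. mom r K a z", OF this mom_log_convex[OF psd]]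
    show ?thesis by (simp add: mom_0)
  qed
qed

section \<open>Traces of powers\<close>

lemma op_trace_funpow: "op_trace r (K ^^ n) = (\<Sum>i<r. mom r K n (basis_fun i))"
  by (simp add: op_trace_def mom_def)

lemma op_trace_nonneg: "psd r K \<Longrightarrow> 0 \<le> op_trace r (K ^^ n)"
  unfolding op_trace_funpow by (intro sum_nonneg mom_nonneg)

lemma op_trace_Suc_le:
  assumes "near_id r \<delta> K" "\<delta> \<le> 1"
  shows "op_trace r (K ^^ Suc n) \<le> (1 + \<delta>) * op_trace r (K ^^ n)"
  unfolding op_trace_funpow sum_distrib_left
  using assms near_id_psd[OF assms] by (intro sum_mono mom_Suc_le) (auto simp: near_id_def)

lemma op_trace_Suc_ge:
  assumes "near_id r \<delta> K" "\<delta> \<le> 1"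
  shows "(1 - \<delta>) * op_trace r (K ^^ n) \<le> op_trace r (K ^^ Suc n)"
  unfolding op_trace_funpow sum_distrib_left
  using assms near_id_psd[OF assms] by (intro sum_mono mom_Suc_ge) (auto simp: near_id_def)

lemma sqn_basis: "i < r \<Longrightarrow> sqn r (basis_fun i) = 1"
  using cip_self[of r "basis_fun i"] cip_basis_left[of i r "basis_fun i"]
  by (simp add: basis_fun_def)

lemma op_trace_funpow_le:
  assumes "psd r K" and "\<And>v. Re (cip r v (K v)) \<le> c * sqn r v" and "0 \<le> c"
  shows "op_trace r (K ^^ n) \<le> real r * c ^ n"
proof -
  have "mom r K n z \<le> c ^ n * sqn r z" for z
  proof (induction n)
    case (Suc n)
    have "mom r K (Suc n) z \<le> c * mom r K n z" by (rule mom_Suc_le[OF assms(1,2)])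
    also have "\<dots> \<le> c * (c ^ n * sqn r z)" using Suc assms by (intro mult_left_mono) auto
    finally show ?case by simp
  qed (simp add: mom_0)
  then have "op_trace r (K ^^ n) \<le> (\<Sum>i<r. c ^ n * sqn r (basis_fun i))"
    unfolding op_trace_funpow by (rule sum_mono)
  then show ?thesis by (simp add: sqn_basis)
qed

lemma sqn_L2: "sqn r v = (L2_set (\<lambda>i. cmod (v i)) {..<r})\<^sup>2"
  by (simp add: sqn_def L2_set_def sum_nonneg)

lemma cip_Cauchy_Schwarz: "(cmod (cip r u v))\<^sup>2 \<le> sqn r u * sqn r v"
proof -
  have "cmod (cip r u v) \<le> (\<Sum>i<r. \<bar>cmod (u i)\<bar> * \<bar>cmod (v i)\<bar>)"
    unfolding cip_def by (rule order_trans[OF norm_sum]) (simp add: norm_mult)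
  also have "\<dots> \<le> L2_set (\<lambda>i. cmod (u i)) {..<r} * L2_set (\<lambda>i. cmod (v i)) {..<r}"
    by (rule L2_set_mult_ineq)
  finally show ?thesis
    unfolding sqn_L2 power_mult_distrib[symmetric] by (intro power_mono) auto
qed

text \<open>For n = 2 b the trace is the squared Hilbert-Schmidt norm of the b-th power, which
  bounds its squared operator norm. A single direction with a large moment is thus seen by the
  potential.\<close>

lemma mom_le_op_trace:
  assumes "selfadj r K" "even n"
  shows "mom r K n u \<le> sqn r u * op_trace r (K ^^ n)"
proof -
  obtain b where n: "n = b + b" using assms(2) by (metis evenE mult_2)
  note sb = selfadj_funpow[OF assms(1), of b]
  have "mom r K n u = sqn r ((K ^^ b) u)" unfolding n by (rule mom_even[OF assms(1)])
  also have "\<dots> = (\<Sum>i<r. (cmod (cip r (basis_fun i) ((K ^^ b) u)))\<^sup>2)"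
    unfolding sqn_def by (intro sum.cong) (simp_all add: cip_basis_left)
  also have "\<dots> = (\<Sum>i<r. (cmod (cip r ((K ^^ b) (basis_fun i)) u))\<^sup>2)"
    by (simp add: selfadjD[OF sb])
  also have "\<dots> \<le> (\<Sum>i<r. sqn r ((K ^^ b) (basis_fun i)) * sqn r u)"
    by (intro sum_mono cip_Cauchy_Schwarz)
  also have "\<dots> = sqn r u * op_trace r (K ^^ n)"
    unfolding op_trace_funpow n mom_even[OF assms(1)] by (simp add: sum_distrib_left mult.commute)
  finally show ?thesis .
qed

text \<open>Jensen's inequality for the spectral measure of \<open>K\<close> at a unit vector,
  obtained by repeated merging of moments.\<close>

lemma mom_power_le:
  assumes "near_id r \<delta> K" "\<delta> < 1" "sqn r z = 1"
  shows "mom r K 1 z ^ n \<le> mom r K n z"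
proof (induction n)
  case (Suc n)
  have "mom r K 1 z ^ Suc n \<le> mom r K 1 z * mom r K n z"
    using Suc mom_nonneg[OF near_id_psd[OF assms(1)]] assms(2) by (simp add: mult_left_mono)
  also have "\<dots> \<le> mom r K (Suc n) z" using mom_mult_le[OF assms(1,2), of 1 z n] assms(3) by simp
  finally show ?case .
qed (simp add: mom_0 assms)

lemma near_id_rank_one_update:
  assumes "near_id r \<delta> K" "\<bar>t\<bar> * sqn r z \<le> \<epsilon>"
  shows "near_id r (\<delta> + \<epsilon>) (rank_one_update r K t z)"
proof -
  have "\<bar>Re (cip r v (rank_one_update r K t z v)) - Re (cip r v (K v))\<bar> \<le> \<epsilon> * sqn r v" for v
  proof -
    have "cip r v (rank_one_update r K t z v) = cip r v (K v) + of_real (t * (cmod (cip r z v))\<^sup>2)"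
    proof -
      have "cip r v z * cip r z v = of_real ((cmod (cip r z v))\<^sup>2)"
        using cip_cnj[of r z v] by (metis complex_norm_square mult.commute of_real_power)
      then show ?thesis by (simp add: cip_rank_one_update mult.assoc)
    qed
    then have "\<bar>Re (cip r v (rank_one_update r K t z v)) - Re (cip r v (K v))\<bar> = \<bar>t\<bar> * (cmod (cip r z v))\<^sup>2"
      by (simp add: abs_mult)
    also have "\<dots> \<le> \<bar>t\<bar> * (sqn r z * sqn r v)"
      by (intro mult_left_mono cip_Cauchy_Schwarz) simp
    also have "\<dots> \<le> \<epsilon> * sqn r v"
      using assms(2) sqn_nonneg[of r v] by (simp add: mult.assoc[symmetric] mult_right_mono)
    finally show ?thesis .
  qed
  moreover have "(1 - \<delta>) * sqn r v \<le> Re (cip r v (K v)) \<and> Re (cip r v (K v)) \<le> (1 + \<delta>) * sqn r v" for v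
    using assms(1) by (simp add: near_id_def)
  ultimately have "(1 - (\<delta> + \<epsilon>)) * sqn r v \<le> Re (cip r v (rank_one_update r K t z v)) \<and>
     Re (cip r v (rank_one_update r K t z v)) \<le> (1 + (\<delta> + \<epsilon>)) * sqn r v" for v
    by (smt (verit) left_diff_distrib distrib_right)
  then show ?thesis using selfadj_rank_one_update assms(1) by (simp add: near_id_def)
qed

section \<open>Tight frames\<close>

definition tight_frame :: "nat \<Rightarrow> nat \<Rightarrow> (nat \<Rightarrow> nat \<Rightarrow> complex) \<Rightarrow> bool" where
  "tight_frame d r q \<longleftrightarrow> (\<forall>i<r. \<forall>j<r. (\<Sum>l<d. q l i * cnj (q l j)) = (if i = j then 1 else 0))"

text \<open>This is the trace of \<open>T\<close> against the sum of the rank-one operators of the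
  frame, which is the identity. As \<open>T\<close> is just a function, its linearity is drawn from
  self-adjointness through an expansion in the basis.\<close>

lemma tight_frame_trace:
  assumes "tight_frame d r q" "selfadj r T"
  shows "(\<Sum>l<d. Re (cip r (q l) (T (q l)))) = op_trace r T"
proof -
  have "cip r (q l) (T (q l)) = (\<Sum>j<r. \<Sum>i<r. (T (basis_fun j)) i * (q l j * cnj (q l i)))" for l
  proof -
    have "cip r (q l) (T (q l)) = (\<Sum>j<r. cip r (T (q l)) (basis_fun j) * cip r (basis_fun j) (q l))"
      unfolding sum_cip_basis by (rule selfadjD[OF assms(2), symmetric])
    also have "\<dots> = (\<Sum>j<r. cip r (q l) (T (basis_fun j)) * q l j)"
      using selfadjD[OF assms(2)] by (intro sum.cong) (simp_all add: cip_basis_left)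
    also have "\<dots> = (\<Sum>j<r. \<Sum>i<r. (T (basis_fun j)) i * (q l j * cnj (q l i)))"
      by (simp add: cip_def sum_distrib_right sum_distrib_left algebra_simps)
    finally show ?thesis .
  qed
  then have "(\<Sum>l<d. cip r (q l) (T (q l))) =
      (\<Sum>j<r. \<Sum>i<r. (T (basis_fun j)) i * (\<Sum>l<d. q l j * cnj (q l i)))"
    by (simp add: sum_distrib_left sum.swap[where A="{..<d}"])
  also have "\<dots> = (\<Sum>j<r. \<Sum>i<r. if j = i then (T (basis_fun j)) i else 0)"
    using assms(1) by (intro sum.cong) (auto simp: tight_frame_def)
  also have "\<dots> = (\<Sum>j<r. (T (basis_fun j)) j)"
    by (intro sum.cong refl) (simp add: sum.delta)
  also have "\<dots> = (\<Sum>j<r. cip r (basis_fun j) (T (basis_fun j)))"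
    by (simp add: cip_basis_left)
  finally have "Re (\<Sum>l<d. cip r (q l) (T (q l))) = Re (\<Sum>j<r. cip r (basis_fun j) (T (basis_fun j)))"
    by simp
  then show ?thesis by (simp add: op_trace_def)
qed

text \<open>The trace identity for the rank-one operator along \<open>u\<close>.\<close>

lemma tight_frame_Parseval:
  assumes "tight_frame d r q"
  shows "(\<Sum>l<d. (cmod (cip r (q l) u))\<^sup>2) = sqn r u"
proof -
  define T where "T = rank_one_update r (\<lambda>v i. 0) 1 u"
  have T: "selfadj r T" unfolding T_def
    by (intro selfadj_rank_one_update) (simp add: selfadj_def cip_def)
  have c: "cip r v (T v) = of_real ((cmod (cip r v u))\<^sup>2)" for v
  proof -
    have "cip r v (T v) = cip r v u * cnj (cip r v u)"
      unfolding T_def cip_rank_one_update cip_cnj by (simp add: cip_def)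
    then show ?thesis by (metis complex_norm_square of_real_power)
  qed
  have "(\<Sum>l<d. (cmod (cip r (q l) u))\<^sup>2) = (\<Sum>i<r. (cmod (cip r (basis_fun i) u))\<^sup>2)"
    using tight_frame_trace[OF assms T] by (simp add: op_trace_def c)
  then show ?thesis by (simp add: sqn_def cip_basis_left)
qed

lemma tight_frame_sum_sqn:
  assumes "tight_frame d r q"
  shows "(\<Sum>l<d. sqn r (q l)) = real r"
  using tight_frame_trace[OF assms psd_selfadj[OF psd_id]]
  by (simp add: cip_self op_trace_def sqn_basis)

text \<open>Parseval at \<open>q l\<close>, keeping only the l-th term.\<close>

lemma tight_frame_sqn_le_1:
  assumes "tight_frame d r q" "l < d"
  shows "sqn r (q l) \<le> 1"
proof -
  have "(cmod (cip r (q l) (q l)))\<^sup>2 \<le> (\<Sum>m<d. (cmod (cip r (q m) (q l)))\<^sup>2)"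
    using assms(2) by (intro member_le_sum) auto
  then have "sqn r (q l) * sqn r (q l) \<le> 1 * sqn r (q l)"
    using tight_frame_Parseval[OF assms(1), of "q l"] by (simp add: cip_self power2_eq_square)
  then show ?thesis using sqn_nonneg[of r "q l"]
    by (cases "sqn r (q l) = 0") (auto simp: mult_le_cancel_right)
qed

section \<open>Rademacher signs and sampling without replacement\<close>

abbreviation E :: "'a pmf \<Rightarrow> ('a \<Rightarrow> real) \<Rightarrow> real" where
  "E p f \<equiv> measure_pmf.expectation p f"

lemma expectation_add:
  fixes f :: "'a \<Rightarrow> real"
  assumes "finite (set_pmf p)"
  shows "E p (\<lambda>x. f x + g x) = E p f + E p g"
  by (intro Bochner_Integration.integral_add integrable_measure_pmf_finite assms)

lemma expectation_sum:
  fixes f :: "'i \<Rightarrow> 'a \<Rightarrow> real"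
  assumes "finite (set_pmf p)"
  shows "E p (\<lambda>x. \<Sum>i\<in>A. f i x) = (\<Sum>i\<in>A. E p (f i))"
  by (intro Bochner_Integration.integral_sum integrable_measure_pmf_finite assms)

lemma expectation_mono:
  fixes f :: "'a \<Rightarrow> real"
  assumes "finite (set_pmf p)" and "\<And>x. x \<in> set_pmf p \<Longrightarrow> f x \<le> g x"
  shows "E p f \<le> E p g"
  by (intro integral_mono_AE integrable_measure_pmf_finite assms AE_pmfI)

lemma expectation_eq_sum:
  fixes f :: "'a \<Rightarrow> real"
  assumes "finite (set_pmf p)"
  shows "E p f = (\<Sum>x\<in>set_pmf p. f x * pmf p x)"
  by (rule integral_measure_pmf_real) (use assms in auto)

lemma expectation_bind:
  fixes f :: "'b \<Rightarrow> real"
  assumes "finite (set_pmf p)" "\<And>x. x \<in> set_pmf p \<Longrightarrow> finite (set_pmf (q x))"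
  shows "E (p \<bind> q) f = E p (\<lambda>x. E (q x) f)"
  using assms by (subst pmf_expectation_bind[of "set_pmf p"]) (auto simp: expectation_eq_sum[of p] mult.commute)

lemma expectation_pair_pmf:
  fixes f :: "'a \<times> 'b \<Rightarrow> real"
  assumes "finite (set_pmf p)" "finite (set_pmf q)"
  shows "E (pair_pmf p q) f = E p (\<lambda>x. E q (\<lambda>y. f (x, y)))"
  unfolding pair_pmf_def using assms by (simp add: expectation_bind)

lemma expectation_swap:
  fixes f :: "'a \<Rightarrow> 'b \<Rightarrow> real"
  assumes "finite (set_pmf p)" "finite (set_pmf q)"
  shows "E p (\<lambda>x. E q (f x)) = E q (\<lambda>y. E p (\<lambda>x. f x y))"
  unfolding expectation_eq_sum[OF assms(1)] expectation_eq_sum[OF assms(2)] sum_distrib_right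
  by (subst sum.swap) (simp add: mult.assoc mult.left_commute mult.commute)

lemma finite_set_Pi_pmf:
  assumes "finite A" "\<And>x. x \<in> A \<Longrightarrow> finite (set_pmf (p x))"
  shows "finite (set_pmf (Pi_pmf A dflt p))"
  using assms by (simp add: set_Pi_pmf finite_PiE_dflt)

lemma expectation_Pi_pmf_insert:
  fixes f :: "('i \<Rightarrow> 'a) \<Rightarrow> real"
  assumes "finite A" "x \<notin> A" "\<And>i. i \<in> insert x A \<Longrightarrow> finite (set_pmf (p i))"
  shows "E (Pi_pmf (insert x A) dflt p) f = E (p x) (\<lambda>y. E (Pi_pmf A dflt p) (\<lambda>g. f (g(x := y))))"
  using assms by (simp add: Pi_pmf_insert expectation_pair_pmf finite_set_Pi_pmf)

section \<open>Second and fourth moments of Rademacher sums\<close>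

definition sign_pmf :: "real pmf" where
  "sign_pmf = pmf_of_set {- 1, 1}"

definition rademacher :: "'i set \<Rightarrow> ('i \<Rightarrow> real) pmf" where
  "rademacher A = Pi_pmf A 0 (\<lambda>_. sign_pmf)"

lemma set_sign_pmf: "set_pmf sign_pmf = {- 1, 1}"
  by (simp add: sign_pmf_def)

lemma expectation_sign: "E sign_pmf f = (f 1 + f (- 1)) / 2"
  unfolding sign_pmf_def by (subst integral_pmf_of_set) auto

lemma finite_set_rademacher: "finite A \<Longrightarrow> finite (set_pmf (rademacher A))"
  unfolding rademacher_def by (rule finite_set_Pi_pmf) (auto simp: set_sign_pmf)

lemma expectation_rademacher_empty: "E (rademacher {}) f = f (\<lambda>_. 0)"
  by (simp add: rademacher_def)

lemma expectation_rademacher_insert: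
  assumes "finite A" "x \<notin> A"
  shows "E (rademacher (insert x A)) f = E (rademacher A) (\<lambda>\<rho>. (f (\<rho>(x := 1)) + f (\<rho>(x := - 1))) / 2)"
proof -
  have "E (rademacher (insert x A)) f = E sign_pmf (\<lambda>y. E (rademacher A) (\<lambda>g. f (g(x := y))))"
    unfolding rademacher_def by (rule expectation_Pi_pmf_insert) (use assms in \<open>auto simp: set_sign_pmf\<close>)
  also have "\<dots> = E (rademacher A) (\<lambda>g. E sign_pmf (\<lambda>y. f (g(x := y))))"
    by (rule expectation_swap) (use assms in \<open>auto simp: set_sign_pmf finite_set_rademacher\<close>)
  finally show ?thesis by (simp add: expectation_sign)
qed

definition quad :: "'i set \<Rightarrow> ('i \<Rightarrow> 'i \<Rightarrow> real) \<Rightarrow> ('i \<Rightarrow> real) \<Rightarrow> real" where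
  "quad A b \<rho> = (\<Sum>i\<in>A. \<Sum>j\<in>A. \<rho> i * \<rho> j * b i j)"

lemma quad_insert:
  assumes "finite A" "x \<notin> A"
  shows "quad (insert x A) b (\<rho>(x := y)) = quad A b \<rho> + y\<^sup>2 * b x x + y * (\<Sum>i\<in>A. \<rho> i * (b x i + b i x))"
proof -
  have [simp]: "(\<Sum>i\<in>A. (\<rho>(x := y)) i * h i) = (\<Sum>i\<in>A. \<rho> i * h i)" for h
    using assms by (intro sum.cong) auto
  have 1: "(\<Sum>i\<in>A. (\<rho>(x := y)) i * y * b i x + (\<Sum>j\<in>A. (\<rho>(x := y)) i * (\<rho>(x := y)) j * b i j))
     = (\<Sum>i\<in>A. \<rho> i * y * b i x + (\<Sum>j\<in>A. \<rho> i * \<rho> j * b i j))"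
    using assms by (intro sum.cong arg_cong2[where f="(+)"]) auto
  have 2: "(\<Sum>j\<in>A. y * (\<rho>(x := y)) j * b x j) = (\<Sum>j\<in>A. y * \<rho> j * b x j)"
    using assms by (intro sum.cong) auto
  show ?thesis
    unfolding quad_def using assms 1 2
    by (simp add: sum.distrib sum_distrib_left algebra_simps power2_eq_square)
qed

lemma expectation_quad:
  assumes "finite A"
  shows "E (rademacher A) (quad A b) = (\<Sum>i\<in>A. b i i)"
  using assms
proof (induction A rule: finite_induct)
  case empty
  then show ?case by (simp add: expectation_rademacher_empty quad_def)
next
  case (insert x A)
  have "E (rademacher (insert x A)) (quad (insert x A) b) = E (rademacher A) (\<lambda>\<rho>. quad A b \<rho> + b x x)"
    unfolding expectation_rademacher_insert[OF insert(1,2)] quad_insert[OF insert(1,2)]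
    by (intro Bochner_Integration.integral_cong refl) (simp add: field_simps)
  also have "\<dots> = (\<Sum>i\<in>A. b i i) + b x x"
    using insert by (simp add: expectation_add finite_set_rademacher)
  finally show ?case using insert by simp
qed

text \<open>Of the products of four signs those survive whose indices pair up: within the two forms,
  or across them in two ways that symmetry makes equal, hence the factor 2.\<close>

lemma expectation_quad_mult:
  assumes "finite A" and "\<And>i j. b i j = b j i" and "\<And>i j. c i j = c j i"
  shows "E (rademacher A) (\<lambda>\<rho>. quad A b \<rho> * quad A c \<rho>) =
    (\<Sum>i\<in>A. b i i * c i i) + (\<Sum>i\<in>A. \<Sum>k\<in>A - {i}. b i i * c k k + 2 * b i k * c i k)"
  using assms(1)
proof (induction A rule: finite_induct)
  case empty
  then show ?case by (simp add: expectation_rademacher_empty quad_def)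
next
  case (insert x A)
  note fin = finite_set_rademacher[OF insert(1)]
  let ?R = "E (rademacher A)"
  define lb where "lb = (\<lambda>\<rho>. \<Sum>i\<in>A. \<rho> i * b x i)"
  define lc where "lc = (\<lambda>\<rho>. \<Sum>i\<in>A. \<rho> i * c x i)"
  have lin: "(\<Sum>i\<in>A. \<rho> i * (b x i + b i x)) = 2 * lb \<rho>" "(\<Sum>i\<in>A. \<rho> i * (c x i + c i x)) = 2 * lc \<rho>" for \<rho>
    unfolding lb_def lc_def sum_distrib_left assms(2)[of _ x] assms(3)[of _ x] by (simp_all add: mult.left_commute)
  have lblc: "lb \<rho> * lc \<rho> = quad A (\<lambda>i j. b x i * c x j) \<rho>" for \<rho>
    unfolding lb_def lc_def quad_def sum_product by (simp add: algebra_simps)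
  \<comment> \<open>Both forms are affine in the new sign, whose square is 1. Averaging removes the
    odd terms and leaves the product of the two linear parts, each carrying a factor 2.\<close>
  have "E (rademacher (insert x A)) (\<lambda>\<rho>. quad (insert x A) b \<rho> * quad (insert x A) c \<rho>)
     = ?R (\<lambda>\<rho>. quad A b \<rho> * quad A c \<rho> + (c x x * quad A b \<rho> + (b x x * quad A c \<rho> +
          (b x x * c x x + 4 * quad A (\<lambda>i j. b x i * c x j) \<rho>))))"
    unfolding expectation_rademacher_insert[OF insert(1,2)] quad_insert[OF insert(1,2)] lin lblc[symmetric]
    by (intro Bochner_Integration.integral_cong refl) (simp add: field_simps)
  also have "\<dots> = ?R (\<lambda>\<rho>. quad A b \<rho> * quad A c \<rho>) + (c x x * (\<Sum>i\<in>A. b i i) + (b x x * (\<Sum>i\<in>A. c i i) +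
          (b x x * c x x + 4 * (\<Sum>i\<in>A. b x i * c x i))))"
    by (simp only: expectation_add[OF fin] integral_mult_right_zero expectation_quad[OF insert(1)])
       (simp add: measure_pmf.prob_space)
  also have "\<dots> = (\<Sum>i\<in>insert x A. b i i * c i i) + (\<Sum>i\<in>insert x A. \<Sum>k\<in>insert x A - {i}. b i i * c k k + 2 * b i k * c i k)"
  proof -
    have "(\<Sum>k\<in>insert x A - {i}. b i i * c k k + 2 * b i k * c i k) =
        (\<Sum>k\<in>A - {i}. b i i * c k k + 2 * b i k * c i k) + (b i i * c x x + 2 * b x i * c x i)" if "i \<in> A" for i
    proof -
      have "insert x A - {i} = insert x (A - {i})" using that insert by auto
      then show ?thesis using insert assms(2)[of i x] assms(3)[of i x] by simp
    qed
    then have "(\<Sum>i\<in>A. \<Sum>k\<in>insert x A - {i}. b i i * c k k + 2 * b i k * c i k) =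
        (\<Sum>i\<in>A. \<Sum>k\<in>A - {i}. b i i * c k k + 2 * b i k * c i k)
        + (c x x * (\<Sum>i\<in>A. b i i) + 2 * (\<Sum>i\<in>A. b x i * c x i))"
      by (simp add: sum.distrib sum_distrib_left mult.commute mult.left_commute)
    moreover have "insert x A - {x} = A" using insert by auto
    moreover have "(\<Sum>k\<in>A. b x x * c k k + 2 * b x k * c x k) =
        b x x * (\<Sum>k\<in>A. c k k) + 2 * (\<Sum>k\<in>A. b x k * c x k)"
      by (simp add: sum.distrib sum_distrib_left mult.assoc)
    ultimately show ?thesis
      unfolding insert.IH sum.insert[OF insert(1,2)] by simp
  qed
  finally show ?case .
qed

section \<open>Uniform samples without replacement\<close>

definition distinct_lists :: "nat \<Rightarrow> nat \<Rightarrow> nat list set" where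
  "distinct_lists d \<xi> = {s. length s = \<xi> \<and> distinct s \<and> set s \<subseteq> {..<d}}"

lemma finite_distinct_lists: "finite (distinct_lists d \<xi>)"
  by (rule finite_subset[OF _ finite_lists_length_eq[of "{..<d}" \<xi>]]) (auto simp: distinct_lists_def)

lemma distinct_lists_nonempty: "\<xi> \<le> d \<Longrightarrow> distinct_lists d \<xi> \<noteq> {}"
  by (auto simp: distinct_lists_def intro!: exI[of _ "[0..<\<xi>]"])

lemma sum_distinct_lists_permute:
  fixes g :: "nat list \<Rightarrow> real"
  assumes "\<pi> permutes {..<d}"
  shows "(\<Sum>s\<in>distinct_lists d \<xi>. g (map \<pi> s)) = (\<Sum>s\<in>distinct_lists d \<xi>. g s)"
proof (rule sum.reindex_bij_witness[where j="map \<pi>" and i="map (inv_into UNIV \<pi>)"])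
  have inv: "\<pi> (inv_into UNIV \<pi> x) = x" "inv_into UNIV \<pi> (\<pi> x) = x" for x
    using permutes_inverses[OF assms] by auto
  have perm: "map \<sigma> s \<in> distinct_lists d \<xi>" if "\<sigma> permutes {..<d}" "s \<in> distinct_lists d \<xi>" for \<sigma> s
    using that permutes_image[OF that(1)] inj_on_subset[OF permutes_inj[OF that(1)]]
    by (auto simp: distinct_lists_def distinct_map)
  show "map (inv_into UNIV \<pi>) (map \<pi> s) = s" for s by (simp add: inv o_def)
  show "map \<pi> (map (inv_into UNIV \<pi>) s) = s" for s by (simp add: inv o_def)
  show "map \<pi> s \<in> distinct_lists d \<xi>" if "s \<in> distinct_lists d \<xi>" for s by (rule perm[OF assms that])
  show "map (inv_into UNIV \<pi>) s \<in> distinct_lists d \<xi>" if "s \<in> distinct_lists d \<xi>" for s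
    by (rule perm[OF permutes_inv[OF assms] that])
qed auto

text \<open>Permuting the coordinates preserves the set of lists, so all values at position
  \<open>i\<close> are equally frequent; \<open>N\<close> counts them. Writing the factor d on the
  left rather than a quotient on the right also covers d = 0.\<close>

lemma sum_distinct_lists_nth:
  fixes f :: "nat \<Rightarrow> real"
  assumes "i < \<xi>"
  shows "d * (\<Sum>s\<in>distinct_lists d \<xi>. f (s ! i)) = card (distinct_lists d \<xi>) * (\<Sum>l<d. f l)"
proof -
  let ?X = "distinct_lists d \<xi>"
  have r: "s ! i < d" "length s = \<xi>" if "s \<in> ?X" for s using that assms by (auto simp: distinct_lists_def dest: nth_mem)
  define N where "N = (\<lambda>l. \<Sum>s\<in>?X. if s ! i = l then 1 else 0 :: real)"
  have N: "N l = N m" if "l < d" "m < d" for l m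
  proof -
    have p: "Transposition.transpose l m permutes {..<d}" using that by (intro permutes_swap_id) auto
    have "N l = (\<Sum>s\<in>?X. if map (Transposition.transpose l m) s ! i = m then 1 else 0 :: real)"
      unfolding N_def using assms
      by (intro sum.cong refl) (auto simp: r Transposition.transpose_def)
    also have "\<dots> = N m" unfolding N_def by (rule sum_distinct_lists_permute[OF p])
    finally show ?thesis .
  qed
  have S: "(\<Sum>s\<in>?X. f (s ! i)) = (\<Sum>l<d. N l * f l)" for f :: "nat \<Rightarrow> real"
  proof -
    have "(\<Sum>s\<in>?X. f (s ! i)) = (\<Sum>s\<in>?X. \<Sum>l<d. if s ! i = l then f l else 0)"
      using r by (intro sum.cong refl) (simp add: sum.delta)
    also have "\<dots> = (\<Sum>l<d. \<Sum>s\<in>?X. (if s ! i = l then 1 else 0) * f l)"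
      by (subst sum.swap) (simp add: if_distrib if_distribR cong: if_cong)
    finally show ?thesis by (simp add: N_def sum_distrib_right)
  qed
  show ?thesis
  proof (cases "d = 0")
    case False
    have N0: "N l = N 0" if "l < d" for l using N[OF that, of 0] False by blast
    have S0: "(\<Sum>l<d. N l * f l) = N 0 * (\<Sum>l<d. f l)" for f
      unfolding sum_distrib_left by (intro sum.cong refl arg_cong2[where f="(*)"] N0) auto
    have "real (card ?X) = d * N 0" using S[of "\<lambda>_. 1"] S0[of "\<lambda>_. 1"] by simp
    moreover have "(\<Sum>s\<in>?X. f (s ! i)) = N 0 * (\<Sum>l<d. f l)" unfolding S by (rule S0)
    ultimately show ?thesis by simp
  qed simp
qed

text \<open>Double transitivity of the symmetric group: at two given positions all ordered pairs of
  distinct coordinates are equally frequent. For d \<le> 1 both sides vanish.\<close>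

lemma sum_distinct_lists_nth_nth:
  fixes f :: "nat \<Rightarrow> nat \<Rightarrow> real"
  assumes "i < \<xi>" "k < \<xi>" "i \<noteq> k"
  shows "d * (d - 1) * (\<Sum>s\<in>distinct_lists d \<xi>. f (s ! i) (s ! k)) =
    card (distinct_lists d \<xi>) * (\<Sum>l<d. \<Sum>m\<in>{..<d} - {l}. f l m)"
proof -
  let ?X = "distinct_lists d \<xi>"
  have r: "s ! i < d" "s ! k < d" "s ! i \<noteq> s ! k" "length s = \<xi>" if "s \<in> ?X" for s
    using that assms by (auto simp: distinct_lists_def nth_eq_iff_index_eq dest: nth_mem)
  define N where "N = (\<lambda>l m. \<Sum>s\<in>?X. if s ! i = l \<and> s ! k = m then 1 else 0 :: real)"
  have N: "N l m = N l' m'" if "l < d" "m < d" "l' < d" "m' < d" "l \<noteq> m" "l' \<noteq> m'" for l m l' m'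
  proof -
    \<comment> \<open>The first swap takes \<open>l\<close> to \<open>l'\<close> and
      \<open>m\<close> to \<open>m1\<close>; the second takes \<open>m1\<close> to \<open>m'\<close>
      and fixes \<open>l'\<close>, which differs from both.\<close>
    define m1 where "m1 = Transposition.transpose l l' m"
    have m1: "m1 < d" "m1 \<noteq> l'" using that by (auto simp: m1_def Transposition.transpose_def)
    define \<pi> where "\<pi> = Transposition.transpose m1 m' \<circ> Transposition.transpose l l'"
    have p: "\<pi> permutes {..<d}" unfolding \<pi>_def using that m1
      by (intro permutes_compose permutes_swap_id) auto
    have inj: "\<pi> x = \<pi> y \<longleftrightarrow> x = y" for x y using permutes_inj[OF p] by (auto dest: injD)
    have "\<pi> l = l'" using that m1 by (simp add: \<pi>_def Transposition.transpose_def)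
    moreover have "\<pi> m = m'" by (simp add: \<pi>_def m1_def[symmetric])
    ultimately have "N l m = (\<Sum>s\<in>?X. if map \<pi> s ! i = l' \<and> map \<pi> s ! k = m' then 1 else 0 :: real)"
      unfolding N_def using assms inj
      by (intro sum.cong refl) (metis (no_types, lifting) nth_map r(4))
    also have "\<dots> = N l' m'" unfolding N_def by (rule sum_distinct_lists_permute[OF p])
    finally show ?thesis .
  qed
  have S: "(\<Sum>s\<in>?X. f (s ! i) (s ! k)) = (\<Sum>l<d. \<Sum>m\<in>{..<d} - {l}. N l m * f l m)" for f :: "nat \<Rightarrow> nat \<Rightarrow> real"
  proof -
    have "(\<Sum>l<d. \<Sum>m\<in>{..<d} - {l}. if s ! i = l \<and> s ! k = m then f l m else 0) = f (s ! i) (s ! k)"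
      if "s \<in> ?X" for s
    proof -
      have "(\<Sum>m\<in>{..<d} - {l}. if s ! i = l \<and> s ! k = m then f l m else 0) = (if s ! i = l then f l (s ! k) else 0)" for l
        using r[OF that] by (simp add: sum.delta if_distrib cong: if_cong)
      then show ?thesis using r[OF that] by (simp add: sum.delta)
    qed
    then have "(\<Sum>s\<in>?X. f (s ! i) (s ! k)) = (\<Sum>s\<in>?X. \<Sum>l<d. \<Sum>m\<in>{..<d} - {l}. if s ! i = l \<and> s ! k = m then f l m else 0)"
      by simp
    also have "\<dots> = (\<Sum>l<d. \<Sum>s\<in>?X. \<Sum>m\<in>{..<d} - {l}. if s ! i = l \<and> s ! k = m then f l m else 0)"
      by (rule sum.swap)
    also have "\<dots> = (\<Sum>l<d. \<Sum>m\<in>{..<d} - {l}. \<Sum>s\<in>?X. if s ! i = l \<and> s ! k = m then f l m else 0)"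
      by (intro sum.cong refl sum.swap)
    also have "\<dots> = (\<Sum>l<d. \<Sum>m\<in>{..<d} - {l}. N l m * f l m)"
      unfolding N_def sum_distrib_right by (intro sum.cong refl) auto
    finally show ?thesis .
  qed
  show ?thesis
  proof (cases "d \<le> 1")
    case True
    then have "d = 0 \<or> d = 1" by auto
    then show ?thesis by (auto simp: lessThan_Suc)
  next
    case False
    have N0: "N l m = N 0 1" if "l < d" "m \<in> {..<d} - {l}" for l m using N[of l m 0 1] that False by auto
    have S0: "(\<Sum>l<d. \<Sum>m\<in>{..<d} - {l}. N l m * f l m) = N 0 1 * (\<Sum>l<d. \<Sum>m\<in>{..<d} - {l}. f l m)" for f
      unfolding sum_distrib_left by (intro sum.cong refl arg_cong2[where f="(*)"] N0) auto
    have "real (card ?X) = d * (d - 1) * N 0 1"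
      using S[of "\<lambda>_ _. 1"] S0[of "\<lambda>_ _. 1"] False by (simp add: of_nat_diff)
    moreover have "(\<Sum>s\<in>?X. f (s ! i) (s ! k)) = N 0 1 * (\<Sum>l<d. \<Sum>m\<in>{..<d} - {l}. f l m)"
      unfolding S by (rule S0)
    ultimately show ?thesis using False by (simp add: of_nat_diff)
  qed
qed

section \<open>Comparison of one sparse column with a signed dense column\<close>

text \<open>The coefficients of a column are real over either scalar field, so a single law on real
  functions serves both.\<close>

definition sparse_law :: "nat \<Rightarrow> nat \<Rightarrow> (nat \<Rightarrow> real) pmf" where
  "sparse_law d \<xi> = do {
     \<rho> \<leftarrow> rademacher {..<\<xi>};
     s \<leftarrow> pmf_of_set (distinct_lists d \<xi>);
     return_pmf (\<lambda>l. sqrt (real d / real \<xi>) * (\<Sum>i<\<xi>. \<rho> i * (if s ! i = l then 1 else 0)))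
   }"

lemma finite_set_sparse_law: "\<xi> \<le> d \<Longrightarrow> finite (set_pmf (sparse_law d \<xi>))"
  by (simp add: sparse_law_def finite_set_rademacher finite_distinct_lists distinct_lists_nonempty)

text \<open>The positions are fixed before the signs are averaged, so that the Rademacher identities
  apply to each list.\<close>

lemma expectation_sparse_law:
  fixes f :: "(nat \<Rightarrow> real) \<Rightarrow> real"
  assumes "\<xi> \<le> d"
  shows "E (sparse_law d \<xi>) f = (\<Sum>s\<in>distinct_lists d \<xi>. E (rademacher {..<\<xi>})
      (\<lambda>\<rho>. f (\<lambda>l. sqrt (real d / real \<xi>) * (\<Sum>i<\<xi>. \<rho> i * (if s ! i = l then 1 else 0))))) / card (distinct_lists d \<xi>)"
proof -
  note fin = finite_distinct_lists distinct_lists_nonempty[OF assms]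
  let ?P = "pmf_of_set (distinct_lists d \<xi>)"
  let ?g = "\<lambda>\<rho> s. f (\<lambda>l. sqrt (real d / real \<xi>) * (\<Sum>i<\<xi>. \<rho> i * (if s ! i = l then 1 else 0)))"
  have fp: "finite (set_pmf ?P)" using fin by simp
  have "E (sparse_law d \<xi>) f = E (rademacher {..<\<xi>}) (\<lambda>\<rho>. E ?P (?g \<rho>))"
    unfolding sparse_law_def using fin
    by (simp add: expectation_bind finite_set_rademacher)
  also have "\<dots> = E ?P (\<lambda>s. E (rademacher {..<\<xi>}) (\<lambda>\<rho>. ?g \<rho> s))"
    by (rule expectation_swap) (use fp in \<open>auto simp: finite_set_rademacher\<close>)
  also have "\<dots> = (\<Sum>s\<in>distinct_lists d \<xi>. E (rademacher {..<\<xi>}) (\<lambda>\<rho>. ?g \<rho> s)) / card (distinct_lists d \<xi>)"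
    by (rule integral_pmf_of_set) (use fin in auto)
  finally show ?thesis .
qed

text \<open>A form in a sparse column is a form in its signs, with the matrix read at the sampled
  coordinates; the factor d / \<xi> is the squared scaling.\<close>

lemma quad_sparse:
  assumes "s \<in> distinct_lists d \<xi>"
  shows "quad {..<d} b (\<lambda>l. sqrt (real d / real \<xi>) * (\<Sum>i<\<xi>. \<rho> i * (if s ! i = l then 1 else 0))) =
    (d / \<xi>) * quad {..<\<xi>} (\<lambda>i j. b (s ! i) (s ! j)) \<rho>"
proof -
  define c where "c = sqrt (real d / real \<xi>)"
  have r: "s ! i < d" if "i < \<xi>" for i
    using that assms by (auto simp: distinct_lists_def dest: nth_mem)
  define w where "w = (\<lambda>l. c * (\<Sum>i<\<xi>. \<rho> i * (if s ! i = l then 1 else 0)))"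
  have lin: "(\<Sum>l<d. w l * h l) = c * (\<Sum>i<\<xi>. \<rho> i * h (s ! i))" for h
  proof -
    have "(\<Sum>l<d. w l * h l) = (\<Sum>l<d. \<Sum>i<\<xi>. c * \<rho> i * (if s ! i = l then h l else 0))"
      unfolding w_def sum_distrib_left sum_distrib_right by (intro sum.cong refl) auto
    also have "\<dots> = (\<Sum>i<\<xi>. \<Sum>l<d. c * \<rho> i * (if s ! i = l then h l else 0))" by (rule sum.swap)
    also have "\<dots> = (\<Sum>i<\<xi>. c * \<rho> i * h (s ! i))"
      using r by (intro sum.cong refl) (simp add: sum_distrib_left[symmetric])
    finally show ?thesis by (simp add: sum_distrib_left mult.assoc)
  qed
  have "quad {..<d} b w = (\<Sum>l<d. w l * (\<Sum>m<d. w m * b l m))"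
    by (simp add: quad_def sum_distrib_left mult.assoc)
  also have "\<dots> = c * c * (\<Sum>i<\<xi>. \<rho> i * (\<Sum>j<\<xi>. \<rho> j * b (s ! i) (s ! j)))"
    unfolding lin by (simp add: sum_distrib_left mult.assoc mult.left_commute)
  also have "\<dots> = (d / \<xi>) * quad {..<\<xi>} (\<lambda>i j. b (s ! i) (s ! j)) \<rho>"
    by (simp add: quad_def sum_distrib_left mult.assoc c_def)
  finally show ?thesis by (simp add: w_def c_def)
qed

lemma expectation_sparse_quad:
  assumes "1 \<le> \<xi>" "\<xi> \<le> d"
  shows "E (sparse_law d \<xi>) (quad {..<d} b) = (\<Sum>l<d. b l l)"
proof -
  let ?X = "distinct_lists d \<xi>"
  have card: "card ?X > 0" using finite_distinct_lists distinct_lists_nonempty[OF assms(2)] by (simp add: card_gt_0_iff)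
  have one: "(\<Sum>s\<in>?X. b (s ! i) (s ! i)) = card ?X * (\<Sum>l<d. b l l) / d" if "i < \<xi>" for i
    using sum_distinct_lists_nth[OF that, of d "\<lambda>l. b l l"] assms by (simp add: field_simps)
  have "E (sparse_law d \<xi>) (quad {..<d} b) = (\<Sum>s\<in>?X. (d / \<xi>) * (\<Sum>i<\<xi>. b (s ! i) (s ! i))) / card ?X"
    unfolding expectation_sparse_law[OF assms(2)]
    by (intro arg_cong2[where f="(/)"] sum.cong refl) (simp add: quad_sparse expectation_quad)
  also have "\<dots> = (d / \<xi>) * (\<Sum>i<\<xi>. \<Sum>s\<in>?X. b (s ! i) (s ! i)) / card ?X"
    by (subst sum.swap) (simp add: sum_distrib_left)
  also have "\<dots> = (d / \<xi>) * (\<xi> * (card ?X * (\<Sum>l<d. b l l) / d)) / card ?X"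
    using one by simp
  finally show ?thesis using card assms by simp
qed

text \<open>Sampling keeps the shape of the Rademacher fourth moment and only reweights it: the
  diagonal by d / \<xi>, the pairs of distinct coordinates by \<kappa>.\<close>

lemma expectation_sparse_quad_mult:
  assumes "1 \<le> \<xi>" "\<xi> \<le> d" and "\<And>i j. b i j = b j i" and "\<And>i j. c i j = c j i"
  obtains \<kappa> where "0 \<le> \<kappa>" "\<kappa> \<le> 1"
    "E (sparse_law d \<xi>) (\<lambda>\<omega>. quad {..<d} b \<omega> * quad {..<d} c \<omega>) =
      (d / \<xi>) * (\<Sum>l<d. b l l * c l l) + \<kappa> * (\<Sum>l<d. \<Sum>m\<in>{..<d} - {l}. b l l * c m m + 2 * b l m * c l m)"
proof
  let ?X = "distinct_lists d \<xi>"
  let ?t = "\<lambda>l m. b l l * c m m + 2 * b l m * c l m"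
  let ?T = "\<Sum>l<d. \<Sum>m\<in>{..<d} - {l}. ?t l m"
  let ?D = "\<Sum>l<d. b l l * c l l"
  \<comment> \<open>The fourth power of the scaling times the probability that two given distinct
    coordinates are both sampled. It is at most 1 because (\<xi> - 1) / \<xi> \<le> (d - 1) / d; for
    d = 1 the division by zero makes it 0.\<close>
  define \<kappa> where "\<kappa> = (d / \<xi>)\<^sup>2 * (real \<xi> * (real \<xi> - 1) / (real d * (real d - 1)))"
  have card: "card ?X > 0" using finite_distinct_lists distinct_lists_nonempty[OF assms(2)] by (simp add: card_gt_0_iff)
  show "0 \<le> \<kappa>" using assms unfolding \<kappa>_def by (intro mult_nonneg_nonneg divide_nonneg_nonneg) auto
  show "\<kappa> \<le> 1"
  proof (cases "d = 1")
    case False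
    then have d: "real d > 1" "real \<xi> \<ge> 1" "real \<xi> \<le> real d" using assms by auto
    have "\<kappa> = (real d * (real \<xi> - 1)) / (real \<xi> * (real d - 1))"
      using d by (simp add: \<kappa>_def power2_eq_square field_simps)
    also have "\<dots> \<le> 1" using d by (simp add: field_simps)
    finally show ?thesis .
  qed (simp add: \<kappa>_def)
  have one: "(\<Sum>s\<in>?X. b (s ! i) (s ! i) * c (s ! i) (s ! i)) = card ?X * ?D / d" if "i < \<xi>" for i
    using sum_distinct_lists_nth[OF that, of d "\<lambda>l. b l l * c l l"] assms by (simp add: field_simps)
  have two: "(\<Sum>s\<in>?X. ?t (s ! i) (s ! k)) = card ?X * ?T / (real d * (real d - 1))"
    if "i < \<xi>" "k \<in> {..<\<xi>} - {i}" for i k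
  proof -
    have ik: "i < \<xi>" "k < \<xi>" "i \<noteq> k" using that by auto
    then have "real d * (real d - 1) \<noteq> 0" using assms(2) by auto
    then show ?thesis using sum_distinct_lists_nth_nth[OF ik, of d ?t] by (simp add: field_simps)
  qed
  have "E (sparse_law d \<xi>) (\<lambda>\<omega>. quad {..<d} b \<omega> * quad {..<d} c \<omega>) =
     (\<Sum>s\<in>?X. (d / \<xi>)\<^sup>2 * ((\<Sum>i<\<xi>. b (s ! i) (s ! i) * c (s ! i) (s ! i)) +
        (\<Sum>i<\<xi>. \<Sum>k\<in>{..<\<xi>} - {i}. ?t (s ! i) (s ! k)))) / card ?X"
  proof -
    have "E (rademacher {..<\<xi>}) (\<lambda>\<rho>. (d / \<xi>) * quad {..<\<xi>} (\<lambda>i j. b (s ! i) (s ! j)) \<rho> *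
          ((d / \<xi>) * quad {..<\<xi>} (\<lambda>i j. c (s ! i) (s ! j)) \<rho>)) =
      (d / \<xi>)\<^sup>2 * E (rademacher {..<\<xi>}) (\<lambda>\<rho>. quad {..<\<xi>} (\<lambda>i j. b (s ! i) (s ! j)) \<rho> *
          quad {..<\<xi>} (\<lambda>i j. c (s ! i) (s ! j)) \<rho>)" for s :: "nat list"
      unfolding integral_mult_right_zero[symmetric] power2_eq_square
      by (intro Bochner_Integration.integral_cong refl) simp
    then show ?thesis
      unfolding expectation_sparse_law[OF assms(2)]
      using assms(3,4)
      by (intro arg_cong2[where f="(/)"] sum.cong refl) (simp add: quad_sparse expectation_quad_mult)
  qed
  also have "\<dots> = (d / \<xi>)\<^sup>2 * ((\<Sum>i<\<xi>. \<Sum>s\<in>?X. b (s ! i) (s ! i) * c (s ! i) (s ! i)) +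
        (\<Sum>i<\<xi>. \<Sum>k\<in>{..<\<xi>} - {i}. \<Sum>s\<in>?X. ?t (s ! i) (s ! k))) / card ?X"
  proof -
    have "(\<Sum>s\<in>?X. C * ((\<Sum>i<\<xi>. h s i) + (\<Sum>i<\<xi>. \<Sum>k\<in>{..<\<xi>} - {i}. t s i k))) =
        C * ((\<Sum>i<\<xi>. \<Sum>s\<in>?X. h s i) + (\<Sum>i<\<xi>. \<Sum>k\<in>{..<\<xi>} - {i}. \<Sum>s\<in>?X. t s i k))"
      for C :: real and h t
      unfolding sum_distrib_left[symmetric] sum.distrib sum.swap[where A="distinct_lists d \<xi>"] ..
    from this[where C="(d / \<xi>)\<^sup>2" and h="\<lambda>s i. b (s ! i) (s ! i) * c (s ! i) (s ! i)"
        and t="\<lambda>s i k. ?t (s ! i) (s ! k)"]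
    show ?thesis by (simp only:)
  qed
  also have "(\<Sum>i<\<xi>. \<Sum>k\<in>{..<\<xi>} - {i}. \<Sum>s\<in>?X. ?t (s ! i) (s ! k)) =
      (\<Sum>i<\<xi>. \<Sum>k\<in>{..<\<xi>} - {i}. card ?X * ?T / (real d * (real d - 1)))"
    by (intro sum.cong refl two) auto
  also have "\<dots> = real \<xi> * (real \<xi> - 1) * (card ?X * ?T / (real d * (real d - 1)))"
    using assms(1) by (simp add: of_nat_diff)
  also have "(\<Sum>i<\<xi>. \<Sum>s\<in>?X. b (s ! i) (s ! i) * c (s ! i) (s ! i)) = \<xi> * (card ?X * ?D / d)"
    using one by simp
  also have "(d / \<xi>)\<^sup>2 * (\<xi> * (card ?X * ?D / d) + real \<xi> * (real \<xi> - 1) * (card ?X * ?T / (real d * (real d - 1)))) / card ?X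
     = (d / \<xi>) * ?D + \<kappa> * ?T"
  proof -
    have "(x / y)\<^sup>2 * (y * (N * D / x) + y * (y - 1) * (N * T / (x * (x - 1)))) / N =
        (x / y) * D + (x / y)\<^sup>2 * (y * (y - 1) / (x * (x - 1))) * T"
      if "x \<noteq> 0" "y \<noteq> 0" "N \<noteq> 0" for x y N D T :: real
      using that by (simp add: power2_eq_square distrib_left add_divide_distrib)
    then show ?thesis using card assms unfolding \<kappa>_def by auto
  qed
  finally show "E (sparse_law d \<xi>) (\<lambda>\<omega>. quad {..<d} b \<omega> * quad {..<d} c \<omega>) =
      (d / \<xi>) * ?D + \<kappa> * ?T" .
qed

text \<open>
  With \<open>D\<close> and \<open>T\<close> the diagonal and off-diagonal parts, the two expectations are \<open>(d / \<xi>) D + \<kappa> T\<close>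
  and \<open>D + T\<close>.  The sign of \<open>T\<close> is unknown, but \<open>T \<ge> - D\<close> because the dense expectation is nonnegative.
\<close>

lemma expectation_sparse_quad_mult_le:
  assumes "1 \<le> \<xi>" "\<xi> \<le> d" and "\<And>i j. b i j = b j i" and "\<And>i j. c i j = c j i"
    and "\<And>\<rho>. 0 \<le> quad {..<d} b \<rho>" and "\<And>\<rho>. 0 \<le> quad {..<d} c \<rho>"
    and "\<And>l. 0 \<le> b l l" and "\<And>l. 0 \<le> c l l"
  shows "E (sparse_law d \<xi>) (\<lambda>\<omega>. quad {..<d} b \<omega> * quad {..<d} c \<omega>) \<le>
    E (rademacher {..<d}) (\<lambda>\<rho>. quad {..<d} b \<rho> * quad {..<d} c \<rho>) + (d / \<xi>) * (\<Sum>l<d. b l l * c l l)"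
proof -
  let ?D = "\<Sum>l<d. b l l * c l l"
  let ?T = "\<Sum>l<d. \<Sum>m\<in>{..<d} - {l}. b l l * c m m + 2 * b l m * c l m"
  obtain \<kappa> where \<kappa>: "0 \<le> \<kappa>" "\<kappa> \<le> 1"
    "E (sparse_law d \<xi>) (\<lambda>\<omega>. quad {..<d} b \<omega> * quad {..<d} c \<omega>) = (d / \<xi>) * ?D + \<kappa> * ?T"
    by (rule expectation_sparse_quad_mult[OF assms(1-4)])
  have dense: "E (rademacher {..<d}) (\<lambda>\<rho>. quad {..<d} b \<rho> * quad {..<d} c \<rho>) = ?D + ?T"
    by (rule expectation_quad_mult[OF finite_lessThan assms(3,4)])
  have "0 \<le> E (rademacher {..<d}) (\<lambda>\<rho>. quad {..<d} b \<rho> * quad {..<d} c \<rho>)"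
    using assms by (intro integral_nonneg_AE) auto
  then have "(1 - \<kappa>) * (- ?D) \<le> (1 - \<kappa>) * ?T" using \<kappa>(2) dense by (intro mult_left_mono) linarith+
  moreover have "0 \<le> \<kappa> * ?D" by (intro mult_nonneg_nonneg sum_nonneg \<kappa>(1) assms(7,8))
  moreover have "w * D + k * T \<le> D + T + w * D" if "(1 - k) * (- D) \<le> (1 - k) * T" "0 \<le> k * D" for w k D T :: real
    using that by (simp add: algebra_simps)
  ultimately show ?thesis unfolding \<kappa>(3) dense by (simp only:)
qed

section \<open>Moments at random combinations of frame vectors\<close>

definition frame_comb :: "nat \<Rightarrow> (nat \<Rightarrow> nat \<Rightarrow> complex) \<Rightarrow> (nat \<Rightarrow> real) \<Rightarrow> nat \<Rightarrow> complex" where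
  "frame_comb d q \<omega> = (\<lambda>i. \<Sum>l<d. of_real (\<omega> l) * q l i)"

lemma cip_frame_comb_right: "cip r u (frame_comb d q \<omega>) = (\<Sum>l<d. of_real (\<omega> l) * cip r u (q l))"
  unfolding cip_def frame_comb_def sum_distrib_left
  by (subst sum.swap) (simp add: mult.left_commute)

text \<open>Turns a moment at a random vector into a form in its coefficients, to which the
  Rademacher and sampling identities apply. Real coefficients let the real part pass to the
  entries.\<close>

lemma mom_frame_comb:
  assumes "selfadj r K"
  shows "mom r K a (frame_comb d q \<omega>) = quad {..<d} (\<lambda>l m. Re (cip r (q l) ((K ^^ a) (q m)))) \<omega>"
proof -
  note sa = selfadjD[OF selfadj_funpow[OF assms], of a]
  have left: "cip r (frame_comb d q \<omega>) u = (\<Sum>l<d. of_real (\<omega> l) * cip r (q l) u)" for u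
    unfolding cip_cnj[of r u, symmetric] cip_frame_comb_right by (simp add: cip_cnj)
  have "cip r (frame_comb d q \<omega>) ((K ^^ a) (frame_comb d q \<omega>)) =
     (\<Sum>l<d. of_real (\<omega> l) * (\<Sum>m<d. of_real (\<omega> m) * cip r (q l) ((K ^^ a) (q m))))"
  proof -
    have "cip r u ((K ^^ a) (frame_comb d q \<omega>)) = (\<Sum>m<d. of_real (\<omega> m) * cip r u ((K ^^ a) (q m)))" for u
      by (simp only: sa[symmetric] cip_frame_comb_right)
    then show ?thesis unfolding left by simp
  qed
  then show ?thesis
    by (simp add: mom_def quad_def sum_distrib_left mult.assoc)
qed

lemma Re_cip_symmetric:
  assumes "selfadj r K"
  shows "Re (cip r u ((K ^^ a) v)) = Re (cip r v ((K ^^ a) u))"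
  using selfadjD[OF selfadj_funpow[OF assms], of a u v] cip_cnj[of r "(K ^^ a) u" v]
  by (metis cnj.simps(1))

text \<open>Isotropy evaluates the first-order term as a trace, the fourth moment of the sparse
  column is exchanged for the dense one plus a diagonal term, and the dense term is recognised as
  the gain from a random sign. The signed update has size 2 s instead of s: its gain is then four
  times the term to be absorbed, so the contraction factor, which is at least 1/4, can be pulled
  out.\<close>

lemma expectation_one_step:
  fixes d r \<xi> n :: nat and q :: "nat \<Rightarrow> nat \<Rightarrow> complex" and s a R \<mu> \<delta> :: real
  defines "X \<equiv> frame_comb d q"
  assumes frame: "tight_frame d r q" and xi: "1 \<le> \<xi>" "\<xi> \<le> d"
    and K: "near_id r \<delta> K" and small: "\<delta> + 2 * s * R \<le> 1 / 8" "0 \<le> \<delta>" "0 \<le> s"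
    and n: "2 \<le> n" and a: "a = n * s" "a \<le> 1"
    and coh: "\<And>l. l < d \<Longrightarrow> sqn r (q l) \<le> \<mu>" "a * (d / \<xi>) * \<mu> \<le> 1 / 8"
    and bdx: "\<And>\<omega>. \<omega> \<in> set_pmf (sparse_law d \<xi>) \<Longrightarrow> sqn r (X \<omega>) \<le> R"
    and bdy: "\<And>\<rho>. \<rho> \<in> set_pmf (rademacher {..<d}) \<Longrightarrow> sqn r (X \<rho>) \<le> R"
  shows "E (sparse_law d \<xi>) (\<lambda>\<omega>. op_trace r (rank_one_update r K (- s) (X \<omega>) ^^ n)) \<le>
    (1 - 3 / 4 * a) * E (pair_pmf sign_pmf (rademacher {..<d}))
      (\<lambda>(\<eta>, \<rho>). op_trace r (rank_one_update r K (2 * s * \<eta>) (X \<rho>) ^^ n))"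
proof -
  note finS = finite_set_sparse_law[OF xi(2)]
  note finR = finite_set_rademacher[OF finite_lessThan[of d]]
  obtain \<rho>0 where "\<rho>0 \<in> set_pmf (rademacher {..<d})" using set_pmf_not_empty by fast
  then have R: "0 \<le> R" using bdy sqn_nonneg[of r "X \<rho>0"] by (meson order_trans)
  have dl: "\<delta> \<le> 1 / 8" using small R by (smt (verit) mult_nonneg_nonneg)
  have psdK: "psd r K" using near_id_psd[OF K] dl by simp
  note sa = psd_selfadj[OF psdK]
  have sR: "2 * s * R \<le> 1 / 8 - \<delta>" using small by simp
  have psd_upd: "psd r (rank_one_update r K t z)" if "\<bar>t\<bar> \<le> 2 * s" "sqn r z \<le> R" for t z
  proof -
    have "\<bar>t\<bar> * sqn r z \<le> 2 * s * R" using that sqn_nonneg[of r z] small by (intro mult_mono) auto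
    then have "near_id r (\<delta> + (1 / 8 - \<delta>)) (rank_one_update r K t z)"
      using sR by (intro near_id_rank_one_update[OF K]) simp
    then show ?thesis by (rule near_id_psd) simp
  qed
  define B where "B = (\<lambda>a l m. Re (cip r (q l) ((K ^^ a) (q m))))"
  have B: "mom r K a (X \<omega>) = quad {..<d} (B a) \<omega>" for a \<omega>
    unfolding X_def B_def by (rule mom_frame_comb[OF sa])
  have Bsym: "B a l m = B a m l" for a l m unfolding B_def by (rule Re_cip_symmetric[OF sa])
  have Bdiag: "B a l l = mom r K a (q l)" for a l by (simp add: B_def mom_def)
  have tr: "(\<Sum>l<d. mom r K a (q l)) = op_trace r (K ^^ a)" for a
    using tight_frame_trace[OF frame selfadj_funpow[OF sa]] by (simp add: mom_def)
  define m where "m = op_trace r (K ^^ n)"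
  define V where "V = (\<Sum>e<n-1. real (n - 1 - e) *
     E (rademacher {..<d}) (\<lambda>\<rho>. mom r K (n - 2 - e) (X \<rho>) * mom r K e (X \<rho>)))"
  have V: "0 \<le> V" unfolding V_def
    by (intro sum_nonneg mult_nonneg_nonneg integral_nonneg_AE) (auto simp: mom_nonneg[OF psdK])
  have mu: "0 \<le> d / \<xi> * \<mu>" using coh(1)[of 0] sqn_nonneg[of r "q 0"] xi by auto
  have m0: "0 \<le> m" unfolding m_def by (rule op_trace_nonneg[OF psdK])
  have n1: "n = Suc (n - 1)" "n - 1 = Suc (n - 2)" using n by auto
  \<comment> \<open>Lowering the order of the trace from n costs 1 + \<delta> \<le> 9/8 in one
    direction and, for two orders, twice the factor 1 - \<delta> \<ge> 7/8 in the other.\<close>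
  have tr1: "8 / 9 * m \<le> op_trace r (K ^^ (n - 1))"
  proof -
    have "m \<le> (1 + \<delta>) * op_trace r (K ^^ (n - 1))"
      unfolding m_def using op_trace_Suc_le[OF K, of "n - 1"] n1 dl by simp
    also have "\<dots> \<le> (9 / 8) * op_trace r (K ^^ (n - 1))"
      using dl by (intro mult_right_mono op_trace_nonneg psdK) auto
    finally show ?thesis by simp
  qed
  have tr2: "op_trace r (K ^^ (n - 2)) \<le> 64 / 49 * m"
  proof -
    have "7 / 8 * op_trace r (K ^^ (n - 2)) \<le> (1 - \<delta>) * op_trace r (K ^^ (n - 2))"
      using dl by (intro mult_right_mono op_trace_nonneg psdK) auto
    also have "\<dots> \<le> op_trace r (K ^^ (n - 1))"
      using op_trace_Suc_ge[OF K, of "n - 2"] n1 dl by simp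
    finally have 1: "7 / 8 * op_trace r (K ^^ (n - 2)) \<le> op_trace r (K ^^ (n - 1))" .
    have "7 / 8 * op_trace r (K ^^ (n - 1)) \<le> (1 - \<delta>) * op_trace r (K ^^ (n - 1))"
      using dl by (intro mult_right_mono op_trace_nonneg psdK) auto
    also have "\<dots> \<le> m"
      unfolding m_def using op_trace_Suc_ge[OF K, of "n - 1"] n1 dl by simp
    finally show ?thesis using 1 by simp
  qed
  \<comment> \<open>The multiplicities sum to n (n - 1) / 2, and n s = a.\<close>
  have weights: "s\<^sup>2 * (\<Sum>e<n-1. real (n - 1 - e)) \<le> a\<^sup>2 / 2"
  proof -
    have "(\<Sum>e<n-1. real (n - 1 - e)) = (\<Sum>e<n-1. real (Suc e))"
      by (subst sum.nat_diff_reindex[symmetric]) (intro sum.cong, auto)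
    also have "\<dots> = real (n - 1) * real n / 2"
    proof -
      have "(\<Sum>e<N. real (Suc e)) = real N * (real N + 1) / 2" for N
        by (induction N) (auto simp: field_simps)
      moreover have "real (n - 1) + 1 = real n" using n by (simp add: of_nat_diff)
      ultimately show ?thesis by (simp only:)
    qed
    also have "\<dots> \<le> (real n)\<^sup>2 / 2" by (simp add: power2_eq_square mult_right_mono)
    finally have "s\<^sup>2 * (\<Sum>e<n-1. real (n - 1 - e)) \<le> s\<^sup>2 * ((real n)\<^sup>2 / 2)" by (intro mult_left_mono) auto
    then show ?thesis by (simp add: a power_mult_distrib mult.commute)
  qed
  have quart: "E (sparse_law d \<xi>) (\<lambda>\<omega>. mom r K (n - 2 - e) (X \<omega>) * mom r K e (X \<omega>)) \<le>
      E (rademacher {..<d}) (\<lambda>\<rho>. mom r K (n - 2 - e) (X \<rho>) * mom r K e (X \<rho>)) + (d / \<xi> * \<mu>) * (64 / 49 * m)"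
    if "e < n - 1" for e
  proof -
    have "E (sparse_law d \<xi>) (\<lambda>\<omega>. mom r K (n - 2 - e) (X \<omega>) * mom r K e (X \<omega>)) \<le>
      E (rademacher {..<d}) (\<lambda>\<rho>. mom r K (n - 2 - e) (X \<rho>) * mom r K e (X \<rho>))
       + (d / \<xi>) * (\<Sum>l<d. B (n - 2 - e) l l * B e l l)"
      unfolding B using xi Bsym
      by (intro expectation_sparse_quad_mult_le) (auto simp: B[symmetric] Bdiag mom_nonneg[OF psdK])
    also have "(\<Sum>l<d. B (n - 2 - e) l l * B e l l) \<le> (\<Sum>l<d. \<mu> * mom r K (n - 2) (q l))"
    proof (rule sum_mono)
      fix l assume l: "l \<in> {..<d}"
      \<comment> \<open>Log-convexity merges the moments of orders n - 2 - e and e into one of order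
        n - 2, independent of \<open>e\<close>; the frame then sums it to a trace.\<close>
      have "B (n - 2 - e) l l * B e l l \<le> sqn r (q l) * mom r K (n - 2 - e + e) (q l)"
        unfolding Bdiag using dl by (intro mom_mult_le[OF K]) auto
      also have "n - 2 - e + e = n - 2" using that by simp
      also have "sqn r (q l) * mom r K (n - 2) (q l) \<le> \<mu> * mom r K (n - 2) (q l)"
        using coh(1) l by (intro mult_right_mono mom_nonneg psdK) auto
      finally show "B (n - 2 - e) l l * B e l l \<le> \<mu> * mom r K (n - 2) (q l)" .
    qed
    also have "(\<Sum>l<d. \<mu> * mom r K (n - 2) (q l)) = \<mu> * op_trace r (K ^^ (n - 2))"
      by (simp add: sum_distrib_left[symmetric] tr)
    finally have 1: "E (sparse_law d \<xi>) (\<lambda>\<omega>. mom r K (n - 2 - e) (X \<omega>) * mom r K e (X \<omega>)) \<le>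
      E (rademacher {..<d}) (\<lambda>\<rho>. mom r K (n - 2 - e) (X \<rho>) * mom r K e (X \<rho>))
       + (d / \<xi>) * (\<mu> * op_trace r (K ^^ (n - 2)))" by (simp add: mult_left_mono divide_right_mono)
    have "(d / \<xi>) * (\<mu> * op_trace r (K ^^ (n - 2))) = (d / \<xi> * \<mu>) * op_trace r (K ^^ (n - 2))" by simp
    also have "\<dots> \<le> (d / \<xi> * \<mu>) * (64 / 49 * m)" by (intro mult_left_mono tr2 mu)
    finally show ?thesis using 1 by simp
  qed
  have "E (sparse_law d \<xi>) (\<lambda>\<omega>. op_trace r (rank_one_update r K (- s) (X \<omega>) ^^ n)) \<le>
     E (sparse_law d \<xi>) (\<lambda>\<omega>. m + ((- a) * mom r K (n - 1) (X \<omega>)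
      + s\<^sup>2 * (\<Sum>e<n-1. real (n - 1 - e) * (mom r K (n - 2 - e) (X \<omega>) * mom r K e (X \<omega>)))))"
  proof (rule expectation_mono[OF finS])
    fix \<omega> assume "\<omega> \<in> set_pmf (sparse_law d \<xi>)"
    then have "psd r (rank_one_update r K (- s) (X \<omega>))" using small by (intro psd_upd bdx) auto
    from trace_rank_one_downdate_le[OF psdK this \<open>0 \<le> s\<close>, of n]
    show "op_trace r (rank_one_update r K (- s) (X \<omega>) ^^ n) \<le> m + ((- a) * mom r K (n - 1) (X \<omega>)
      + s\<^sup>2 * (\<Sum>e<n-1. real (n - 1 - e) * (mom r K (n - 2 - e) (X \<omega>) * mom r K e (X \<omega>))))"
      by (simp add: m_def a)
  qed
  also have "\<dots> = m + ((- a) * op_trace r (K ^^ (n - 1)) + s\<^sup>2 * (\<Sum>e<n-1. real (n - 1 - e) *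
       E (sparse_law d \<xi>) (\<lambda>\<omega>. mom r K (n - 2 - e) (X \<omega>) * mom r K e (X \<omega>))))"
  proof -
    have "E (sparse_law d \<xi>) (\<lambda>\<omega>. mom r K (n - 1) (X \<omega>)) = op_trace r (K ^^ (n - 1))"
      unfolding B expectation_sparse_quad[OF xi] Bdiag tr ..
    moreover have "E (sparse_law d \<xi>) (\<lambda>_. m) = m" by simp
    ultimately show ?thesis
      by (simp only: expectation_add[OF finS] integral_mult_right_zero expectation_sum[OF finS])
  qed
  also have "\<dots> \<le> m + ((- a) * (8 / 9 * m) + (s\<^sup>2 * V + a\<^sup>2 / 2 * ((d / \<xi> * \<mu>) * (64 / 49 * m))))"
  proof -
    have "(\<Sum>e<n-1. real (n - 1 - e) *
       E (sparse_law d \<xi>) (\<lambda>\<omega>. mom r K (n - 2 - e) (X \<omega>) * mom r K e (X \<omega>))) \<le>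
      (\<Sum>e<n-1. real (n - 1 - e) * (E (rademacher {..<d}) (\<lambda>\<rho>. mom r K (n - 2 - e) (X \<rho>) * mom r K e (X \<rho>)) + (d / \<xi> * \<mu>) * (64 / 49 * m)))"
      by (intro sum_mono mult_left_mono quart) auto
    also have "\<dots> = V + (\<Sum>e<n-1. real (n - 1 - e)) * ((d / \<xi> * \<mu>) * (64 / 49 * m))"
      unfolding V_def distrib_left sum.distrib sum_distrib_right ..
    finally have "s\<^sup>2 * (\<Sum>e<n-1. real (n - 1 - e) *
       E (sparse_law d \<xi>) (\<lambda>\<omega>. mom r K (n - 2 - e) (X \<omega>) * mom r K e (X \<omega>))) \<le> 
       s\<^sup>2 * (V + (\<Sum>e<n-1. real (n - 1 - e)) * ((d / \<xi> * \<mu>) * (64 / 49 * m)))"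
      by (intro mult_left_mono) auto
    also have "\<dots> = s\<^sup>2 * V + (s\<^sup>2 * (\<Sum>e<n-1. real (n - 1 - e))) * ((d / \<xi> * \<mu>) * (64 / 49 * m))"
      by (simp only: distrib_left mult.assoc)
    also have "\<dots> \<le> s\<^sup>2 * V + a\<^sup>2 / 2 * ((d / \<xi> * \<mu>) * (64 / 49 * m))"
      using m0 by (intro add_left_mono mult_right_mono weights mult_nonneg_nonneg mu) auto
    finally have "s\<^sup>2 * (\<Sum>e<n-1. real (n - 1 - e) *
       E (sparse_law d \<xi>) (\<lambda>\<omega>. mom r K (n - 2 - e) (X \<omega>) * mom r K e (X \<omega>)))
       \<le> s\<^sup>2 * V + a\<^sup>2 / 2 * ((d / \<xi> * \<mu>) * (64 / 49 * m))" .
    moreover have "(- a) * op_trace r (K ^^ (n - 1)) \<le> (- a) * (8 / 9 * m)"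
      using tr1 small a by (intro mult_left_mono_neg) auto
    ultimately show ?thesis by simp
  qed
  \<comment> \<open>Of the decrease 8/9 a m the diagonal term consumes at most 4/49 a m, so more
    than 3/4 a m remains.\<close>
  also have "\<dots> \<le> (1 - 3 / 4 * a) * (m + 4 * s\<^sup>2 * V)"
  proof -
    have a0: "0 \<le> a" using small a by simp
    have "a\<^sup>2 / 2 * ((d / \<xi> * \<mu>) * (64 / 49 * m)) = (a * (d / \<xi>) * \<mu>) * (a * m * (32 / 49))"
      by (simp add: power2_eq_square)
    also have "\<dots> \<le> 1 / 8 * (a * m * (32 / 49))"
      using a0 m0 by (intro mult_right_mono coh(2)) auto
    finally have 1: "a\<^sup>2 / 2 * ((d / \<xi> * \<mu>) * (64 / 49 * m)) \<le> 4 / 49 * (a * m)" by simp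
    have am: "0 \<le> a * m" using a0 m0 by simp
    have "1 * (s\<^sup>2 * V) \<le> ((1 - 3 / 4 * a) * 4) * (s\<^sup>2 * V)"
      using a(2) V by (intro mult_right_mono) auto
    moreover have "m + ((- a) * (8 / 9 * m) + (s\<^sup>2 * V + Z)) \<le> (1 - 3 / 4 * a) * (m + 4 * s\<^sup>2 * V)"
      if "Z \<le> 4 / 49 * (a * m)" "1 * (s\<^sup>2 * V) \<le> ((1 - 3 / 4 * a) * 4) * (s\<^sup>2 * V)" for Z
      using that am by (simp add: algebra_simps)
    ultimately show ?thesis using 1 by blast
  qed
  also have "\<dots> \<le> (1 - 3 / 4 * a) * E (pair_pmf sign_pmf (rademacher {..<d}))
      (\<lambda>(\<eta>, \<rho>). op_trace r (rank_one_update r K (2 * s * \<eta>) (X \<rho>) ^^ n))"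
  proof (rule mult_left_mono)
    have "m + 4 * s\<^sup>2 * V = E (rademacher {..<d}) (\<lambda>\<rho>. m + (2 * s)\<^sup>2 * (\<Sum>e<n-1. real (n - 1 - e) * 
        (mom r K (n - 2 - e) (X \<rho>) * mom r K e (X \<rho>))))"
    proof -
      have "E (rademacher {..<d}) (\<lambda>_. m) = m" by simp
      then show ?thesis
        unfolding V_def
        by (simp only: expectation_add[OF finR] integral_mult_right_zero expectation_sum[OF finR])
           (simp add: power_mult_distrib)
    qed
    also have "\<dots> \<le> E (rademacher {..<d}) (\<lambda>\<rho>. E sign_pmf (\<lambda>\<eta>. op_trace r (rank_one_update r K (2 * s * \<eta>) (X \<rho>) ^^ n)))"
    proof (rule expectation_mono[OF finR])
      fix \<rho> assume "\<rho> \<in> set_pmf (rademacher {..<d})"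
      then have R: "sqn r (X \<rho>) \<le> R" by (rule bdy)
      have "psd r (rank_one_update r K (2 * s) (X \<rho>))" "psd r (rank_one_update r K (- (2 * s)) (X \<rho>))"
        using small by (auto intro!: psd_upd R)
      from trace_rank_one_symmetric_ge[OF psdK this, of n] small
      show "m + (2 * s)\<^sup>2 * (\<Sum>e<n-1. real (n - 1 - e) * (mom r K (n - 2 - e) (X \<rho>) * mom r K e (X \<rho>))) \<le>
        E sign_pmf (\<lambda>\<eta>. op_trace r (rank_one_update r K (2 * s * \<eta>) (X \<rho>) ^^ n))"
        by (simp add: expectation_sign m_def)
    qed
    also have "\<dots> = E sign_pmf (\<lambda>\<eta>. E (rademacher {..<d}) (\<lambda>\<rho>. op_trace r (rank_one_update r K (2 * s * \<eta>) (X \<rho>) ^^ n)))"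
      by (rule expectation_swap) (simp_all add: finR set_sign_pmf)
    also have "\<dots> = E (pair_pmf sign_pmf (rademacher {..<d}))
      (\<lambda>(\<eta>, \<rho>). op_trace r (rank_one_update r K (2 * s * \<eta>) (X \<rho>) ^^ n))"
      by (subst expectation_pair_pmf) (simp_all add: finR set_sign_pmf)
    finally show "m + 4 * s\<^sup>2 * V \<le> E (pair_pmf sign_pmf (rademacher {..<d}))
      (\<lambda>(\<eta>, \<rho>). op_trace r (rank_one_update r K (2 * s * \<eta>) (X \<rho>) ^^ n))" .
    show "0 \<le> 1 - 3 / 4 * a" using a(2) by simp
  qed
  finally show ?thesis .
qed

section \<open>Replacing the columns one by one\<close>

definition multi_update ::
    "nat \<Rightarrow> ((nat \<Rightarrow> complex) \<Rightarrow> nat \<Rightarrow> complex) \<Rightarrow> (nat \<Rightarrow> real) \<Rightarrow> (nat \<Rightarrow> nat \<Rightarrow> complex) \<Rightarrow> nat \<Rightarrow>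
      (nat \<Rightarrow> complex) \<Rightarrow> nat \<Rightarrow> complex" where
  "multi_update r K c z k = (\<lambda>v i. K v i + (\<Sum>j<k. of_real (c j) * cip r (z j) v * z j i))"

lemma multi_update_0: "multi_update r K c z 0 = K"
  by (simp add: multi_update_def)

lemma multi_update_Suc:
  "multi_update r K c z (Suc k) = rank_one_update r (multi_update r K c z k) (c k) (z k)"
  by (simp add: multi_update_def rank_one_update_def add.assoc)

text \<open>Updates add up, so one of them can be absorbed into the base operator instead of being
  applied last; the replacement argument relies on both views.\<close>

lemma multi_update_Suc':
  "multi_update r K c z (Suc k) = multi_update r (rank_one_update r K (c k) (z k)) c z k"
  by (simp add: multi_update_def rank_one_update_def add_ac)

lemma multi_update_cong:
  "(\<And>j. j < k \<Longrightarrow> c j = c' j \<and> z j = z' j) \<Longrightarrow> multi_update r K c z k = multi_update r K c' z' k"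
  unfolding multi_update_def by (intro ext arg_cong2[where f="(+)"] sum.cong refl) auto

lemma near_id_multi_update:
  assumes "near_id r \<delta> K" "\<And>j. j < k \<Longrightarrow> \<bar>c j\<bar> * sqn r (z j) \<le> \<epsilon>"
  shows "near_id r (\<delta> + k * \<epsilon>) (multi_update r K c z k)"
  using assms(2)
proof (induction k)
  case 0
  then show ?case by (simp add: multi_update_0 assms(1))
next
  case (Suc k)
  have "near_id r (\<delta> + k * \<epsilon> + \<epsilon>) (multi_update r K c z (Suc k))"
    unfolding multi_update_Suc using Suc by (intro near_id_rank_one_update) auto
  then show ?case by (simp add: algebra_simps)
qed

lemma Re_cip_multi_update:
  "Re (cip r v (multi_update r K c z k v)) = Re (cip r v (K v)) + (\<Sum>j<k. c j * (cmod (cip r (z j) v))\<^sup>2)"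
proof (induction k)
  case (Suc k)
  have "cip r v (z k) * cip r (z k) v = of_real ((cmod (cip r (z k) v))\<^sup>2)"
    using cip_cnj[of r "z k" v] by (metis complex_norm_square mult.commute of_real_power)
  then show ?case
    unfolding multi_update_Suc cip_rank_one_update using Suc by (simp add: mult.assoc)
qed (simp add: multi_update_0)

text \<open>Lindeberg replacement. The remaining sparse columns are frozen and count as part of the
  base operator while one column is exchanged; the resulting dense update is then moved into the
  base, and the induction hypothesis is applied to that. Hence \<open>K\<close> and its distance
  \<delta> from the identity vary in the induction, with a budget of 2 s R per column.\<close>

lemma hybrid_comparison:
  fixes d r \<xi> n k :: nat and q :: "nat \<Rightarrow> nat \<Rightarrow> complex" and s a R \<mu> \<delta> :: real
  defines "X \<equiv> frame_comb d q"
  assumes frame: "tight_frame d r q" and xi: "1 \<le> \<xi>" "\<xi> \<le> d"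
    and "0 \<le> s" "0 \<le> R" and n: "2 \<le> n" and a: "a = n * s" "a \<le> 1"
    and coh: "\<And>l. l < d \<Longrightarrow> sqn r (q l) \<le> \<mu>" "a * (d / \<xi>) * \<mu> \<le> 1 / 8"
    and bdx: "\<And>\<omega>. \<omega> \<in> set_pmf (sparse_law d \<xi>) \<Longrightarrow> sqn r (X \<omega>) \<le> R"
    and bdy: "\<And>\<rho>. \<rho> \<in> set_pmf (rademacher {..<d}) \<Longrightarrow> sqn r (X \<rho>) \<le> R"
    and "near_id r \<delta> K" "\<delta> + k * (2 * s * R) \<le> 1 / 8" "0 \<le> \<delta>"
  shows "E (Pi_pmf {..<k} dx (\<lambda>_. sparse_law d \<xi>))
      (\<lambda>\<omega>. op_trace r (multi_update r K (\<lambda>_. - s) (\<lambda>j. X (\<omega> j)) k ^^ n)) \<le>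
    (1 - 3 / 4 * a) ^ k * E (Pi_pmf {..<k} dy (\<lambda>_. pair_pmf sign_pmf (rademacher {..<d})))
      (\<lambda>g. op_trace r (multi_update r K (\<lambda>j. 2 * s * fst (g j)) (\<lambda>j. X (snd (g j))) k ^^ n))"
  using assms(14-16)
proof (induction k arbitrary: K \<delta>)
  case 0
  then show ?case by (simp add: multi_update_0)
next
  case (Suc k)
  let ?S = "sparse_law d \<xi>" and ?C = "pair_pmf sign_pmf (rademacher {..<d})"
  let ?PS = "Pi_pmf {..<k} dx (\<lambda>_. ?S)" and ?PC = "Pi_pmf {..<k} dy (\<lambda>_. ?C)"
  let ?\<beta> = "1 - 3 / 4 * a"
  have finS: "finite (set_pmf ?S)" by (rule finite_set_sparse_law[OF xi(2)])
  have finC: "finite (set_pmf ?C)" by (simp add: set_sign_pmf finite_set_rademacher)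
  have finPS: "finite (set_pmf ?PS)" by (rule finite_set_Pi_pmf) (auto simp: finS)
  have finPC: "finite (set_pmf ?PC)" by (rule finite_set_Pi_pmf) (simp_all only: finC finite_lessThan)
  have b0: "0 \<le> ?\<beta>" using a by simp
  have sR0: "0 \<le> s * R" using \<open>0 \<le> s\<close> \<open>0 \<le> R\<close> by simp
  have up1: "multi_update r K (\<lambda>_. - s) (\<lambda>j. X ((g(k := y)) j)) (Suc k) =
      rank_one_update r (multi_update r K (\<lambda>_. - s) (\<lambda>j. X (g j)) k) (- s) (X y)" for g y
    unfolding multi_update_Suc by (simp cong: multi_update_cong)
  have up2: "rank_one_update r (multi_update r K (\<lambda>_. - s) (\<lambda>j. X (g j)) k) t z =
      multi_update r (rank_one_update r K t z) (\<lambda>_. - s) (\<lambda>j. X (g j)) k" for g t z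
    by (simp add: multi_update_def rank_one_update_def add_ac)
  have up3: "multi_update r K (\<lambda>j. 2 * s * fst ((g(k := y)) j)) (\<lambda>j. X (snd ((g(k := y)) j))) (Suc k) =
      multi_update r (rank_one_update r K (2 * s * fst y) (X (snd y)))
        (\<lambda>j. 2 * s * fst (g j)) (\<lambda>j. X (snd (g j))) k" for g y
    unfolding multi_update_Suc' fun_upd_same by (simp cong: multi_update_cong)
  have "E (Pi_pmf {..<Suc k} dx (\<lambda>_. ?S)) (\<lambda>\<omega>. op_trace r (multi_update r K (\<lambda>_. - s) (\<lambda>j. X (\<omega> j)) (Suc k) ^^ n))
     = E ?S (\<lambda>y. E ?PS (\<lambda>g. op_trace r (rank_one_update r (multi_update r K (\<lambda>_. - s) (\<lambda>j. X (g j)) k) (- s) (X y) ^^ n)))"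
    unfolding lessThan_Suc
    by (subst expectation_Pi_pmf_insert) (auto simp: finS up1[simplified])
  also have "\<dots> = E ?PS (\<lambda>g. E ?S (\<lambda>y. op_trace r (rank_one_update r (multi_update r K (\<lambda>_. - s) (\<lambda>j. X (g j)) k) (- s) (X y) ^^ n)))"
    by (rule expectation_swap[OF finS finPS])
  also have "\<dots> \<le> E ?PS (\<lambda>g. ?\<beta> * E ?C (\<lambda>(\<eta>, \<rho>). op_trace r (rank_one_update r (multi_update r K (\<lambda>_. - s) (\<lambda>j. X (g j)) k) (2 * s * \<eta>) (X \<rho>) ^^ n)))"
  proof (rule expectation_mono[OF finPS])
    fix g assume "g \<in> set_pmf ?PS"
    then have g: "g j \<in> set_pmf ?S" if "j < k" for j
      using that by (auto simp: set_Pi_pmf PiE_dflt_def)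
    have "near_id r (\<delta> + k * (s * R)) (multi_update r K (\<lambda>_. - s) (\<lambda>j. X (g j)) k)"
      using \<open>0 \<le> s\<close> g by (intro near_id_multi_update Suc.prems) (auto intro!: mult_left_mono bdx)
    \<comment> \<open>A frozen sparse column uses only s R of its budget, so one further update of
      size 2 s R fits.\<close>
    moreover have "\<delta> + k * (s * R) + 2 * s * R \<le> 1 / 8"
    proof -
      have "k * (s * R) \<ge> 0" using sR0 by simp
      then show ?thesis using Suc.prems(2) by (simp add: algebra_simps)
    qed
    moreover have "0 \<le> \<delta> + k * (s * R)" using Suc.prems(3) sR0 by simp
    ultimately show "E ?S (\<lambda>y. op_trace r (rank_one_update r (multi_update r K (\<lambda>_. - s) (\<lambda>j. X (g j)) k) (- s) (X y) ^^ n))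
      \<le> ?\<beta> * E ?C (\<lambda>(\<eta>, \<rho>). op_trace r (rank_one_update r (multi_update r K (\<lambda>_. - s) (\<lambda>j. X (g j)) k) (2 * s * \<eta>) (X \<rho>) ^^ n))"
      unfolding X_def
      by (intro expectation_one_step[where R=R and \<mu>=\<mu> and \<delta>="\<delta> + k * (s * R)"] frame xi n a coh)
        (use \<open>0 \<le> s\<close> bdx bdy in \<open>auto simp: X_def\<close>)
  qed
  also have "\<dots> = ?\<beta> * E ?C (\<lambda>y. E ?PS (\<lambda>g. op_trace r (multi_update r (rank_one_update r K (2 * s * fst y) (X (snd y))) (\<lambda>_. - s) (\<lambda>j. X (g j)) k ^^ n)))"
    unfolding case_prod_unfold up2 by (subst expectation_swap[OF finC finPS]) simp
  also have "\<dots> \<le> ?\<beta> * E ?C (\<lambda>y. ?\<beta> ^ k * E ?PC (\<lambda>g. op_trace r (multi_update r (rank_one_update r K (2 * s * fst y) (X (snd y)))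
        (\<lambda>j. 2 * s * fst (g j)) (\<lambda>j. X (snd (g j))) k ^^ n)))"
  proof (intro mult_left_mono b0 expectation_mono[OF finC])
    fix y assume "y \<in> set_pmf ?C"
    then have y: "\<bar>fst y\<bar> = 1" "sqn r (X (snd y)) \<le> R" by (auto simp: set_sign_pmf bdy)
    have "near_id r (\<delta> + 2 * s * R) (rank_one_update r K (2 * s * fst y) (X (snd y)))"
      using y \<open>0 \<le> s\<close> by (intro near_id_rank_one_update Suc.prems) (auto simp: abs_mult intro!: mult_left_mono)
    moreover have "\<delta> + 2 * s * R + k * (2 * s * R) \<le> 1 / 8" using Suc.prems(2) by (simp add: algebra_simps)
    moreover have "0 \<le> \<delta> + 2 * s * R" using Suc.prems(3) sR0 by simp
    ultimately show "E ?PS (\<lambda>g. op_trace r (multi_update r (rank_one_update r K (2 * s * fst y) (X (snd y))) (\<lambda>_. - s) (\<lambda>j. X (g j)) k ^^ n))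
      \<le> ?\<beta> ^ k * E ?PC (\<lambda>g. op_trace r (multi_update r (rank_one_update r K (2 * s * fst y) (X (snd y)))
        (\<lambda>j. 2 * s * fst (g j)) (\<lambda>j. X (snd (g j))) k ^^ n))"
      by (rule Suc.IH)
  qed
  also have "\<dots> = ?\<beta> ^ Suc k * E ?C (\<lambda>y. E ?PC (\<lambda>g. op_trace r (multi_update r (rank_one_update r K (2 * s * fst y) (X (snd y)))
        (\<lambda>j. 2 * s * fst (g j)) (\<lambda>j. X (snd (g j))) k ^^ n)))"
    by simp
  also have "E ?C (\<lambda>y. E ?PC (\<lambda>g. op_trace r (multi_update r (rank_one_update r K (2 * s * fst y) (X (snd y)))
        (\<lambda>j. 2 * s * fst (g j)) (\<lambda>j. X (snd (g j))) k ^^ n))) =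
     E (Pi_pmf {..<Suc k} dy (\<lambda>_. ?C)) (\<lambda>g. op_trace r (multi_update r K (\<lambda>j. 2 * s * fst (g j)) (\<lambda>j. X (snd (g j))) (Suc k) ^^ n))"
    unfolding lessThan_Suc
    by (subst expectation_Pi_pmf_insert) (auto simp: set_sign_pmf finite_set_rademacher up3[simplified])
  finally show ?case .
qed

section \<open>Exponential moments of signed quadratic forms\<close>

text \<open>Termwise in the power series: every positive even power of \<open>u\<close> is at most
  its square.\<close>

lemma cosh_mult_le:
  fixes u x :: real
  assumes "\<bar>u\<bar> \<le> 1"
  shows "cosh (u * x) \<le> 1 + u\<^sup>2 * (cosh x - 1)"
proof -
  have c: "(\<lambda>n. if even n then y ^ n /\<^sub>R fact n else 0) sums cosh y" for y :: real
    by (rule cosh_converges)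
  have rhs: "(\<lambda>n. u\<^sup>2 * (if even n then x ^ n /\<^sub>R fact n else 0) + (if n = 0 then 1 - u\<^sup>2 else 0))
      sums (u\<^sup>2 * cosh x + (1 - u\<^sup>2))"
    by (intro sums_add sums_mult c) (use sums_single[of 0 "\<lambda>_. 1 - u\<^sup>2"] in simp)
  have le: "(if even n then (u * x) ^ n /\<^sub>R fact n else 0) \<le>
      u\<^sup>2 * (if even n then x ^ n /\<^sub>R fact n else 0) + (if n = 0 then 1 - u\<^sup>2 else 0)" for n
  proof (cases "n = 0 \<or> odd n")
    case True
    then show ?thesis by auto
  next
    case False
    then obtain m where m: "n = 2 * m" "m \<ge> 1" by (auto elim!: evenE)
    have "(u\<^sup>2) ^ m \<le> (u\<^sup>2) ^ 1"
      using m assms by (intro power_decreasing) (auto simp: abs_square_le_1)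
    then have "u ^ n * x ^ n \<le> u\<^sup>2 * x ^ n"
      using m by (intro mult_right_mono) (auto simp: power_mult)
    then have "inverse (fact n) * (u ^ n * x ^ n) \<le> inverse (fact n) * (u\<^sup>2 * x ^ n)"
      by (intro mult_left_mono) auto
    then show ?thesis using False by (simp add: power_mult_distrib mult.left_commute)
  qed
  have "cosh (u * x) \<le> u\<^sup>2 * cosh x + (1 - u\<^sup>2)" by (rule sums_le[OF le c rhs])
  then show ?thesis by (simp add: algebra_simps)
qed

text \<open>Termwise, because (2 m)! is at least 2^m m!.\<close>

lemma cosh_le_exp_square: "cosh (x::real) \<le> exp (x\<^sup>2 / 2)"
proof -
  have "(\<lambda>n. if even n then x ^ n /\<^sub>R fact n else 0) sums cosh x" by (rule cosh_converges)
  moreover have "(if even n then x ^ n /\<^sub>R fact n else 0) = 0" if "n \<notin> range (\<lambda>m. 2 * m)" for n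
    using that by (auto elim!: evenE)
  ultimately have 1: "(\<lambda>m. x ^ (2 * m) /\<^sub>R fact (2 * m)) sums cosh x"
    using sums_mono_reindex[of "\<lambda>m. 2 * m" "\<lambda>n. if even n then x ^ n /\<^sub>R fact n else 0" "cosh x"]
    by (simp add: strict_mono_def)
  have 2: "(\<lambda>m. (x\<^sup>2 / 2) ^ m /\<^sub>R fact m) sums exp (x\<^sup>2 / 2)" by (rule exp_converges)
  have "x ^ (2 * m) /\<^sub>R fact (2 * m) \<le> (x\<^sup>2 / 2) ^ m /\<^sub>R fact m" for m
  proof -
    have "(2::real) ^ m * fact m \<le> fact (2 * m)"
    proof (induction m)
      case (Suc m)
      have "(2::real) ^ Suc m * fact (Suc m) = (2 * real (Suc m)) * (2 ^ m * fact m)" by simp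
      also have "\<dots> \<le> (real (2 * m + 2) * real (2 * m + 1)) * fact (2 * m)"
        using Suc by (intro mult_mono) (auto simp: field_simps)
      finally show ?case by (simp add: algebra_simps)
    qed simp
    then have "inverse (fact (2 * m)) \<le> inverse ((2::real) ^ m * fact m)" by (intro le_imp_inverse_le) auto
    then have "(x\<^sup>2) ^ m * inverse (fact (2 * m)) \<le> (x\<^sup>2) ^ m * inverse ((2::real) ^ m * fact m)" by (intro mult_left_mono) auto
    moreover have "x ^ (2 * m) /\<^sub>R fact (2 * m) = (x\<^sup>2) ^ m * inverse (fact (2 * m))"
      unfolding power_mult by simp
    moreover have "(x\<^sup>2 / 2) ^ m /\<^sub>R fact m = (x\<^sup>2) ^ m * inverse ((2::real) ^ m * fact m)"
      unfolding power_divide by (simp add: divide_inverse)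
    ultimately show ?thesis by (simp only:)
  qed
  then show ?thesis by (rule sums_le[OF _ 1 2])
qed

text \<open>The signs are averaged one at a time. A sign whose coefficient has squared modulus t
  contributes exp (\<tau> t) and a cosh; the Gaussian bound on the cosh raises the exponent of the
  remaining sum from \<tau> to at most \<tau> / (1 - 2 \<tau> t). For positive \<tau> this map
  lowers 1 / \<tau> by 2 t, so its iterates depend only on the sum of all t, which explains the
  closed form.\<close>

lemma rademacher_exp_square:
  fixes v :: "'i \<Rightarrow> complex"
  assumes "finite A" "0 \<le> \<tau>" "2 * \<tau> * (\<Sum>l\<in>A. (cmod (v l))\<^sup>2) < 1"
  shows "E (rademacher A) (\<lambda>\<rho>. exp (\<tau> * (cmod (\<Sum>l\<in>A. of_real (\<rho> l) * v l))\<^sup>2))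
    \<le> exp (\<tau> * (\<Sum>l\<in>A. (cmod (v l))\<^sup>2) / (1 - 2 * \<tau> * (\<Sum>l\<in>A. (cmod (v l))\<^sup>2)))"
  using assms
proof (induction A arbitrary: \<tau> rule: finite_induct)
  case empty
  then show ?case by (simp add: expectation_rademacher_empty)
next
  case (insert x A)
  note fin = finite_set_rademacher[OF insert(1)]
  define S where "S = (\<Sum>l\<in>A. (cmod (v l))\<^sup>2)"
  define t where "t = (cmod (v x))\<^sup>2"
  define \<tau>' where "\<tau>' = \<tau> / (1 - 2 * \<tau> * t)"
  have S0: "0 \<le> S" "0 \<le> t" by (auto simp: S_def t_def sum_nonneg)
  have small: "2 * \<tau> * (t + S) < 1" using insert by (simp add: S_def t_def)
  have tS: "2 * \<tau> * t \<le> 2 * \<tau> * (t + S)" using S0 insert by (intro mult_left_mono) auto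
  then have t1: "0 < 1 - 2 * \<tau> * t" using small by linarith
  have l': "0 \<le> \<tau>'" using t1 insert by (simp add: \<tau>'_def)
  have "1 - 2 * \<tau>' * S = (1 - 2 * \<tau> * (t + S)) / (1 - 2 * \<tau> * t)"
    using t1 by (simp add: \<tau>'_def field_simps)
  then have l'S: "1 - 2 * \<tau>' * S > 0" "\<tau>' / (1 - 2 * \<tau>' * S) = \<tau> / (1 - 2 * \<tau> * (t + S))"
    using t1 small by (simp_all add: \<tau>'_def)
  \<comment> \<open>With x = 2 \<tau> t this is (1 + x) (1 - x) \<le> 1.\<close>
  have "\<tau> * (1 + 2 * \<tau> * t) * (1 - 2 * \<tau> * t) \<le> \<tau>"
    using insert(4) by (simp add: algebra_simps power2_eq_square)
  then have grow: "\<tau> * (1 + 2 * \<tau> * t) \<le> \<tau>'" unfolding \<tau>'_def using t1 by (simp add: pos_le_divide_eq)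
  define y where "y = (\<lambda>\<rho>. \<Sum>l\<in>A. of_real (\<rho> l) * v l)"
  have y: "(\<Sum>l\<in>insert x A. of_real ((\<rho>(x := c)) l) * v l) = y \<rho> + of_real c * v x" for \<rho> c
  proof -
    have "(\<Sum>l\<in>A. of_real ((\<rho>(x := c)) l) * v l) = y \<rho>"
      unfolding y_def using insert(2) by (intro sum.cong) auto
    then show ?thesis using insert by simp
  qed
  have step: "(exp (\<tau> * (cmod (y \<rho> + of_real 1 * v x))\<^sup>2) + exp (\<tau> * (cmod (y \<rho> + of_real (- 1) * v x))\<^sup>2)) / 2
     \<le> exp (\<tau> * t) * exp (\<tau>' * (cmod (y \<rho>))\<^sup>2)" for \<rho>
  proof -
    define c where "c = Re (y \<rho> * cnj (v x))"
    have 1: "(cmod (y \<rho> + of_real 1 * v x))\<^sup>2 = (cmod (y \<rho>))\<^sup>2 + t + 2 * c"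
      "(cmod (y \<rho> + of_real (- 1) * v x))\<^sup>2 = (cmod (y \<rho>))\<^sup>2 + t - 2 * c"
      unfolding t_def c_def cmod_power2 by (simp_all add: power2_eq_square algebra_simps)
    have "\<bar>c\<bar> \<le> cmod (y \<rho>) * cmod (v x)"
      unfolding c_def using abs_Re_le_cmod[of "y \<rho> * cnj (v x)"] by (simp add: norm_mult)
    then have "\<bar>c\<bar>\<^sup>2 \<le> (cmod (y \<rho>) * cmod (v x))\<^sup>2" by (intro power_mono) auto
    then have c2: "c\<^sup>2 \<le> (cmod (y \<rho>))\<^sup>2 * t" by (simp add: power_mult_distrib t_def)
    have "(exp (\<tau> * (cmod (y \<rho> + of_real 1 * v x))\<^sup>2) + exp (\<tau> * (cmod (y \<rho> + of_real (- 1) * v x))\<^sup>2)) / 2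
      = exp (\<tau> * ((cmod (y \<rho>))\<^sup>2 + t)) * cosh (2 * \<tau> * c)"
    proof -
      have "(exp (\<tau> * (B + 2 * c)) + exp (\<tau> * (B - 2 * c))) / 2 = exp (\<tau> * B) * cosh (2 * \<tau> * c)" for B
        by (simp add: cosh_field_def distrib_left right_diff_distrib exp_add exp_diff exp_minus field_simps)
      then show ?thesis unfolding 1 .
    qed
    also have "\<dots> \<le> exp (\<tau> * ((cmod (y \<rho>))\<^sup>2 + t)) * exp ((2 * \<tau> * c)\<^sup>2 / 2)"
      by (intro mult_left_mono cosh_le_exp_square) auto
    also have "\<dots> = exp (\<tau> * t) * exp (\<tau> * (cmod (y \<rho>))\<^sup>2 + 2 * \<tau>\<^sup>2 * c\<^sup>2)"
      by (simp add: exp_add[symmetric] power_mult_distrib algebra_simps)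
    also have "\<tau> * (cmod (y \<rho>))\<^sup>2 + 2 * \<tau>\<^sup>2 * c\<^sup>2 \<le> \<tau> * (cmod (y \<rho>))\<^sup>2 + 2 * \<tau>\<^sup>2 * ((cmod (y \<rho>))\<^sup>2 * t)"
      by (intro add_left_mono mult_left_mono c2) auto
    also have "\<dots> = \<tau> * (1 + 2 * \<tau> * t) * (cmod (y \<rho>))\<^sup>2" by (simp add: algebra_simps power2_eq_square)
    also have "\<dots> \<le> \<tau>' * (cmod (y \<rho>))\<^sup>2" by (intro mult_right_mono grow) auto
    finally show ?thesis by simp
  qed
  have "E (rademacher (insert x A)) (\<lambda>\<rho>. exp (\<tau> * (cmod (\<Sum>l\<in>insert x A. of_real (\<rho> l) * v l))\<^sup>2)) \<le>
     E (rademacher A) (\<lambda>\<rho>. exp (\<tau> * t) * exp (\<tau>' * (cmod (y \<rho>))\<^sup>2))"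
    unfolding expectation_rademacher_insert[OF insert(1,2)] y
    by (intro expectation_mono[OF fin] step)
  also have "\<dots> = exp (\<tau> * t) * E (rademacher A) (\<lambda>\<rho>. exp (\<tau>' * (cmod (\<Sum>l\<in>A. of_real (\<rho> l) * v l))\<^sup>2))"
    by (simp add: y_def)
  also have "\<dots> \<le> exp (\<tau> * t) * exp (\<tau>' * S / (1 - 2 * \<tau>' * S))"
    using insert.IH[of \<tau>'] l' l'S(1) by (intro mult_left_mono) (auto simp: S_def)
  also have "\<dots> = exp (\<tau> * t + \<tau> / (1 - 2 * \<tau> * (t + S)) * S)"
    by (simp add: exp_add[symmetric] l'S(2)[symmetric])
  also have "\<dots> \<le> exp (\<tau> * (t + S) / (1 - 2 * \<tau> * (t + S)))"
  proof -
    have "\<tau> * 1 \<le> \<tau> * (1 / (1 - 2 * \<tau> * (t + S)))"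
      using small insert S0 by (intro mult_left_mono) auto
    then have "\<tau> * t \<le> \<tau> / (1 - 2 * \<tau> * (t + S)) * t" using S0 by (intro mult_right_mono) auto
    moreover have "\<tau> * (t + S) / (1 - 2 * \<tau> * (t + S)) = \<tau> / (1 - 2 * \<tau> * (t + S)) * t + \<tau> / (1 - 2 * \<tau> * (t + S)) * S"
      by (simp add: algebra_simps add_divide_distrib)
    ultimately show ?thesis by simp
  qed
  finally show ?case using insert by (simp add: S_def t_def)
qed

text \<open>The cosh is the average over a random sign, which cancels the linear term and leaves a
  bound quadratic in \<open>t\<close>. At the exponent 1/4 the square has exponential moment at most
  exp (1/2) \<le> 2; writing t Z as 4 t times Z / 4 extracts (4 t)^2, whence 16.\<close>

lemma rademacher_cosh_square:
  fixes v :: "'i \<Rightarrow> complex"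
  assumes "finite A" "(\<Sum>l\<in>A. (cmod (v l))\<^sup>2) \<le> 1" "\<bar>t\<bar> \<le> 1 / 4"
  shows "E (rademacher A) (\<lambda>\<rho>. cosh (t * (cmod (\<Sum>l\<in>A. of_real (\<rho> l) * v l))\<^sup>2)) \<le> exp (16 * t\<^sup>2)"
proof -
  note fin = finite_set_rademacher[OF assms(1)]
  define S where "S = (\<Sum>l\<in>A. (cmod (v l))\<^sup>2)"
  define Z where "Z = (\<lambda>\<rho>. (cmod (\<Sum>l\<in>A. of_real (\<rho> l) * v l))\<^sup>2)"
  have S: "0 \<le> S" "S \<le> 1" using assms(2) by (auto simp: S_def sum_nonneg)
  have "E (rademacher A) (\<lambda>\<rho>. exp (1 / 4 * Z \<rho>)) \<le> exp (1 / 4 * S / (1 - 2 * (1 / 4) * S))"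
    unfolding S_def Z_def by (rule rademacher_exp_square) (use assms S in \<open>auto simp: S_def\<close>)
  also have "1 / 4 * S / (1 - 2 * (1 / 4) * S) \<le> 1 / 2" using S by (simp add: field_simps)
  also have "exp (1 / 2 :: real) \<le> 2"
    using exp_bound_half[of "1/2 :: real"] by simp
  finally have 1: "E (rademacher A) (\<lambda>\<rho>. exp (1 / 4 * Z \<rho>)) \<le> 2" by simp
  have "E (rademacher A) (\<lambda>\<rho>. cosh (t * Z \<rho>)) \<le> E (rademacher A) (\<lambda>\<rho>. (1 - 16 * t\<^sup>2) + 16 * t\<^sup>2 * exp (1 / 4 * Z \<rho>))"
  proof (rule expectation_mono[OF fin])
    fix \<rho>
    have "cosh (4 * t * (1 / 4 * Z \<rho>)) \<le> 1 + (4 * t)\<^sup>2 * (cosh (1 / 4 * Z \<rho>) - 1)"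
      using assms(3) by (intro cosh_mult_le) auto
    also have "\<dots> \<le> 1 + (4 * t)\<^sup>2 * (exp (1 / 4 * Z \<rho>) - 1)"
    proof -
      have "exp (- (1 / 4 * Z \<rho>)) \<le> exp (1 / 4 * Z \<rho>)" by (simp add: Z_def)
      then have "cosh (1 / 4 * Z \<rho>) \<le> exp (1 / 4 * Z \<rho>)" unfolding cosh_def by simp
      then show ?thesis by (intro add_left_mono mult_left_mono) auto
    qed
    finally show "cosh (t * Z \<rho>) \<le> (1 - 16 * t\<^sup>2) + 16 * t\<^sup>2 * exp (1 / 4 * Z \<rho>)"
      by (simp add: power_mult_distrib algebra_simps)
  qed
  also have "\<dots> = (1 - 16 * t\<^sup>2) + 16 * t\<^sup>2 * E (rademacher A) (\<lambda>\<rho>. exp (1 / 4 * Z \<rho>))"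
    by (simp add: expectation_add[OF fin])
  also have "\<dots> \<le> (1 - 16 * t\<^sup>2) + 16 * t\<^sup>2 * 2" by (intro add_left_mono mult_left_mono 1) auto
  also have "\<dots> \<le> exp (16 * t\<^sup>2)" using exp_ge_add_one_self[of "16 * t\<^sup>2"] by linarith
  finally show ?thesis by (simp add: Z_def)
qed

text \<open>Independence gives a product over the columns, the sign turns each factor into a cosh,
  and Parseval bounds the coefficients of the dense sum.\<close>

lemma expectation_signed_sum_exp:
  fixes k :: nat
  assumes frame: "tight_frame d r q" and v: "sqn r v \<le> 1" and t: "\<bar>t\<bar> \<le> 1 / 4"
  shows "E (Pi_pmf {..<k} dy (\<lambda>_. pair_pmf sign_pmf (rademacher {..<d})))
     (\<lambda>g. exp (t * (\<Sum>j<k. fst (g j) * (cmod (cip r (frame_comb d q (snd (g j))) v))\<^sup>2)))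
    \<le> exp (16 * t\<^sup>2 * k)"
proof -
  let ?C = "pair_pmf sign_pmf (rademacher {..<d})"
  let ?h = "\<lambda>y. exp (t * (fst y * (cmod (cip r (frame_comb d q (snd y)) v))\<^sup>2))"
  have finC: "finite (set_pmf ?C)" by (simp add: set_sign_pmf finite_set_rademacher)
  have "E (Pi_pmf {..<k} dy (\<lambda>_. ?C)) (\<lambda>g. exp (t * (\<Sum>j<k. fst (g j) * (cmod (cip r (frame_comb d q (snd (g j))) v))\<^sup>2)))
     = E (Pi_pmf {..<k} dy (\<lambda>_. ?C)) (\<lambda>g. \<Prod>j<k. ?h (g j))"
    unfolding sum_distrib_left exp_sum[OF finite_lessThan] ..
  also have "\<dots> = (\<Prod>j<k. E ?C ?h)"
    by (rule expectation_prod_Pi_pmf) (auto intro!: integrable_measure_pmf_finite simp: set_sign_pmf finite_set_rademacher)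
  also have "\<dots> = (E ?C ?h) ^ k" by simp
  also have "E ?C ?h = E (rademacher {..<d}) (\<lambda>\<rho>. E sign_pmf (\<lambda>\<eta>. ?h (\<eta>, \<rho>)))"
  proof -
    have "E ?C ?h = E sign_pmf (\<lambda>\<eta>. E (rademacher {..<d}) (\<lambda>\<rho>. ?h (\<eta>, \<rho>)))"
      by (rule expectation_pair_pmf) (simp_all add: set_sign_pmf finite_set_rademacher)
    also have "\<dots> = E (rademacher {..<d}) (\<lambda>\<rho>. E sign_pmf (\<lambda>\<eta>. ?h (\<eta>, \<rho>)))"
      by (rule expectation_swap) (simp_all add: set_sign_pmf finite_set_rademacher)
    finally show ?thesis .
  qed
  also have "\<dots> = E (rademacher {..<d}) (\<lambda>\<rho>. cosh (t * (cmod (\<Sum>l<d. of_real (\<rho> l) * cip r (q l) v))\<^sup>2))"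
  proof -
    have "cip r (frame_comb d q \<rho>) v = (\<Sum>l<d. of_real (\<rho> l) * cip r (q l) v)" for \<rho>
      unfolding cip_cnj[of r v, symmetric] cip_frame_comb_right by (simp add: cip_cnj)
    then show ?thesis by (simp add: expectation_sign cosh_field_def)
  qed
  also have "\<dots> ^ k \<le> exp (16 * t\<^sup>2) ^ k"
  proof (rule power_mono)
    show "E (rademacher {..<d}) (\<lambda>\<rho>. cosh (t * (cmod (\<Sum>l<d. of_real (\<rho> l) * cip r (q l) v))\<^sup>2)) \<le> exp (16 * t\<^sup>2)"
      using v t by (intro rademacher_cosh_square) (simp_all add: tight_frame_Parseval[OF frame])
  qed (simp add: integral_nonneg_AE cosh_real_nonneg)
  also have "\<dots> = exp (16 * t\<^sup>2 * k)" by (simp add: exp_of_nat_mult[symmetric] mult.commute)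
  finally show ?thesis .
qed

section \<open>A net for the norm of a quadratic form\<close>

text \<open>For a self-adjoint operator this is the operator norm. The ball, unlike the sphere, is
  never empty; boundedness, without which a real supremum has no meaning, is supplied to the lemmas
  by a constant \<open>C\<close>.\<close>

definition form_norm :: "nat \<Rightarrow> ((nat \<Rightarrow> complex) \<Rightarrow> nat \<Rightarrow> complex) \<Rightarrow> real" where
  "form_norm r W = (SUP v\<in>{v. sqn r v \<le> 1}. \<bar>Re (cip r v (W v))\<bar>)"

lemma sqn_scale: "sqn r (\<lambda>i. of_real c * v i) = c\<^sup>2 * sqn r v"
  by (simp add: sqn_def norm_mult power_mult_distrib sum_distrib_left)

lemma selfadj_add_scaled:
  assumes "selfadj r W"
  shows "cip r x (W (\<lambda>i. u i + c * v i)) = cip r x (W u) + c * cip r x (W v)"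
  using selfadjD[OF assms] cip_add_scaled_right[of r "W x" u c v] by simp

lemma selfadj_scale:
  assumes "selfadj r W"
  shows "cip r x (W (\<lambda>i. c * v i)) = c * cip r x (W v)"
proof -
  have "cip r y (\<lambda>i. c * v i) = c * cip r y v" for y
    by (simp add: cip_def sum_distrib_left mult.left_commute)
  then show ?thesis using selfadjD[OF assms] by metis
qed

lemma cip_scale_left: "cip r (\<lambda>i. of_real c * u i) v = of_real c * cip r u v"
  by (simp add: cip_def sum_distrib_left mult.assoc)

lemma form_scale:
  assumes "selfadj r W"
  shows "Re (cip r (\<lambda>i. of_real c * v i) (W (\<lambda>i. of_real c * v i))) = c\<^sup>2 * Re (cip r v (W v))"
  by (simp add: selfadj_scale[OF assms] cip_scale_left power2_eq_square)

lemma form_le_form_norm: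
  assumes sa: "selfadj r W" and bdd: "\<And>v. \<bar>Re (cip r v (W v))\<bar> \<le> C * sqn r v" and "0 \<le> C"
  shows "\<bar>Re (cip r v (W v))\<bar> \<le> form_norm r W * sqn r v"
proof (cases "sqn r v = 0")
  case True
  then show ?thesis using bdd[of v] by simp
next
  case False
  then have pos: "0 < sqn r v" using sqn_nonneg[of r v] by linarith
  define c where "c = 1 / sqrt (sqn r v)"
  have c2: "c\<^sup>2 = 1 / sqn r v" using pos by (simp add: c_def power_divide)
  have bddabove: "bdd_above ((\<lambda>v. \<bar>Re (cip r v (W v))\<bar>) ` {v. sqn r v \<le> 1})"
  proof (rule bdd_aboveI2)
    fix v assume "v \<in> {v. sqn r v \<le> 1}"
    then have "C * sqn r v \<le> C * 1" using assms(3) by (intro mult_left_mono) auto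
    then show "\<bar>Re (cip r v (W v))\<bar> \<le> C" using bdd[of v] by simp
  qed
  have "\<bar>Re (cip r (\<lambda>i. of_real c * v i) (W (\<lambda>i. of_real c * v i)))\<bar> \<le> form_norm r W"
    unfolding form_norm_def by (rule cSUP_upper[OF _ bddabove]) (use pos in \<open>simp add: sqn_scale c2\<close>)
  then have "\<bar>Re (cip r v (W v))\<bar> / sqn r v \<le> form_norm r W"
    using pos by (simp add: form_scale[OF sa] abs_mult c2)
  then show ?thesis using pos by (simp add: divide_le_eq)
qed

lemma form_norm_le:
  assumes "\<And>v. sqn r v \<le> 1 \<Longrightarrow> \<bar>Re (cip r v (W v))\<bar> \<le> m"
  shows "form_norm r W \<le> m"
  unfolding form_norm_def
proof (rule cSUP_least)
  have "sqn r (\<lambda>_. 0) \<le> 1" by (simp add: sqn_def)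
  then show "{v. sqn r v \<le> 1} \<noteq> {}" by blast
qed (use assms in auto)

lemma sqn_parallelogram:
  "sqn r (\<lambda>i. u i + v i) + sqn r (\<lambda>i. u i - v i) = 2 * sqn r u + 2 * sqn r v"
  unfolding sqn_def sum.distrib[symmetric] sum_distrib_left
  unfolding cmod_power2 by (intro sum.cong refl) (simp add: power2_eq_square algebra_simps)

lemma form_norm_nonneg:
  assumes "selfadj r W" "\<And>v. \<bar>Re (cip r v (W v))\<bar> \<le> C * sqn r v" "0 \<le> C"
  shows "0 \<le> form_norm r W"
proof -
  have "bdd_above ((\<lambda>v. \<bar>Re (cip r v (W v))\<bar>) ` {v. sqn r v \<le> 1})"
  proof (rule bdd_aboveI2)
    fix v assume "v \<in> {v. sqn r v \<le> 1}"
    then have "C * sqn r v \<le> C * 1" using assms(3) by (intro mult_left_mono) auto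
    then show "\<bar>Re (cip r v (W v))\<bar> \<le> C" using assms(2)[of v] by simp
  qed
  then have "\<bar>Re (cip r (\<lambda>_. 0) (W (\<lambda>_. 0)))\<bar> \<le> form_norm r W"
    unfolding form_norm_def by (intro cSUP_upper) (auto simp: sqn_def)
  then show ?thesis by linarith
qed

lemma Re_form_polar:
  assumes "selfadj r W"
  shows "Re (cip r a (W b)) = (Re (cip r (\<lambda>i. a i + b i) (W (\<lambda>i. a i + b i)))
    - Re (cip r (\<lambda>i. a i - b i) (W (\<lambda>i. a i - b i)))) / 4"
proof -
  have add: "cip r x (W (\<lambda>i. a i + b i)) = cip r x (W a) + cip r x (W b)" for x
    using selfadj_add_scaled[OF assms, of x a 1 b] by simp
  have sub: "cip r x (W (\<lambda>i. a i - b i)) = cip r x (W a) - cip r x (W b)" for x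
    using selfadj_add_scaled[OF assms, of x a "-1" b] by simp
  have l: "cip r (\<lambda>i. a i + b i) y = cip r a y + cip r b y" "cip r (\<lambda>i. a i - b i) y = cip r a y - cip r b y" for y
    by (simp_all add: cip_def sum.distrib sum_subtractf algebra_simps)
  have "Re (cip r b (W a)) = Re (cip r a (W b))" using Re_cip_symmetric[OF assms, of b 1 a] by simp
  then show ?thesis unfolding add sub l by simp
qed

text \<open>The values of the form at two points differ by the bilinear form at their difference and
  sum. Near a net point this is at most half the norm itself, which is absorbed on the left.\<close>

lemma form_norm_net:
  assumes sa: "selfadj r W" and bdd: "\<And>v. \<bar>Re (cip r v (W v))\<bar> \<le> C * sqn r v" "0 \<le> C"
    and net: "\<And>u. sqn r u \<le> 1 \<Longrightarrow> \<exists>v\<in>N. sqn r v \<le> 1 \<and> sqn r (\<lambda>i. u i - v i) \<le> 1 / 16"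
    and m: "\<And>v. v \<in> N \<Longrightarrow> \<bar>Re (cip r v (W v))\<bar> \<le> m"
  shows "form_norm r W \<le> 2 * m"
proof -
  let ?q = "\<lambda>v. Re (cip r v (W v))"
  let ?w = "form_norm r W"
  have w0: "0 \<le> ?w" by (rule form_norm_nonneg[OF sa bdd])
  have "form_norm r W \<le> m + ?w / 2"
  proof (rule form_norm_le)
    fix u assume u: "sqn r u \<le> 1"
    then obtain v where v: "v \<in> N" "sqn r v \<le> 1" "sqn r (\<lambda>i. u i - v i) \<le> 1 / 16" using net by blast
    define a where "a = (\<lambda>i. u i - v i)"
    define b where "b = (\<lambda>i. u i + v i)"
    have sb: "sqn r b \<le> 4" using sqn_parallelogram[of r u v] u v sqn_nonneg[of r a] by (simp add: a_def b_def)
    have diff: "?q u - ?q v = Re (cip r a (W b))"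
    proof -
      have l: "cip r a y = cip r u y - cip r v y" for y
        unfolding a_def by (simp add: cip_def sum_subtractf algebra_simps)
      have r: "cip r x (W b) = cip r x (W u) + cip r x (W v)" for x
        unfolding b_def using selfadj_add_scaled[OF sa, of x u 1 v] by simp
      have "Re (cip r v (W u)) = Re (cip r u (W v))" using Re_cip_symmetric[OF sa, of v 1 u] by simp
      then show ?thesis unfolding l r by simp
    qed
    \<comment> \<open>Scaling by \<open>c\<close> and its inverse balances the squared norms, at
      most 1/16 for the difference and 4 for the sum, to 1/2 each; polarisation then yields the
      factor 1/2.\<close>
    define c where "c = sqrt 8"
    define a' where "a' = (\<lambda>i. of_real c * a i)"
    define b' where "b' = (\<lambda>i. of_real (1 / c) * b i)"
    have c: "c\<^sup>2 = 8" "c \<noteq> 0" by (simp_all add: c_def)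
    have "cip r a' (W b') = cip r a (W b)"
      unfolding a'_def b'_def cip_scale_left selfadj_scale[OF sa] using c by simp
    then have "?q u - ?q v = (?q (\<lambda>i. a' i + b' i) - ?q (\<lambda>i. a' i - b' i)) / 4"
      unfolding diff Re_form_polar[OF sa, symmetric] by simp
    moreover have "\<bar>p\<bar> \<le> (X + Y) / 4" if "p = (A - B) / 4" "\<bar>A\<bar> \<le> X" "\<bar>B\<bar> \<le> Y" for p A B X Y :: real
      using that by (auto simp: abs_le_iff)
    moreover have "\<bar>?q (\<lambda>i. a' i + b' i)\<bar> \<le> ?w * sqn r (\<lambda>i. a' i + b' i)" "\<bar>?q (\<lambda>i. a' i - b' i)\<bar> \<le> ?w * sqn r (\<lambda>i. a' i - b' i)"
      by (rule form_le_form_norm[OF sa bdd])+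
    ultimately have "\<bar>?q u - ?q v\<bar> \<le> ?w * (sqn r (\<lambda>i. a' i + b' i) + sqn r (\<lambda>i. a' i - b' i)) / 4"
      unfolding distrib_left by blast
    also have "sqn r (\<lambda>i. a' i + b' i) + sqn r (\<lambda>i. a' i - b' i) \<le> 2"
    proof -
      have "sqn r a' \<le> 1 / 2" unfolding a'_def sqn_scale c(1) using v(3) by (simp add: a_def)
      moreover have "sqn r b' \<le> 1 / 2" unfolding b'_def sqn_scale using sb c(1) by (simp add: power_divide)
      ultimately show ?thesis unfolding sqn_parallelogram by simp
    qed
    finally have "\<bar>?q u - ?q v\<bar> \<le> ?w / 2" using w0 by (simp add: mult_left_mono)
    then show "\<bar>?q u\<bar> \<le> m + ?w / 2" using m[OF v(1)] by linarith
  qed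
  then show ?thesis by simp
qed

text \<open>Integer codes for grid points of mesh h = (32 r)^(-1/2) in the unit ball. Moving 2 r
  real coordinates by at most h each gives squared distance at most 2 r h^2 = 1/16, which fixes the
  number 32. The box makes finiteness immediate and cuts off no integer point of the ball.\<close>

definition grid_codes :: "nat \<Rightarrow> (nat \<Rightarrow> int \<times> int) set" where
  "grid_codes r = {g \<in> PiE {..<r} (\<lambda>_. {- int (32 * r)..int (32 * r)} \<times> {- int (32 * r)..int (32 * r)}).
     (\<Sum>i<r. (fst (g i))\<^sup>2 + (snd (g i))\<^sup>2) \<le> int (32 * r)}"

definition grid_point :: "nat \<Rightarrow> (nat \<Rightarrow> int \<times> int) \<Rightarrow> nat \<Rightarrow> complex" where
  "grid_point r g = (\<lambda>i. of_real (1 / sqrt (32 * r)) * Complex (of_int (fst (g i))) (of_int (snd (g i))))"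

lemma finite_grid_codes: "finite (grid_codes r)"
  unfolding grid_codes_def by (rule finite_subset[OF Collect_restrict]) (auto intro!: finite_PiE)

lemma int_abs_le_square: "\<bar>a::int\<bar> \<le> a\<^sup>2"
proof (cases "a = 0")
  case False
  then have "\<bar>a\<bar> * 1 \<le> \<bar>a\<bar> * \<bar>a\<bar>" by (intro mult_left_mono) auto
  then show ?thesis by (simp add: power2_eq_square)
qed simp

lemma sum_half_power_abs: "(\<Sum>a\<in>{- int M..int M}. (1 / 2 :: real) ^ nat \<bar>a\<bar>) \<le> 3"
proof -
  have "(\<Sum>a\<in>{- int M..int M}. (1 / 2 :: real) ^ nat \<bar>a\<bar>) = 3 - 2 * (1 / 2) ^ M"
  proof (induction M)
    case (Suc M)
    have "{- int (Suc M)..int (Suc M)} = insert (int (Suc M)) (insert (- int (Suc M)) {- int M..int M})" by auto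
    then show ?case using Suc by (simp add: nat_add_distrib)
  qed simp
  then show ?thesis by simp
qed

text \<open>Points of the grid are counted with weights \<open>2\<close> to the power \<open>32 r - |z|\<^sup>2\<close>, which are at least one in the ball.\<close>

lemma card_grid_codes: "real (card (grid_codes r)) \<le> 2 ^ (32 * r) * 9 ^ r"
proof -
  let ?B = "{- int (32 * r)..int (32 * r)}"
  let ?f = "\<lambda>p. (1 / 2 :: real) ^ nat ((fst p)\<^sup>2 + (snd p)\<^sup>2)"
  \<comment> \<open>Replacing squares by absolute values splits the weight into two geometric sums,
    each at most 3.\<close>
  have "(\<Sum>p\<in>?B \<times> ?B. ?f p) \<le> (\<Sum>p\<in>?B \<times> ?B. (1 / 2) ^ nat \<bar>fst p\<bar> * (1 / 2) ^ nat \<bar>snd p\<bar>)"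
  proof (rule sum_mono)
    fix p :: "int \<times> int"
    have "nat \<bar>fst p\<bar> + nat \<bar>snd p\<bar> \<le> nat ((fst p)\<^sup>2 + (snd p)\<^sup>2)"
      by (simp add: nat_add_distrib[symmetric] add_mono nat_mono int_abs_le_square)
    then show "?f p \<le> (1 / 2) ^ nat \<bar>fst p\<bar> * (1 / 2) ^ nat \<bar>snd p\<bar>"
      unfolding power_add[symmetric] by (intro power_decreasing) auto
  qed
  also have "\<dots> = (\<Sum>a\<in>?B. (1 / 2) ^ nat \<bar>a\<bar>) * (\<Sum>a\<in>?B. (1 / 2) ^ nat \<bar>a\<bar>)"
    by (simp add: sum_product sum.cartesian_product case_prod_unfold)
  also have "\<dots> \<le> 3 * 3"
    by (intro mult_mono sum_half_power_abs) (auto intro: sum_nonneg)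
  finally have S9: "(\<Sum>p\<in>?B \<times> ?B. ?f p) \<le> 9" by simp
  have "real (card (grid_codes r)) = (\<Sum>g\<in>grid_codes r. 1)" by simp
  also have "\<dots> \<le> (\<Sum>g\<in>grid_codes r. 2 ^ (32 * r) * (\<Prod>i<r. ?f (g i)))"
  proof (rule sum_mono)
    fix g assume g: "g \<in> grid_codes r"
    have nat: "(\<Sum>i<r. nat ((fst (g i))\<^sup>2 + (snd (g i))\<^sup>2)) = nat (\<Sum>i<r. (fst (g i))\<^sup>2 + (snd (g i))\<^sup>2)"
    proof -
      have "int (\<Sum>i<r. nat ((fst (g i))\<^sup>2 + (snd (g i))\<^sup>2)) = (\<Sum>i<r. (fst (g i))\<^sup>2 + (snd (g i))\<^sup>2)" by simp
      from arg_cong[OF this, of nat] show ?thesis by (simp only: nat_int)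
    qed
    have le: "nat (\<Sum>i<r. (fst (g i))\<^sup>2 + (snd (g i))\<^sup>2) \<le> 32 * r"
      using g unfolding grid_codes_def nat_le_iff by blast
    have "(\<Prod>i<r. ?f (g i)) = (1 / 2) ^ nat (\<Sum>i<r. (fst (g i))\<^sup>2 + (snd (g i))\<^sup>2)"
      unfolding power_sum[symmetric] nat ..
    also have "\<dots> \<ge> (1 / 2) ^ (32 * r)" by (rule power_decreasing[OF le]) auto
    finally have "2 ^ (32 * r) * (1 / 2 :: real) ^ (32 * r) \<le> 2 ^ (32 * r) * (\<Prod>i<r. ?f (g i))"
      by (intro mult_left_mono) auto
    then show "1 \<le> 2 ^ (32 * r) * (\<Prod>i<r. ?f (g i))" by (simp add: power_mult_distrib[symmetric])
  qed
  also have "\<dots> \<le> (\<Sum>g\<in>PiE {..<r} (\<lambda>_. ?B \<times> ?B). 2 ^ (32 * r) * (\<Prod>i<r. ?f (g i)))"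
  proof (rule sum_mono2)
    show "finite (PiE {..<r} (\<lambda>_. ?B \<times> ?B))" by (intro finite_PiE) simp_all
    show "grid_codes r \<subseteq> PiE {..<r} (\<lambda>_. ?B \<times> ?B)" unfolding grid_codes_def by (rule Collect_restrict)
  qed (simp add: prod_nonneg)
  also have "\<dots> = 2 ^ (32 * r) * (\<Prod>i<r. \<Sum>p\<in>?B \<times> ?B. ?f p)"
    by (subst prod_sum_PiE) (simp_all add: sum_distrib_left)
  also have "\<dots> \<le> 2 ^ (32 * r) * 9 ^ r"
  proof (rule mult_left_mono)
    have "(\<Prod>i<r. \<Sum>p\<in>?B \<times> ?B. ?f p) \<le> (\<Prod>i<r. 9)"
      by (rule prod_mono) (intro conjI S9 sum_nonneg, simp)
    then show "(\<Prod>i<r. \<Sum>p\<in>?B \<times> ?B. ?f p) \<le> 9 ^ r" by simp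
  qed simp
  finally show ?thesis .
qed

text \<open>Rounding towards zero: the error can reach 1 instead of 1/2, but absolute values do not
  grow, so a rounded vector stays in the ball.\<close>

lemma int_truncation: "\<exists>z::int. \<bar>of_int z\<bar> \<le> \<bar>x::real\<bar> \<and> \<bar>x - of_int z\<bar> \<le> 1"
proof (cases "0 \<le> x")
  case True
  then have "0 \<le> real_of_int \<lfloor>x\<rfloor>" by simp
  moreover have "real_of_int \<lfloor>x\<rfloor> \<le> x" "x < real_of_int \<lfloor>x\<rfloor> + 1" by linarith+
  ultimately show ?thesis
    using abs_ge_self[of x] unfolding abs_le_iff by (intro exI[of _ "\<lfloor>x\<rfloor>"] conjI) linarith+
next
  case False
  then have "real_of_int \<lceil>x\<rceil> \<le> 0" by simp
  moreover have "x \<le> real_of_int \<lceil>x\<rceil>" "real_of_int \<lceil>x\<rceil> < x + 1" by linarith+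
  ultimately show ?thesis
    using abs_ge_minus_self[of x] unfolding abs_le_iff by (intro exI[of _ "\<lceil>x\<rceil>"] conjI) linarith+
qed

lemma grid_net:
  assumes "1 \<le> r" "sqn r u \<le> 1"
  shows "\<exists>g\<in>grid_codes r. sqn r (grid_point r g) \<le> 1 \<and> sqn r (\<lambda>i. u i - grid_point r g i) \<le> 1 / 16"
proof -
  define h where "h = 1 / sqrt (32 * real r)"
  have h: "h > 0" "h\<^sup>2 = 1 / (32 * r)" using assms(1) by (simp_all add: h_def power_divide)
  define T where "T = (\<lambda>x::real. SOME z::int. \<bar>of_int z\<bar> \<le> \<bar>x\<bar> \<and> \<bar>x - of_int z\<bar> \<le> 1)"
  have T: "\<bar>of_int (T x)\<bar> \<le> \<bar>x\<bar>" "\<bar>x - of_int (T x)\<bar> \<le> 1" for x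
    using someI_ex[OF int_truncation[of x]] by (auto simp: T_def)
  define g where "g = (\<lambda>i\<in>{..<r}. (T (Re (u i) / h), T (Im (u i) / h)))"
  have sq: "h\<^sup>2 * (real_of_int (T (x / h)))\<^sup>2 \<le> x\<^sup>2" for x
  proof -
    have "\<bar>h * of_int (T (x / h))\<bar> \<le> \<bar>x\<bar>"
      using T(1)[of "x / h"] h(1) by (simp add: abs_mult field_simps)
    then have "\<bar>h * of_int (T (x / h))\<bar>\<^sup>2 \<le> \<bar>x\<bar>\<^sup>2" by (intro power_mono) auto
    then show ?thesis by (simp add: power_mult_distrib)
  qed
  have er: "(x - h * of_int (T (x / h)))\<^sup>2 \<le> h\<^sup>2" for x
  proof -
    have "\<bar>x - h * of_int (T (x / h))\<bar> = h * \<bar>x / h - of_int (T (x / h))\<bar>"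
    proof -
      have "x - h * of_int (T (x / h)) = h * (x / h - of_int (T (x / h)))" using h(1) by (simp add: field_simps)
      then show ?thesis using h(1) by (simp add: abs_mult)
    qed
    also have "\<dots> \<le> h * 1" using h(1) by (intro mult_left_mono T) auto
    finally have "\<bar>x - h * of_int (T (x / h))\<bar>\<^sup>2 \<le> h\<^sup>2" by (intro power_mono) auto
    then show ?thesis by simp
  qed
  have pt: "grid_point r g i = Complex (h * of_int (T (Re (u i) / h))) (h * of_int (T (Im (u i) / h)))" if "i < r" for i
    using that by (simp add: grid_point_def g_def h_def complex_eq_iff)
  have sqsum: "h\<^sup>2 * (\<Sum>i<r. (real_of_int (fst (g i)))\<^sup>2 + (real_of_int (snd (g i)))\<^sup>2) \<le> sqn r u"
    unfolding sum_distrib_left sqn_def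
  proof (rule sum_mono)
    fix i assume "i \<in> {..<r}"
    then show "h\<^sup>2 * ((real_of_int (fst (g i)))\<^sup>2 + (real_of_int (snd (g i)))\<^sup>2) \<le> (cmod (u i))\<^sup>2"
      using sq[of "Re (u i)"] sq[of "Im (u i)"] by (simp add: g_def cmod_power2 distrib_left)
  qed
  then have "(\<Sum>i<r. (real_of_int (fst (g i)))\<^sup>2 + (real_of_int (snd (g i)))\<^sup>2) \<le> 32 * r"
  proof -
    have "h\<^sup>2 * S \<le> 1 \<Longrightarrow> S \<le> 32 * r" for S
      unfolding h(2) using assms(1) by (simp add: field_simps)
    then show ?thesis using sqsum assms(2) by (meson order_trans)
  qed
  then have "real_of_int (\<Sum>i<r. (fst (g i))\<^sup>2 + (snd (g i))\<^sup>2) \<le> real_of_int (int (32 * r))" by simp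
  then have isum: "(\<Sum>i<r. (fst (g i))\<^sup>2 + (snd (g i))\<^sup>2) \<le> int (32 * r)" by (simp only: of_int_le_iff)
  have bound: "\<bar>fst (g i)\<bar> \<le> int (32 * r) \<and> \<bar>snd (g i)\<bar> \<le> int (32 * r)" if "i < r" for i
  proof -
    have "(fst (g i))\<^sup>2 + (snd (g i))\<^sup>2 \<le> (\<Sum>i<r. (fst (g i))\<^sup>2 + (snd (g i))\<^sup>2)"
      using that by (intro member_le_sum) auto
    then have "(fst (g i))\<^sup>2 + (snd (g i))\<^sup>2 \<le> int (32 * r)" using isum by simp
    then show ?thesis
      using int_abs_le_square[of "fst (g i)"] int_abs_le_square[of "snd (g i)"]
        zero_le_power2[of "fst (g i)"] zero_le_power2[of "snd (g i)"] by linarith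
  qed
  have "g \<in> PiE {..<r} (\<lambda>_. {- int (32 * r)..int (32 * r)} \<times> {- int (32 * r)..int (32 * r)})"
  proof (rule PiE_I)
    fix i assume "i \<in> {..<r}"
    then show "g i \<in> {- int (32 * r)..int (32 * r)} \<times> {- int (32 * r)..int (32 * r)}"
      using bound[of i] by (simp add: mem_Times_iff abs_le_iff)
  qed (simp add: g_def)
  then have "g \<in> grid_codes r" unfolding grid_codes_def using isum by blast
  moreover have "sqn r (grid_point r g) \<le> 1"
  proof -
    have "sqn r (grid_point r g) = h\<^sup>2 * (\<Sum>i<r. (real_of_int (fst (g i)))\<^sup>2 + (real_of_int (snd (g i)))\<^sup>2)"
      unfolding sqn_def sum_distrib_left
    proof (intro sum.cong refl)
      fix i assume "i \<in> {..<r}"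
      then have i: "i < r" by simp
      then have "g i = (T (Re (u i) / h), T (Im (u i) / h))" by (simp add: g_def)
      then show "(cmod (grid_point r g i))\<^sup>2 = h\<^sup>2 * ((real_of_int (fst (g i)))\<^sup>2 + (real_of_int (snd (g i)))\<^sup>2)"
        unfolding pt[OF i] by (simp add: cmod_power2 power_mult_distrib distrib_left)
    qed
    then show ?thesis using sqsum assms by simp
  qed
  moreover have "sqn r (\<lambda>i. u i - grid_point r g i) \<le> 1 / 16"
  proof -
    have "sqn r (\<lambda>i. u i - grid_point r g i) \<le> (\<Sum>i<r. h\<^sup>2 + h\<^sup>2)"
      unfolding sqn_def
    proof (rule sum_mono)
      fix i assume "i \<in> {..<r}"
      then show "(cmod (u i - grid_point r g i))\<^sup>2 \<le> h\<^sup>2 + h\<^sup>2"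
        using er[of "Re (u i)"] er[of "Im (u i)"] by (simp add: pt cmod_power2)
    qed
    also have "\<dots> = 1 / 16" using h(2) assms(1) by simp
    finally show ?thesis .
  qed
  ultimately show ?thesis by blast
qed

section \<open>Exponential moments of the norm of the signed sum\<close>

lemma exp_abs_le: "exp \<bar>x::real\<bar> \<le> exp x + exp (- x)"
  by (cases "0 \<le> x") (simp_all add: add_increasing add_increasing2)

lemma selfadj_signed_sum: "selfadj r (multi_update r (\<lambda>v i. 0) c z k)"
  by (induction k) (auto simp: multi_update_0 multi_update_Suc selfadj_def[of r "\<lambda>v i. 0"] cip_def
    intro!: selfadj_rank_one_update)

lemma form_signed_sum:
  "Re (cip r v (multi_update r (\<lambda>v i. 0) c z k v)) = (\<Sum>j<k. c j * (cmod (cip r (z j) v))\<^sup>2)"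
  unfolding Re_cip_multi_update by (simp add: cip_def)

lemma abs_form_signed_sum_le:
  "\<bar>Re (cip r v (multi_update r (\<lambda>v i. 0) c z k v))\<bar> \<le> (\<Sum>j<k. \<bar>c j\<bar> * sqn r (z j)) * sqn r v"
  unfolding form_signed_sum sum_distrib_right
proof (rule order_trans[OF sum_abs sum_mono])
  fix j
  show "\<bar>c j * (cmod (cip r (z j) v))\<^sup>2\<bar> \<le> \<bar>c j\<bar> * sqn r (z j) * sqn r v"
    unfolding abs_mult mult.assoc by (intro mult_left_mono) (auto simp: cip_Cauchy_Schwarz)
qed

text \<open>A union bound over the net: the exponential of a maximum is at most the sum over net
  points and both signs. The net doubles the exponent to 2 T, whence 16 (2 T)^2 = 64 T^2.\<close>

lemma expectation_exp_form_norm: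
  fixes T :: real and d r k :: nat
  defines "W \<equiv> \<lambda>d q r k g. multi_update r (\<lambda>v i. 0) (\<lambda>j. fst (g j)) (\<lambda>j. frame_comb d q (snd (g j))) k"
  assumes frame: "tight_frame d r q" and r: "1 \<le> r" and T: "0 \<le> T" "2 * T \<le> 1 / 4"
  shows "E (Pi_pmf {..<k} dy (\<lambda>_. pair_pmf sign_pmf (rademacher {..<d})))
     (\<lambda>g. exp (T * form_norm r (W d q r k g))) \<le> exp (37 * r + 64 * T\<^sup>2 * k)"
proof -
  let ?C = "pair_pmf sign_pmf (rademacher {..<d})"
  let ?P = "Pi_pmf {..<k} dy (\<lambda>_. ?C)"
  have fin: "finite (set_pmf ?P)"
    by (rule finite_set_Pi_pmf) (simp_all add: set_sign_pmf finite_set_rademacher)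
  define Q where "Q = (\<lambda>g v. \<Sum>j<k. fst (g j) * (cmod (cip r (frame_comb d q (snd (g j))) v))\<^sup>2)"
  have form: "Re (cip r v (W d q r k g v)) = Q g v" for g v
    unfolding W_def form_signed_sum Q_def ..
  have sa: "selfadj r (W d q r k g)" for g
    unfolding W_def by (rule selfadj_signed_sum)
  \<comment> \<open>At a vector outside the unit ball the switch turns the exponential into 1, so
    the moment bound is invoked inside the ball only.\<close>
  have point: "exp (T * form_norm r (W d q r k g)) \<le>
      (\<Sum>c\<in>grid_codes r. exp (2 * T * Q g (grid_point r c) * (if sqn r (grid_point r c) \<le> 1 then 1 else 0))
       + exp (- 2 * T * Q g (grid_point r c) * (if sqn r (grid_point r c) \<le> 1 then 1 else 0)))" for g
  proof -
    let ?N = "{v \<in> grid_point r ` grid_codes r. sqn r v \<le> 1}"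
    define C where "C = (\<Sum>j<k. \<bar>fst (g j)\<bar> * sqn r (frame_comb d q (snd (g j))))"
    have C0: "0 \<le> C" unfolding C_def by (intro sum_nonneg mult_nonneg_nonneg sqn_nonneg) auto
    have bdd: "\<bar>Re (cip r v (W d q r k g v))\<bar> \<le> C * sqn r v" for v
      unfolding W_def C_def by (rule abs_form_signed_sum_le)
    have net: "\<exists>v\<in>?N. sqn r v \<le> 1 \<and> sqn r (\<lambda>i. u i - v i) \<le> 1 / 16" if "sqn r u \<le> 1" for u
      using grid_net[OF r that] by auto
    have finN: "finite ?N" by (simp add: finite_grid_codes)
    have neN: "?N \<noteq> {}" using net[of "\<lambda>_. 0"] by (auto simp: sqn_def)
    define m where "m = Max ((\<lambda>v. \<bar>Q g v\<bar>) ` ?N)"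
    have "form_norm r (W d q r k g) \<le> 2 * m"
      by (rule form_norm_net[OF sa bdd C0 net]) (use finN in \<open>auto simp: m_def form intro!: Max_ge\<close>)
    have "m \<in> (\<lambda>v. \<bar>Q g v\<bar>) ` ?N" unfolding m_def using finN neN by (intro Max_in) auto
    then obtain c where c: "c \<in> grid_codes r" "sqn r (grid_point r c) \<le> 1" "m = \<bar>Q g (grid_point r c)\<bar>" by auto
    have "exp (T * form_norm r (W d q r k g)) \<le> exp (T * (2 * m))"
      using T \<open>form_norm r (W d q r k g) \<le> 2 * m\<close> by (simp add: mult_left_mono)
    also have "\<dots> = exp \<bar>2 * T * Q g (grid_point r c)\<bar>" using T c(3) by (simp add: abs_mult)
    also have "\<dots> \<le> exp (2 * T * Q g (grid_point r c)) + exp (- (2 * T * Q g (grid_point r c)))" by (rule exp_abs_le)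
    also have "\<dots> = exp (2 * T * Q g (grid_point r c) * (if sqn r (grid_point r c) \<le> 1 then 1 else 0))
       + exp (- 2 * T * Q g (grid_point r c) * (if sqn r (grid_point r c) \<le> 1 then 1 else 0))"
      using c(2) by simp
    also have "\<dots> \<le> (\<Sum>c\<in>grid_codes r. exp (2 * T * Q g (grid_point r c) * (if sqn r (grid_point r c) \<le> 1 then 1 else 0))
       + exp (- 2 * T * Q g (grid_point r c) * (if sqn r (grid_point r c) \<le> 1 then 1 else 0)))"
      by (rule member_le_sum[OF c(1)]) (auto simp: finite_grid_codes add_nonneg_nonneg)
    finally show ?thesis .
  qed
  have each: "E ?P (\<lambda>g. exp (t * Q g v * (if sqn r v \<le> 1 then 1 else 0))) \<le> exp (64 * T\<^sup>2 * k)"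
    if "t = 2 * T \<or> t = - 2 * T" for v t
  proof (cases "sqn r v \<le> 1")
    case True
    have "E ?P (\<lambda>g. exp (t * Q g v)) \<le> exp (16 * t\<^sup>2 * k)"
      unfolding Q_def using that T by (intro expectation_signed_sum_exp frame True) auto
    also have "16 * t\<^sup>2 = 64 * T\<^sup>2" using that by (auto simp: power_mult_distrib)
    finally show ?thesis using True by simp
  qed simp
  have "E ?P (\<lambda>g. exp (T * form_norm r (W d q r k g))) \<le> E ?P (\<lambda>g. 
      (\<Sum>c\<in>grid_codes r. exp (2 * T * Q g (grid_point r c) * (if sqn r (grid_point r c) \<le> 1 then 1 else 0))
       + exp (- 2 * T * Q g (grid_point r c) * (if sqn r (grid_point r c) \<le> 1 then 1 else 0))))"
    by (intro expectation_mono[OF fin] point)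
  also have "\<dots> = (\<Sum>c\<in>grid_codes r. 
      E ?P (\<lambda>g. exp (2 * T * Q g (grid_point r c) * (if sqn r (grid_point r c) \<le> 1 then 1 else 0)))
       + E ?P (\<lambda>g. exp (- 2 * T * Q g (grid_point r c) * (if sqn r (grid_point r c) \<le> 1 then 1 else 0))))"
    by (simp only: expectation_sum[OF fin] expectation_add[OF fin])
  also have "\<dots> \<le> (\<Sum>c\<in>grid_codes r. exp (64 * T\<^sup>2 * k) + exp (64 * T\<^sup>2 * k))"
    by (intro sum_mono add_mono each) auto
  also have "\<dots> = (2 * real (card (grid_codes r))) * exp (64 * T\<^sup>2 * k)" by simp
  also have "\<dots> \<le> exp (37 * real r) * exp (64 * T\<^sup>2 * k)"
  proof (rule mult_right_mono)
    \<comment> \<open>The two signs, the factor 2^(32 r) and 9^r \<le> 2^(4 r) combine to at most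
      2^(37 r).\<close>
    have "2 * real (card (grid_codes r)) \<le> 2 ^ r * (2 ^ (32 * r) * 16 ^ r)"
    proof (rule mult_mono)
      show "(2::real) \<le> 2 ^ r" using r by (metis power_increasing one_le_numeral power_one_right)
      have "(9::real) ^ r \<le> 16 ^ r" by (intro power_mono) auto
      then have "(2::real) ^ (32 * r) * 9 ^ r \<le> 2 ^ (32 * r) * 16 ^ r" by (intro mult_left_mono) auto
      then show "real (card (grid_codes r)) \<le> 2 ^ (32 * r) * 16 ^ r" using card_grid_codes[of r] by linarith
    qed auto
    also have "\<dots> = 2 ^ (37 * r)"
    proof -
      have "(16::real) ^ r = 2 ^ (4 * r)" by (simp add: power_mult)
      then show ?thesis by (simp add: power_add[symmetric])
    qed
    also have "\<dots> \<le> exp 1 ^ (37 * r)"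
      using exp_ge_add_one_self[of "1::real"] by (intro power_mono) auto
    also have "\<dots> = exp (37 * real r)" by (simp add: exp_of_nat_mult[symmetric])
    finally show "2 * real (card (grid_codes r)) \<le> exp (37 * real r)" .
  qed simp
  finally show ?thesis by (simp add: exp_add)
qed

section \<open>The abstract lower tail\<close>

text \<open>Lyapunov's inequality, from the convexity of exp between 0 and T w - m. It makes the
  cost of the net, exponential in the dimension at the fixed exponent \<open>T\<close>, shrink in
  proportion to t / T.\<close>

lemma expectation_exp_power:
  fixes w :: "'a \<Rightarrow> real"
  assumes fin: "finite (set_pmf p)" and t: "0 < T" "0 \<le> t" "t \<le> T"
    and M: "E p (\<lambda>x. exp (T * w x)) \<le> exp m"
  shows "E p (\<lambda>x. exp (t * w x)) \<le> exp (t / T * m)"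
proof -
  define u where "u = t / T"
  have u: "0 \<le> u" "u \<le> 1" using t by (simp_all add: u_def)
  have "exp (t * w x) \<le> exp (u * m) * (1 - u) + (exp (u * m) * u * exp (- m)) * exp (T * w x)" for x
  proof -
    have "exp ((1 - u) *\<^sub>R 0 + u *\<^sub>R (T * w x - m)) \<le> (1 - u) * exp 0 + u * exp (T * w x - m)"
      by (rule convex_onD[OF exp_convex u]) auto
    then have "exp (u * m) * exp (u * (T * w x - m)) \<le> exp (u * m) * ((1 - u) + u * exp (T * w x - m))"
      by (intro mult_left_mono) auto
    moreover have "exp (u * m) * exp (u * (T * w x - m)) = exp (t * w x)"
    proof -
      have "u * m + u * (T * w x - m) = t * w x" using t(1) by (simp add: u_def algebra_simps)
      then show ?thesis by (simp only: exp_add[symmetric])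
    qed
    moreover have "exp (u * m) * ((1 - u) + u * exp (T * w x - m)) =
        exp (u * m) * (1 - u) + (exp (u * m) * u * exp (- m)) * exp (T * w x)"
      by (simp add: diff_conv_add_uminus exp_add distrib_left mult_ac del: add_uminus_conv_diff)
    ultimately show ?thesis by linarith
  qed
  then have "E p (\<lambda>x. exp (t * w x)) \<le> E p (\<lambda>x. exp (u * m) * (1 - u) + (exp (u * m) * u * exp (- m)) * exp (T * w x))"
    by (intro expectation_mono[OF fin])
  also have "\<dots> = exp (u * m) * (1 - u) + (exp (u * m) * u * exp (- m)) * E p (\<lambda>x. exp (T * w x))"
    by (simp add: expectation_add[OF fin])
  also have "\<dots> \<le> exp (u * m) * (1 - u) + (exp (u * m) * u * exp (- m)) * exp m"
    using u by (intro add_left_mono mult_left_mono M) auto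
  also have "\<dots> = exp (u * m)" by (simp add: exp_minus algebra_simps)
  finally show ?thesis by (simp add: u_def)
qed

text \<open>The potential is at most r exp (2 a w) for the norm \<open>w\<close> of the signed sum.
  The moment bound at T = 1/2048, lowered to the exponent 2 a \<le> T, costs a (151552 r + k / 16);
  asking for at most a k / 8 is what sets the constant 3000000.\<close>

lemma expectation_trace_dense_le:
  fixes d r k n :: nat and s a :: real and q :: "nat \<Rightarrow> nat \<Rightarrow> complex"
  defines "X \<equiv> frame_comb d q"
  assumes frame: "tight_frame d r q" and r: "1 \<le> r" and k: "3000000 * r \<le> k"
    and s: "0 \<le> s" "a = n * s" "a \<le> 1 / 4096" and R: "k * (2 * s * R) \<le> 1"
    and bdy: "\<And>\<rho>. \<rho> \<in> set_pmf (rademacher {..<d}) \<Longrightarrow> sqn r (X \<rho>) \<le> R"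
  shows "E (Pi_pmf {..<k} dy (\<lambda>_. pair_pmf sign_pmf (rademacher {..<d})))
      (\<lambda>g. op_trace r (multi_update r (\<lambda>v. v) (\<lambda>j. 2 * s * fst (g j)) (\<lambda>j. X (snd (g j))) k ^^ n))
     \<le> r * exp (a * k / 8)"
proof -
  let ?C = "pair_pmf sign_pmf (rademacher {..<d})"
  let ?P = "Pi_pmf {..<k} dy (\<lambda>_. ?C)"
  have fin: "finite (set_pmf ?P)"
    by (rule finite_set_Pi_pmf) (simp_all add: set_sign_pmf finite_set_rademacher)
  define w where "w = (\<lambda>g. form_norm r (multi_update r (\<lambda>v i. 0) (\<lambda>j. fst (g j)) (\<lambda>j. X (snd (g j))) k))"
  have a0: "0 \<le> a" using s by simp
  have "E ?P (\<lambda>g. op_trace r (multi_update r (\<lambda>v. v) (\<lambda>j. 2 * s * fst (g j)) (\<lambda>j. X (snd (g j))) k ^^ n))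
     \<le> E ?P (\<lambda>g. r * exp (2 * a * w g))"
  proof (rule expectation_mono[OF fin])
    fix g assume "g \<in> set_pmf ?P"
    then have "g j \<in> set_pmf ?C" if "j < k" for j
      using that by (auto simp: set_Pi_pmf PiE_dflt_def simp del: set_pair_pmf)
    then have g: "\<bar>fst (g j)\<bar> = 1" "sqn r (X (snd (g j))) \<le> R" if "j < k" for j
      using that by (fastforce simp: set_sign_pmf intro!: bdy)+
    let ?M = "multi_update r (\<lambda>v. v) (\<lambda>j. 2 * s * fst (g j)) (\<lambda>j. X (snd (g j))) k"
    let ?W = "multi_update r (\<lambda>v i. 0) (\<lambda>j. fst (g j)) (\<lambda>j. X (snd (g j))) k"
    let ?B = "\<Sum>j<k. \<bar>fst (g j)\<bar> * sqn r (X (snd (g j)))"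
    have B0: "0 \<le> ?B" by (intro sum_nonneg mult_nonneg_nonneg sqn_nonneg) auto
    have "near_id r (0 + k * (2 * s * R)) ?M"
      using s by (intro near_id_multi_update near_id_id) (auto simp: g abs_mult intro!: mult_left_mono)
    then have psd: "psd r ?M" using R by (intro near_id_psd) auto
    have w0: "0 \<le> w g" unfolding w_def
      by (rule form_norm_nonneg[OF selfadj_signed_sum abs_form_signed_sum_le B0])
    have "Re (cip r v (?M v)) \<le> (1 + 2 * s * w g) * sqn r v" for v
    proof -
      have "Re (cip r v (?M v)) = sqn r v + 2 * s * Re (cip r v (?W v))"
        unfolding form_signed_sum Re_cip_multi_update
        by (simp add: cip_self sum_distrib_left mult.assoc)
      also have "\<dots> \<le> sqn r v + 2 * s * (w g * sqn r v)"
      proof (intro add_left_mono mult_left_mono)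
        show "Re (cip r v (?W v)) \<le> w g * sqn r v"
          using form_le_form_norm[OF selfadj_signed_sum abs_form_signed_sum_le B0, of v]
          unfolding w_def by linarith
      qed (use s in simp)
      finally show ?thesis by (simp add: algebra_simps)
    qed
    then have "op_trace r (?M ^^ n) \<le> r * (1 + 2 * s * w g) ^ n"
      using w0 s by (intro op_trace_funpow_le psd) auto
    also have "\<dots> \<le> r * exp (2 * s * w g) ^ n"
      using w0 s by (intro mult_left_mono power_mono) auto
    also have "exp (2 * s * w g) ^ n = exp (2 * a * w g)"
      by (simp add: exp_of_nat_mult[symmetric] s(2) mult_ac)
    finally show "op_trace r (?M ^^ n) \<le> r * exp (2 * a * w g)" .
  qed
  also have "\<dots> = r * E ?P (\<lambda>g. exp (2 * a * w g))" by simp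
  also have "\<dots> \<le> r * exp (2 * a / (1 / 2048) * (37 * r + 64 * (1 / 2048)\<^sup>2 * k))"
  proof (rule mult_left_mono)
    have "E ?P (\<lambda>g. exp (1 / 2048 * w g)) \<le> exp (37 * r + 64 * (1 / 2048)\<^sup>2 * k)"
      unfolding w_def X_def by (rule expectation_exp_form_norm[OF frame r]) auto
    then show "E ?P (\<lambda>g. exp (2 * a * w g)) \<le> exp (2 * a / (1 / 2048) * (37 * r + 64 * (1 / 2048)\<^sup>2 * k))"
      using a0 s(3) by (intro expectation_exp_power[OF fin]) auto
  qed simp
  also have "\<dots> \<le> r * exp (a * k / 8)"
  proof -
    have k': "3000000 * real r \<le> real k" using k by (metis of_nat_le_iff of_nat_mult of_nat_numeral)
    have "2 * a / (1 / 2048) * (37 * r + 64 * (1 / 2048)\<^sup>2 * k) = a * (151552 * r + k / 16)"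
      by (simp add: power2_eq_square algebra_simps)
    also have "\<dots> \<le> a * (k / 8)" using k' a0 by (intro mult_left_mono) auto
    finally show ?thesis by (simp add: mult_left_mono)
  qed
  finally show ?thesis .
qed

text \<open>With y = \<theta> / (2 n) \<le> 1/16 the quadratic loss 2 y^2 in the logarithm of 1 - y
  is at most y / 8.\<close>

lemma exp_le_one_minus_power:
  fixes \<theta> :: real
  assumes "0 \<le> \<theta>" "8 * \<theta> \<le> n" "1 \<le> n"
  shows "exp (- (9 / 16 * \<theta>)) \<le> (1 - \<theta> / (2 * real n)) ^ n"
proof -
  define y where "y = \<theta> / (2 * real n)"
  have n: "real n > 0" using assms(3) by simp
  have y: "0 \<le> y" "y \<le> 1 / 16" using assms n by (simp_all add: y_def field_simps)
  have "- y - 2 * y\<^sup>2 \<le> ln (1 - y)" using y by (intro ln_one_minus_pos_lower_bound) auto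
  then have "exp (- y - 2 * y\<^sup>2) \<le> 1 - y" using y by (simp add: ln_ge_iff)
  moreover have "- (9 / 8 * y) \<le> - y - 2 * y\<^sup>2"
    using mult_left_mono[OF y(2) y(1)] by (simp add: power2_eq_square)
  ultimately have "exp (- (9 / 8 * y)) \<le> 1 - y" by (meson exp_le_cancel_iff order_trans)
  then have "exp (- (9 / 8 * y)) ^ n \<le> (1 - y) ^ n" by (intro power_mono) auto
  moreover have "exp (- (9 / 8 * y)) ^ n = exp (- (9 / 16 * \<theta>))"
    using n by (simp add: exp_of_nat_mult[symmetric] y_def)
  ultimately show ?thesis by (simp add: y_def)
qed

text \<open>Markov's inequality for the potential. A bad direction forces it to be at least exp (-
  9/16 \<theta>), whereas its expectation is at most r exp (- 3/4 \<theta>) exp (\<theta> / 8). The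
  quotient is r exp (- \<theta> / 16), and the number 112 makes \<theta> / 16 = 7 L: one L pays for
  r \<le> exp L, the other six leave at most 2^(-6) < 1/40.\<close>

lemma sparse_law_lower_bound:
  fixes d r \<xi> k :: nat and q :: "nat \<Rightarrow> nat \<Rightarrow> complex" and \<mu> :: real
  defines "L \<equiv> ln (max 2 (real r))"
  assumes frame: "tight_frame d r q" and r: "1 \<le> r" and xi: "1 \<le> \<xi>" "\<xi> \<le> d" and k: "k = 3000000 * r"
    and coh: "\<And>l. l < d \<Longrightarrow> sqn r (q l) \<le> \<mu>" "112 * L / k * (d / \<xi>) * \<mu> \<le> 1 / 8"
  shows "measure_pmf.prob (Pi_pmf {..<k} dx (\<lambda>_. sparse_law d \<xi>))
    {\<omega>. \<exists>u. sqn r u = 1 \<and> (\<Sum>j<k. (cmod (cip r (frame_comb d q (\<omega> j)) u))\<^sup>2) < k / 2} \<le> 1 / 40"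
proof -
  let ?X = "frame_comb d q"
  let ?S = "sparse_law d \<xi>"
  let ?P = "Pi_pmf {..<k} dx (\<lambda>_. ?S)"
  let ?bad = "{\<omega>. \<exists>u. sqn r u = 1 \<and> (\<Sum>j<k. (cmod (cip r (?X (\<omega> j)) u))\<^sup>2) < k / 2}"
  define \<theta> where "\<theta> = 112 * L"
  define a where "a = \<theta> / k"
  have k0: "real k > 0" using k r by simp
  have L2: "ln 2 \<le> L" "real r \<le> exp L" unfolding L_def by auto
  then have L0: "0 < L" using ln_gt_zero[of 2] by linarith
  have Lr: "L \<le> r"
  proof -
    have "L \<le> max 2 (real r) - 1" unfolding L_def by (rule ln_le_minus_one) simp
    also have "\<dots> \<le> r" using r by (simp add: max_def)
    finally show ?thesis .
  qed
  have th: "0 < \<theta>" "\<theta> = a * k" using L0 k0 by (simp_all add: \<theta>_def a_def)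
  have a: "0 \<le> a" "a \<le> 1 / 4096"
    using Lr L0 r unfolding a_def \<theta>_def k by (simp_all add: field_simps)
  have finS: "finite (set_pmf ?S)" by (rule finite_set_sparse_law[OF xi(2)])
  have finP: "finite (set_pmf ?P)" by (rule finite_set_Pi_pmf) (auto simp: finS)
  have finR: "finite (set_pmf (rademacher {..<d}))" by (simp add: finite_set_rademacher)
  \<comment> \<open>A crude common bound on all squared column norms suffices: \<open>n\<close> is
    chosen after it, and the final estimate involves neither.\<close>
  define R where "R = (\<Sum>\<omega>\<in>set_pmf ?S. sqn r (?X \<omega>)) + (\<Sum>\<rho>\<in>set_pmf (rademacher {..<d}). sqn r (?X \<rho>))"
  have R0: "0 \<le> R" unfolding R_def by (intro add_nonneg_nonneg sum_nonneg sqn_nonneg)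
  have bdx: "sqn r (?X \<omega>) \<le> R" if "\<omega> \<in> set_pmf ?S" for \<omega>
    unfolding R_def using that finS
    by (intro add_increasing2 member_le_sum sum_nonneg sqn_nonneg) auto
  have bdy: "sqn r (?X \<rho>) \<le> R" if "\<rho> \<in> set_pmf (rademacher {..<d})" for \<rho>
    unfolding R_def using that finR
    by (intro add_increasing member_le_sum sum_nonneg sqn_nonneg) auto
  \<comment> \<open>n \<ge> 16 \<theta> R keeps the operator within 1/8 of the identity through all
    updates, n \<ge> 8 \<theta> is the condition of \<open>exp_le_one_minus_power\<close>, and n = 2
    N is even so that a single direction is bounded by the trace.\<close>
  define N where "N = Suc (nat \<lceil>8 * \<theta> + 16 * \<theta> * R\<rceil>)"
  define n where "n = 2 * N"
  have n: "even n" "2 \<le> n" by (simp_all add: n_def N_def)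
  have "8 * \<theta> + 16 * \<theta> * R \<le> n"
  proof -
    have "8 * \<theta> + 16 * \<theta> * R \<le> real N" unfolding N_def by linarith
    also have "\<dots> \<le> n" unfolding n_def by simp
    finally show ?thesis .
  qed
  moreover have "0 \<le> 16 * \<theta> * R" using th(1) R0 by simp
  ultimately have nb: "8 * \<theta> \<le> n" "16 * \<theta> * R \<le> n" using th(1) by linarith+
  have n0: "real n > 0" using n by simp
  define s where "s = a / n"
  have s: "0 \<le> s" "a = n * s" using a n0 by (simp_all add: s_def)
  have ksR: "k * (2 * s * R) \<le> 1 / 8"
  proof -
    have "k * (2 * s * R) = 2 * \<theta> * R / n" using th n0 by (simp add: s_def)
    also have "\<dots> \<le> 1 / 8" using nb(2) n0 by (simp add: divide_le_eq mult.assoc)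
    finally show ?thesis .
  qed
  have ks: "s * k = \<theta> / n" using th by (simp add: s_def)
  let ?M = "\<lambda>\<omega>. multi_update r (\<lambda>v. v) (\<lambda>_. - s) (\<lambda>j. ?X (\<omega> j)) k"
  define c where "c = exp (- (9 / 16 * \<theta>))"
  have near: "near_id r (1 / 8) (?M \<omega>)" if "\<omega> \<in> set_pmf ?P" for \<omega>
  proof -
    have \<omega>: "\<omega> j \<in> set_pmf ?S" if "j < k" for j
      using that \<open>\<omega> \<in> set_pmf ?P\<close> by (auto simp: set_Pi_pmf PiE_dflt_def)
    have "near_id r (0 + k * (s * R)) (?M \<omega>)"
      using s \<omega> by (intro near_id_multi_update near_id_id) (auto intro!: mult_left_mono bdx)
    moreover have "0 \<le> real k * (s * R)" using s(1) R0 by simp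
    then have "0 + k * (s * R) \<le> 1 / 8" using ksR by simp
    ultimately show ?thesis by (rule near_id_mono)
  qed
  have "c * measure_pmf.prob ?P ?bad = E ?P (\<lambda>\<omega>. c * indicator ?bad \<omega>)"
    by simp
  also have "\<dots> \<le> E ?P (\<lambda>\<omega>. op_trace r (?M \<omega> ^^ n))"
  proof (rule expectation_mono[OF finP])
    fix \<omega> assume \<omega>: "\<omega> \<in> set_pmf ?P"
    note nr = near[OF \<omega>]
    have psd: "psd r (?M \<omega>)" by (rule near_id_psd[OF nr]) simp
    show "c * indicator ?bad \<omega> \<le> op_trace r (?M \<omega> ^^ n)"
    proof (cases "\<omega> \<in> ?bad")
      case True
      then obtain u where u: "sqn r u = 1" "(\<Sum>j<k. (cmod (cip r (?X (\<omega> j)) u))\<^sup>2) < k / 2" by blast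
      \<comment> \<open>A bad direction keeps the first moment above 1 - s k / 2; Jensen's
        inequality passes from there to the n-th moment.\<close>
      have "mom r (?M \<omega>) 1 u = 1 - s * (\<Sum>j<k. (cmod (cip r (?X (\<omega> j)) u))\<^sup>2)"
        unfolding mom_def using Re_cip_multi_update[of r u "\<lambda>v. v" "\<lambda>_. - s" "\<lambda>j. ?X (\<omega> j)" k] u(1)
        by (simp add: cip_self sum_distrib_left sum_negf)
      moreover have "s * (\<Sum>j<k. (cmod (cip r (?X (\<omega> j)) u))\<^sup>2) \<le> s * (k / 2)"
        using u(2) s(1) by (intro mult_left_mono) auto
      ultimately have m1: "1 - \<theta> / (2 * real n) \<le> mom r (?M \<omega>) 1 u" using ks by simp
      have "c \<le> (1 - \<theta> / (2 * real n)) ^ n"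
        unfolding c_def using th nb n by (intro exp_le_one_minus_power) auto
      also have "\<dots> \<le> mom r (?M \<omega>) 1 u ^ n"
        using m1 nb(1) n0 th(1) by (intro power_mono) (auto simp: field_simps)
      also have "\<dots> \<le> mom r (?M \<omega>) n u" by (rule mom_power_le[OF nr _ u(1)]) simp
      also have "\<dots> \<le> sqn r u * op_trace r (?M \<omega> ^^ n)"
        by (rule mom_le_op_trace[OF psd_selfadj[OF psd] n(1)])
      finally show ?thesis using True u(1) by simp
    next
      case False
      then show ?thesis using op_trace_nonneg[OF psd] by simp
    qed
  qed
  also have "\<dots> \<le> (1 - 3 / 4 * a) ^ k * E (Pi_pmf {..<k} (0, \<lambda>_. 0) (\<lambda>_. pair_pmf sign_pmf (rademacher {..<d})))
      (\<lambda>g. op_trace r (multi_update r (\<lambda>v. v) (\<lambda>j. 2 * s * fst (g j)) (\<lambda>j. ?X (snd (g j))) k ^^ n))"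
  proof (rule hybrid_comparison[where \<delta> = 0 and R = R and \<mu> = \<mu> and a = a])
    show "a * (d / \<xi>) * \<mu> \<le> 1 / 8" using coh(2) by (simp add: a_def \<theta>_def)
    show "a \<le> 1" using a by simp
    show "near_id r 0 (\<lambda>v. v)" by (rule near_id_id) simp
    show "0 + k * (2 * s * R) \<le> 1 / 8" using ksR by simp
  qed (use frame xi s R0 n coh(1) bdx bdy in auto)
  also have "\<dots> \<le> exp (- (3 / 4 * a)) ^ k * (r * exp (a * k / 8))"
  proof (rule mult_mono)
    show "(1 - 3 / 4 * a) ^ k \<le> exp (- (3 / 4 * a)) ^ k"
      using a exp_ge_add_one_self[of "- (3 / 4 * a)"] by (intro power_mono) auto
    show "E (Pi_pmf {..<k} (0, \<lambda>_. 0) (\<lambda>_. pair_pmf sign_pmf (rademacher {..<d})))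
      (\<lambda>g. op_trace r (multi_update r (\<lambda>v. v) (\<lambda>j. 2 * s * fst (g j)) (\<lambda>j. ?X (snd (g j))) k ^^ n))
      \<le> r * exp (a * k / 8)"
      by (rule expectation_trace_dense_le[OF frame r _ s(1) s(2), where R = R]) (use a ksR bdy k in auto)
    show "0 \<le> E (Pi_pmf {..<k} (0, \<lambda>_. 0) (\<lambda>_. pair_pmf sign_pmf (rademacher {..<d})))
      (\<lambda>g. op_trace r (multi_update r (\<lambda>v. v) (\<lambda>j. 2 * s * fst (g j)) (\<lambda>j. ?X (snd (g j))) k ^^ n))"
    proof (rule integral_nonneg_AE, rule AE_pmfI)
      fix g assume "g \<in> set_pmf (Pi_pmf {..<k} (0, \<lambda>_. 0) (\<lambda>_. pair_pmf sign_pmf (rademacher {..<d})))"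
      then have "g j \<in> set_pmf (pair_pmf sign_pmf (rademacher {..<d}))" if "j < k" for j
        using that by (auto simp: set_Pi_pmf PiE_dflt_def simp del: set_pair_pmf)
      then have "\<bar>fst (g j)\<bar> = 1" "sqn r (?X (snd (g j))) \<le> R" if "j < k" for j
        using that by (fastforce simp: set_sign_pmf intro!: bdy)+
      then have "near_id r (0 + k * (2 * s * R)) (multi_update r (\<lambda>v. v) (\<lambda>j. 2 * s * fst (g j)) (\<lambda>j. ?X (snd (g j))) k)"
        using s by (intro near_id_multi_update near_id_id) (auto simp: abs_mult intro!: mult_left_mono)
      then show "0 \<le> op_trace r (multi_update r (\<lambda>v. v) (\<lambda>j. 2 * s * fst (g j)) (\<lambda>j. ?X (snd (g j))) k ^^ n)"
        by (rule op_trace_nonneg[OF near_id_psd]) (use ksR in linarith)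
    qed
  qed simp
  also have "\<dots> = r * exp (- (5 / 8 * \<theta>))"
    by (simp add: exp_of_nat_mult[symmetric] th(2) exp_add[symmetric] mult_ac)
  finally have "c * measure_pmf.prob ?P ?bad \<le> r * exp (- (5 / 8 * \<theta>))" .
  then have "exp (9 / 16 * \<theta>) * (c * measure_pmf.prob ?P ?bad) \<le> exp (9 / 16 * \<theta>) * (r * exp (- (5 / 8 * \<theta>)))"
    by (intro mult_left_mono) auto
  moreover have "exp (9 / 16 * \<theta>) * (c * p) = p" for p
    by (simp add: c_def mult.assoc[symmetric] exp_add[symmetric])
  moreover have "exp (9 / 16 * \<theta>) * (r * exp (- (5 / 8 * \<theta>))) = r * exp (- (1 / 16 * \<theta>))"
  proof -
    have "9 / 16 * \<theta> + - (5 / 8 * \<theta>) = - (1 / 16 * \<theta>)" by simp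
    then have "exp (9 / 16 * \<theta>) * exp (- (5 / 8 * \<theta>)) = exp (- (1 / 16 * \<theta>))"
      by (simp only: exp_add[symmetric])
    then show ?thesis by (simp only: mult.left_commute[of _ "real r"])
  qed
  ultimately have "measure_pmf.prob ?P ?bad \<le> r * exp (- (1 / 16 * \<theta>))"
    by (simp only:)
  also have "\<dots> \<le> exp L * exp (- (7 * L))"
    using L2(2) by (simp add: \<theta>_def mult_right_mono)
  also have "\<dots> = exp (- (6 * L))" by (simp add: exp_add[symmetric])
  also have "\<dots> \<le> exp (- (6 * ln 2))" using L2(1) by simp
  also have "\<dots> = 1 / 64"
  proof -
    have "exp (6 * ln 2 :: real) = exp (ln 2) ^ 6" by (simp only: exp_of_nat_mult[symmetric] of_nat_numeral)
    then show ?thesis by (simp add: exp_minus)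
  qed
  finally show ?thesis by simp
qed

section \<open>Real and complex matrices\<close>

lemma sign_pmf_of_real: "map_pmf (of_real :: real \<Rightarrow> 'a :: real_normed_field) sign_pmf = pmf_of_set {- 1, 1}"
  unfolding sign_pmf_def by (subst map_pmf_of_set_inj) (auto simp: inj_on_def)

text \<open>Signs and scaling are real, so over either field the column is the image of the real law
  under \<open>of_real\<close>, which also respects the default 0 of the signs.\<close>

lemma sparse_vec_pmf_sparse_law:
  assumes "\<xi> \<le> d"
  shows "(sparse_vec_pmf d \<xi> :: 'a :: real_normed_field vec pmf) =
    map_pmf (\<lambda>w. vec d (\<lambda>l. of_real (w l))) (sparse_law d \<xi>)"
proof -
  have P: "Pi_pmf {..<\<xi>} 0 (\<lambda>_. pmf_of_set {- 1, 1 :: 'a}) =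
      map_pmf (\<lambda>h. of_real \<circ> h) (rademacher {..<\<xi>})"
    unfolding sign_pmf_of_real[symmetric] rademacher_def by (subst Pi_pmf_map[where dflt = 0]) auto
  have V: "of_real (sqrt (real d / real \<xi>)) \<cdot>\<^sub>v
        vec d (\<lambda>l. \<Sum>i<\<xi>. (of_real \<circ> \<rho>) i * unit_vec d (s ! i) $ l) =
      (vec d (\<lambda>l. of_real (sqrt (real d / real \<xi>) * (\<Sum>i<\<xi>. \<rho> i * (if s ! i = l then 1 else 0)))) :: 'a vec)"
    if "s \<in> distinct_lists d \<xi>" for \<rho> s
  proof (rule eq_vecI)
    fix l assume "l < dim_vec (vec d (\<lambda>l. of_real (sqrt (real d / real \<xi>) *
      (\<Sum>i<\<xi>. \<rho> i * (if s ! i = l then 1 else 0)))) :: 'a vec)"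
    then have l: "l < d" by simp
    have "(unit_vec d (s ! i) $ l :: 'a) = (if s ! i = l then 1 else 0)" if "i < \<xi>" for i
    proof -
      have "s ! i < d" using that \<open>s \<in> distinct_lists d \<xi>\<close> by (auto simp: distinct_lists_def dest: nth_mem)
      then show ?thesis using l by auto
    qed
    then have "(\<Sum>i<\<xi>. (of_real \<circ> \<rho>) i * unit_vec d (s ! i) $ l) =
        (\<Sum>i<\<xi>. of_real (\<rho> i * (if s ! i = l then 1 else 0)) :: 'a)"
      by (intro sum.cong refl) simp
    then show "(of_real (sqrt (real d / real \<xi>)) \<cdot>\<^sub>v
        vec d (\<lambda>l. \<Sum>i<\<xi>. (of_real \<circ> \<rho>) i * unit_vec d (s ! i) $ l)) $ l =
      (vec d (\<lambda>l. of_real (sqrt (real d / real \<xi>) * (\<Sum>i<\<xi>. \<rho> i * (if s ! i = l then 1 else 0)))) :: 'a vec) $ l"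
      using l by simp
  qed simp
  show ?thesis
    unfolding sparse_vec_pmf_def sparse_law_def P map_bind_pmf bind_map_pmf map_return_pmf
      distinct_lists_def[symmetric]
    by (intro bind_pmf_cong refl arg_cong[where f = return_pmf] V)
      (simp add: finite_distinct_lists distinct_lists_nonempty[OF assms])
qed

lemma sparse_col_pmf_sparse_law:
  assumes "\<xi> \<le> d"
  shows "(sparse_col_pmf d k \<xi> :: 'a :: real_normed_field mat pmf) =
    map_pmf (\<lambda>\<omega>. mat d k (\<lambda>(l, j). of_real (\<omega> j l / sqrt (real k))))
      (Pi_pmf {..<k} (\<lambda>_. 0) (\<lambda>_. sparse_law d \<xi>))"
proof -
  let ?v = "\<lambda>w. vec d (\<lambda>l. of_real (w l)) :: 'a vec"
  have z: "?v (\<lambda>_. 0) = 0\<^sub>v d" by auto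
  have P: "Pi_pmf {..<k} (0\<^sub>v d) (\<lambda>_. sparse_vec_pmf d \<xi> :: 'a vec pmf) =
      map_pmf (\<lambda>h. ?v \<circ> h) (Pi_pmf {..<k} (\<lambda>_. 0) (\<lambda>_. sparse_law d \<xi>))"
    unfolding sparse_vec_pmf_sparse_law[OF assms] by (rule Pi_pmf_map[where f = ?v and dflt = "\<lambda>_. 0", OF finite_lessThan z])
  have "of_real (1 / sqrt (real k)) \<cdot>\<^sub>m mat_of_cols d (map (?v \<circ> \<omega>) [0..<k]) =
      (mat d k (\<lambda>(l, j). of_real (\<omega> j l / sqrt (real k))) :: 'a mat)" for \<omega>
    by (rule eq_matI) (auto simp: mat_of_cols_index of_real_divide)
  then show ?thesis
    unfolding sparse_col_pmf_def P by (simp add: pmf.map_comp o_def)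
qed

lemma mat_adjoint_carrier: "A \<in> carrier_mat m n \<Longrightarrow> mat_adjoint A \<in> carrier_mat n m"
  unfolding mat_adjoint_def by auto

lemma mat_adjoint_index:
  assumes "A \<in> carrier_mat m n" "i < n" "j < m"
  shows "mat_adjoint A $$ (i, j) = conjugate (A $$ (j, i))"
  using assms unfolding mat_adjoint_def by (simp add: mat_of_rows_index)

lemma l2_norm_square: "(l2_norm v)\<^sup>2 = (\<Sum>i<dim_vec v. (norm (v $ i))\<^sup>2)"
  by (simp add: l2_norm_def L2_set_def sum_nonneg)

lemma mult_mat_vec_index_sum:
  assumes "A \<in> carrier_mat m n" "u \<in> carrier_vec n" "j < m"
  shows "(A *\<^sub>v u) $ j = (\<Sum>i<n. A $$ (j, i) * u $ i)"
  using assms by (simp add: scalar_prod_def lessThan_atLeast0)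

text \<open>A lower bound on all values passes to the infimum once the unit sphere is nonempty; the
  first unit vector is a point of it.\<close>

lemma sigma_min_square_ge:
  fixes M :: "'a :: real_normed_field mat"
  assumes dim: "1 \<le> dim_col M"
    and lower: "\<And>u. u \<in> carrier_vec (dim_col M) \<Longrightarrow> l2_norm u = 1 \<Longrightarrow> c \<le> (l2_norm (M *\<^sub>v u))\<^sup>2"
    and c: "0 \<le> c"
  shows "c \<le> (sigma_min M)\<^sup>2"
proof -
  have "(l2_norm (unit_vec (dim_col M) 0 :: 'a vec))\<^sup>2 = 1"
  proof -
    have "(\<Sum>i<dim_col M. (norm ((unit_vec (dim_col M) 0 :: 'a vec) $ i))\<^sup>2) = (\<Sum>i<dim_col M. if i = 0 then 1 else 0)"
      using dim by (intro sum.cong refl) auto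
    then show ?thesis using dim by (simp add: l2_norm_square)
  qed
  moreover have "0 \<le> l2_norm (unit_vec (dim_col M) 0 :: 'a vec)" by (simp add: l2_norm_def)
  ultimately have unit: "l2_norm (unit_vec (dim_col M) 0 :: 'a vec) = 1"
    by (metis abs_of_nonneg power2_eq_1_iff abs_neg_one abs_one)
  have "sqrt c \<le> sigma_min M"
    unfolding sigma_min_def
  proof (rule cINF_greatest)
    have "(unit_vec (dim_col M) 0 :: 'a vec) \<in> {u \<in> carrier_vec (dim_col M). l2_norm u = 1}" using unit by simp
    then show "{u \<in> carrier_vec (dim_col M). l2_norm (u :: 'a vec) = 1} \<noteq> {}" by blast
    fix u :: "'a vec" assume "u \<in> {u \<in> carrier_vec (dim_col M). l2_norm u = 1}"
    then have "c \<le> (l2_norm (M *\<^sub>v u))\<^sup>2" using lower by blast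
    moreover have "0 \<le> l2_norm (M *\<^sub>v u)" by (simp add: l2_norm_def)
    ultimately show "sqrt c \<le> l2_norm (M *\<^sub>v u)" by (intro real_le_lsqrt) auto
  qed
  then have "(sqrt c)\<^sup>2 \<le> (sigma_min M)\<^sup>2" using c by (intro power_mono) auto
  then show ?thesis using c by simp
qed

text \<open>Both scalar fields are treated inside the complex numbers. The embedding takes unit
  vectors to unit vectors, so a bound over all complex directions also covers real matrices.\<close>

locale conjugation_embedding =
  fixes emb :: "'a :: {conjugatable_field, real_normed_field} \<Rightarrow> complex"
  assumes emb_add: "emb (x + y) = emb x + emb y"
    and emb_mult: "emb (x * y) = emb x * emb y"
    and emb_of_real: "emb (of_real c) = of_real c"
    and emb_conjugate: "emb (conjugate x) = cnj (emb x)"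
    and emb_norm: "cmod (emb x) = norm x"
begin

lemma emb_0: "emb 0 = 0" and emb_1: "emb 1 = 1"
  using emb_of_real[of 0] emb_of_real[of 1] by simp_all

lemma emb_sum: "emb (sum f A) = (\<Sum>i\<in>A. emb (f i))"
  by (induction A rule: infinite_finite_induct) (simp_all add: emb_0 emb_add)

lemma conjugate_sparse: "emb (conjugate (of_real c)) = of_real c"
  by (simp add: emb_conjugate emb_of_real)

lemma tight_frame_of_orthonormal:
  assumes "Q \<in> carrier_mat d r" "orthonormal_columns Q"
  shows "tight_frame d r (\<lambda>l i. cnj (emb (Q $$ (l, i))))"
  unfolding tight_frame_def
proof (intro allI impI)
  fix i j assume ij: "i < r" "j < r"
  have "(mat_adjoint Q * Q) $$ (i, j) = (\<Sum>l<d. conjugate (Q $$ (l, i)) * Q $$ (l, j))"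
    using assms(1) ij mat_adjoint_carrier[OF assms(1)]
    by (simp add: scalar_prod_def mat_adjoint_index[OF assms(1)] lessThan_atLeast0)
  moreover have "mat_adjoint Q * Q = 1\<^sub>m r"
    using assms by (simp add: orthonormal_columns_def)
  ultimately have "(\<Sum>l<d. conjugate (Q $$ (l, i)) * Q $$ (l, j)) = (if i = j then 1 else 0)"
    using ij by simp
  from arg_cong[OF this, of emb]
  show "(\<Sum>l<d. cnj (emb (Q $$ (l, i))) * cnj (cnj (emb (Q $$ (l, j))))) = (if i = j then 1 else 0)"
    by (simp add: emb_sum emb_mult emb_conjugate emb_0 emb_1 split: if_splits)
qed

text \<open>\<open>cip\<close> conjugates its left argument, which undoes the conjugation of the
  rows of \<open>Q\<close>; the normalisation of \<open>S\<close> becomes the division by k.\<close>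

lemma l2_norm_square_sparse_embedding:
  assumes Q: "Q \<in> carrier_mat d r" and u: "u \<in> carrier_vec r"
    and S: "S = (mat d k (\<lambda>(l, j). of_real (\<omega> j l / sqrt (real k))) :: 'a mat)"
  shows "(l2_norm ((mat_adjoint S * Q) *\<^sub>v u))\<^sup>2 =
    (\<Sum>j<k. (cmod (cip r (frame_comb d (\<lambda>l i. cnj (emb (Q $$ (l, i)))) (\<omega> j)) (\<lambda>i. emb (u $ i))))\<^sup>2) / k"
proof -
  have Sc: "S \<in> carrier_mat d k" by (simp add: S)
  note Sa = mat_adjoint_carrier[OF Sc]
  have entry: "(mat_adjoint S * Q) $$ (j, i) = (\<Sum>l<d. conjugate (of_real (\<omega> j l / sqrt (real k))) * Q $$ (l, i))"
    if "j < k" "i < r" for j i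
    using that Q Sa
    by (simp add: scalar_prod_def mat_adjoint_index[OF Sc] lessThan_atLeast0) (simp add: S)
  have coord: "cmod (emb (((mat_adjoint S * Q) *\<^sub>v u) $ j)) =
      cmod (cip r (frame_comb d (\<lambda>l i. cnj (emb (Q $$ (l, i)))) (\<omega> j)) (\<lambda>i. emb (u $ i))) / sqrt k"
    if "j < k" for j
  proof -
    have "((mat_adjoint S * Q) *\<^sub>v u) $ j = (\<Sum>i<r. (mat_adjoint S * Q) $$ (j, i) * u $ i)"
      by (rule mult_mat_vec_index_sum[OF mult_carrier_mat[OF Sa Q] u that])
    also have "\<dots> = (\<Sum>i<r. (\<Sum>l<d. conjugate (of_real (\<omega> j l / sqrt (real k))) * Q $$ (l, i)) * u $ i)"
      using that by (intro sum.cong refl) (simp add: entry)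
    finally have "emb (((mat_adjoint S * Q) *\<^sub>v u) $ j) =
        (\<Sum>i<r. (\<Sum>l<d. of_real (\<omega> j l / sqrt (real k)) * emb (Q $$ (l, i))) * emb (u $ i))"
      by (simp add: emb_sum emb_mult conjugate_sparse del: of_real_divide)
    also have "\<dots> = of_real (1 / sqrt k) *
        cip r (frame_comb d (\<lambda>l i. cnj (emb (Q $$ (l, i)))) (\<omega> j)) (\<lambda>i. emb (u $ i))"
      unfolding cip_def frame_comb_def by (simp add: sum_distrib_left sum_distrib_right mult_ac)
    finally show ?thesis by (simp add: norm_mult norm_divide)
  qed
  have "dim_vec ((mat_adjoint S * Q) *\<^sub>v u) = k" using Sa by simp
  then have "(l2_norm ((mat_adjoint S * Q) *\<^sub>v u))\<^sup>2 = (\<Sum>j<k. (cmod (emb (((mat_adjoint S * Q) *\<^sub>v u) $ j)))\<^sup>2)"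
    by (simp add: l2_norm_square emb_norm)
  also have "\<dots> = (\<Sum>j<k. (cmod (cip r (frame_comb d (\<lambda>l i. cnj (emb (Q $$ (l, i)))) (\<omega> j)) (\<lambda>i. emb (u $ i))))\<^sup>2 / k)"
    by (intro sum.cong refl) (simp add: coord power_divide)
  finally show ?thesis by (simp add: sum_divide_distrib)
qed

text \<open>\<xi> is the number \<open>x\<close> rounded up and truncated at d. The factor 3 pays
  for the rounding, since x \<ge> 1/2 gives x + 1 \<le> 3 x.\<close>

lemma sparse_col_subspace_injection:
  fixes Q :: "'a mat"
  assumes r: "1 \<le> r" and Q: "Q \<in> carrier_mat d r" and on: "orthonormal_columns Q"
  shows "\<exists>k \<xi>. admissible_parameters 3000000 3 d r (coherence Q) k \<xi> \<and>
    measure_pmf.prob (sparse_col_pmf d k \<xi>) {S. (sigma_min (mat_adjoint S * Q))\<^sup>2 \<ge> 1 / 2} \<ge> 39 / 40"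
proof -
  define q where "q = (\<lambda>l i. cnj (emb (Q $$ (l, i))))"
  define L where "L = ln (max 2 (real r))"
  define \<mu> where "\<mu> = coherence Q"
  define k where "k = 3000000 * r"
  have frame: "tight_frame d r q" unfolding q_def by (rule tight_frame_of_orthonormal[OF Q on])
  have row: "(l2_norm (row Q l))\<^sup>2 = sqn r (q l)" if "l < d" for l
    using Q that by (simp add: l2_norm_square sqn_def q_def emb_norm)
  have \<mu>: "\<mu> = (MAX l\<in>{..<d}. sqn r (q l))"
    unfolding \<mu>_def coherence_def using Q by (intro arg_cong[of _ _ Max] image_cong) (auto simp: row)
  have total: "(\<Sum>l<d. sqn r (q l)) = real r" by (rule tight_frame_sum_sqn[OF frame])
  have d: "1 \<le> d" using total r by (cases "d = 0") auto
  have le\<mu>: "sqn r (q l) \<le> \<mu>" if "l < d" for l unfolding \<mu> using that by (intro Max_ge) auto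
  have \<mu>1: "\<mu> \<le> 1" unfolding \<mu> using d tight_frame_sqn_le_1[OF frame] by (subst Max_le_iff) (auto simp: lessThan_empty_iff)
  \<comment> \<open>The squared row norms sum to r, so the coherence is at least r / d; this keeps
    \<open>x\<close> away from 0.\<close>
  have "real r \<le> (\<Sum>l<d. \<mu>)" unfolding total[symmetric] by (intro sum_mono le\<mu>) simp
  then have d\<mu>: "real r \<le> d * \<mu>" by simp
  have \<mu>0: "0 < \<mu>" 
  proof (rule ccontr)
    assume "\<not> 0 < \<mu>"
    then have "d * \<mu> \<le> 0" by (simp add: mult_nonneg_nonpos)
    then show False using d\<mu> r by simp
  qed
  have L: "1 / 2 \<le> L" "L \<le> r"
  proof -
    have "1 / 2 \<le> ln (2::real)" using ln2_ge_two_thirds by simp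
    also have "\<dots> \<le> L" unfolding L_def by simp
    finally show "1 / 2 \<le> L" .
    have "L \<le> max 2 (real r) - 1" unfolding L_def by (rule ln_le_minus_one) simp
    also have "\<dots> \<le> r" using r by (simp add: max_def)
    finally show "L \<le> r" .
  qed
  define x where "x = real d / real r * \<mu> * L"
  have x: "1 / 2 \<le> x"
  proof -
    have "1 * L \<le> (d * \<mu> / r) * L" using d\<mu> r L by (intro mult_right_mono) (auto simp: field_simps)
    also have "(d * \<mu> / r) * L = x" by (simp add: x_def)
    finally show ?thesis using L by linarith
  qed
  define \<xi> where "\<xi> = min d (nat \<lceil>x\<rceil>)"
  have xi: "1 \<le> \<xi>" "\<xi> \<le> d" using d x unfolding \<xi>_def by linarith+
  have "real \<xi> \<le> real (nat \<lceil>x\<rceil>)" unfolding \<xi>_def by simp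
  also have "\<dots> \<le> x + 1" using x by linarith
  also have "\<dots> \<le> 3 * x" using x by simp
  finally have xi_le: "real \<xi> \<le> 3 * x" .
  \<comment> \<open>Either \<xi> = d, where L \<le> r and \<mu> \<le> 1 suffice, or \<xi> \<ge> x,
    where the left side is at most 112 / 3000000.\<close>
  have key: "112 * L / k * (d / \<xi>) * \<mu> \<le> 1 / 8"
  proof (cases "\<xi> = d")
    case True
    have "112 * L / k * (d / \<xi>) * \<mu> = 112 * L / k * \<mu>" using True d by simp
    also have "\<dots> \<le> 112 * L / k * 1" using L by (intro mult_left_mono \<mu>1) auto
    also have "\<dots> \<le> 1 / 8" using L r by (simp add: k_def field_simps)
    finally show ?thesis .
  next
    case False
    then have "\<xi> = nat \<lceil>x\<rceil>" unfolding \<xi>_def by linarith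
    then have "x \<le> \<xi>" by linarith
    have "112 * L / k * (d / \<xi>) * \<mu> = 112 / 3000000 * (x / \<xi>)"
      using r by (simp add: k_def x_def mult_ac)
    also have "\<dots> \<le> 112 / 3000000 * 1" using \<open>x \<le> \<xi>\<close> x by (intro mult_left_mono) auto
    finally show ?thesis by simp
  qed
  let ?P = "Pi_pmf {..<k} (\<lambda>_. 0) (\<lambda>_. sparse_law d \<xi>)"
  let ?bad = "{\<omega>. \<exists>u. sqn r u = 1 \<and> (\<Sum>j<k. (cmod (cip r (frame_comb d q (\<omega> j)) u))\<^sup>2) < k / 2}"
  let ?mat = "\<lambda>\<omega>. mat d k (\<lambda>(l, j). of_real (\<omega> j l / sqrt (real k))) :: 'a mat"
  let ?good = "{S. (sigma_min (mat_adjoint S * Q))\<^sup>2 \<ge> 1 / 2}"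
  have k0: "real k > 0" using r by (simp add: k_def)
  have bad: "measure_pmf.prob ?P ?bad \<le> 1 / 40"
    by (rule sparse_law_lower_bound[OF frame r xi k_def le\<mu>]) (use key in \<open>simp_all add: L_def\<close>)
  have good: "?mat \<omega> \<in> ?good" if "\<omega> \<notin> ?bad" for \<omega>
  proof -
    let ?S = "?mat \<omega>"
    have Sa: "mat_adjoint ?S \<in> carrier_mat k d" by (rule mat_adjoint_carrier) simp
    have dim: "dim_col (mat_adjoint ?S * Q) = r" using Q by simp
    have "1 / 2 \<le> (sigma_min (mat_adjoint ?S * Q))\<^sup>2"
    proof (rule sigma_min_square_ge)
      fix u :: "'a vec" assume "u \<in> carrier_vec (dim_col (mat_adjoint ?S * Q))" "l2_norm u = 1"
      then have u: "u \<in> carrier_vec r" "l2_norm u = 1" using dim by auto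
      have "sqn r (\<lambda>i. emb (u $ i)) = 1"
        using l2_norm_square[of u] u by (simp add: sqn_def emb_norm)
      then have "k / 2 \<le> (\<Sum>j<k. (cmod (cip r (frame_comb d q (\<omega> j)) (\<lambda>i. emb (u $ i))))\<^sup>2)"
        using that by (auto simp: not_less)
      then show "1 / 2 \<le> (l2_norm ((mat_adjoint ?S * Q) *\<^sub>v u))\<^sup>2"
        unfolding l2_norm_square_sparse_embedding[OF Q u(1) refl] q_def using k0 by (simp add: field_simps)
    qed (use dim r in auto)
    then show ?thesis by simp
  qed
  have "39 / 40 \<le> 1 - measure_pmf.prob ?P ?bad" using bad by simp
  also have "\<dots> = measure_pmf.prob ?P (- ?bad)"
    by (simp add: measure_pmf.prob_compl[of ?bad ?P, simplified, symmetric] Compl_eq_Diff_UNIV)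
  also have "\<dots> \<le> measure_pmf.prob ?P (?mat -` ?good)"
    using good by (intro measure_pmf.finite_measure_mono) auto
  also have "\<dots> = measure_pmf.prob (sparse_col_pmf d k \<xi>) ?good"
    unfolding sparse_col_pmf_sparse_law[OF xi(2)] by simp
  finally have "39 / 40 \<le> measure_pmf.prob (sparse_col_pmf d k \<xi>) ?good" .
  moreover have "admissible_parameters 3000000 3 d r (coherence Q) k \<xi>"
    unfolding admissible_parameters_def using r xi xi_le
    by (simp add: k_def x_def L_def \<mu>_def)
  ultimately show ?thesis by blast
qed

end

interpretation real_embedding: conjugation_embedding "of_real :: real \<Rightarrow> complex"
  by unfold_locales auto

interpretation complex_embedding: conjugation_embedding "\<lambda>z :: complex. z"
  by unfold_locales auto

theorem theorem4p4:
  shows "\<exists>A B :: real.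
    (\<forall>d r. \<forall>Q :: real mat.
       1 \<le> r \<and> Q \<in> carrier_mat d r \<and> orthonormal_columns Q \<longrightarrow>
       (\<exists>k \<xi>. admissible_parameters A B d r (coherence Q) k \<xi> \<and>
          measure_pmf.prob (sparse_col_pmf d k \<xi>)
            {S. (sigma_min (mat_adjoint S * Q))\<^sup>2 \<ge> 1 / 2} \<ge> 39 / 40)) \<and>
    (\<forall>d r. \<forall>Q :: complex mat.
       1 \<le> r \<and> Q \<in> carrier_mat d r \<and> orthonormal_columns Q \<longrightarrow>
       (\<exists>k \<xi>. admissible_parameters A B d r (coherence Q) k \<xi> \<and>
          measure_pmf.prob (sparse_col_pmf d k \<xi>)
            {S. (sigma_min (mat_adjoint S * Q))\<^sup>2 \<ge> 1 / 2} \<ge> 39 / 40))"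
  using real_embedding.sparse_col_subspace_injection complex_embedding.sparse_col_subspace_injection
  by blast

end
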